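(* Let $n\geqslant 1$ be an integer, let $\mathcal{M}$ be a type $\mathrm{I}_n$ von Neumann algebra, and let $T_1,T_2\in\mathcal{M}$ be such that $T_1\oplus T_1\sim T_2\oplus T_2$ in $\mathbb{M}_2(\mathcal{M})$. If $T_1$ has property $(J)$ in $\mathcal{M}$, then $T_1\sim T_2$ in $\mathcal{M}$.
   Context: For a unital algebra $\mathcal{N}$ and $A,B\in\mathcal{N}$, write $A\sim B$ in $\mathcal{N}$ (similar) if there is an invertible $X\in\mathcal{N}$ with $XAX^{-1}=B$. For $T\in\mathcal{M}$, $T\oplus T$ denotes the diagonal matrix $\begin{pmatrix}T&0\\0&T\end{pmatrix}\in\mathbb{M}_2(\mathcal{M})$. $\{T\}'\cap\mathcal{M}$ is the set of elements of $\mathcal{M}$ commuting with $T$. An idempotent is an element $P$ with $P^2=P$ (not necessarily self-adjoint). An abelian family of idempotents is a set of pairwise commuting idempotents. An operator $T$ in a von Neumann algebra $\mathcal{M}$ has property $(J)$ if there exists a bounded (in operator norm) family of idempotents in $\{T\}'\cap\mathcal{M}$ that is maximal (under inclusion) among all abelian families of idempotents in $\{T\}'\cap\mathcal{M}$. A type $\mathrm{I}_n$ von Neumann algebra is one isomorphic to $\mathbb{M}_n(\mathcal{A})$ with $\mathcal{A}$ an abelian von Neumann algebra (not assumed to act on a separable space). *)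

theory Defs
  imports
    "HOL-Analysis.Bounded_Linear_Function"
    "HOL-Algebra.QuotRing"
    "Jordan_Normal_Form.Matrix"
begin

section \<open>Complex Hilbert spaces\<close>

class complex_vector = real_vector +
  fixes scaleC :: "complex \<Rightarrow> 'a \<Rightarrow> 'a" (infixr "*\<^sub>C" 75)
  assumes scaleC_add_right: "a *\<^sub>C (x + y) = a *\<^sub>C x + a *\<^sub>C y"
    and scaleC_add_left: "(a + b) *\<^sub>C x = a *\<^sub>C x + b *\<^sub>C x"
    and scaleC_scaleC: "a *\<^sub>C b *\<^sub>C x = (a * b) *\<^sub>C x"
    and scaleC_one: "1 *\<^sub>C x = x"
    and scaleR_scaleC: "r *\<^sub>R x = complex_of_real r *\<^sub>C x"

text \<open>The inner product is linear in the first argument. Positive definiteness is contained in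
  the last axiom, since the norm of a normed space is definite. The dimension is arbitrary: the
  space may be non-separable, and it may be zero.\<close>

class complex_hilbert = complex_vector + banach +
  fixes cinner :: "'a \<Rightarrow> 'a \<Rightarrow> complex"
  assumes cinner_commute: "cinner x y = cnj (cinner y x)"
    and cinner_add_left: "cinner (x + y) z = cinner x z + cinner y z"
    and cinner_scaleC_left: "cinner (a *\<^sub>C x) y = a * cinner x y"
    and cinner_self: "cinner x x = complex_of_real ((norm x)\<^sup>2)"

section \<open>Bounded operators\<close>

typedef (overloaded) 'h bop =
  "{A :: 'h::complex_hilbert \<Rightarrow>\<^sub>L 'h. \<forall>c x. blinfun_apply A (c *\<^sub>C x) = c *\<^sub>C blinfun_apply A x}"
  morphisms blinfun_of_bop Bop
proof
  show "id_blinfun \<in> {A :: 'h \<Rightarrow>\<^sub>L 'h. \<forall>c x. blinfun_apply A (c *\<^sub>C x) = c *\<^sub>C blinfun_apply A x}"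
    by simp
qed

setup_lifting type_definition_bop

lift_definition bop_apply :: "'h::complex_hilbert bop \<Rightarrow> 'h \<Rightarrow> 'h" is blinfun_apply .

lemma bop_eqI: "(\<And>x. bop_apply A x = bop_apply B x) \<Longrightarrow> A = B"
  by transfer (rule blinfun_eqI)

lemma scaleC_zero_right: "a *\<^sub>C (0 :: 'a::complex_vector) = 0"
  using scaleC_add_right[of a 0 0] by simp

lemma scaleC_minus_right: "a *\<^sub>C (- x) = - (a *\<^sub>C (x :: 'a::complex_vector))"
  using scaleC_add_right[of a x "- x"] by (simp add: scaleC_zero_right eq_neg_iff_add_eq_0 add.commute)

lemma scaleC_diff_right: "a *\<^sub>C (x - y) = a *\<^sub>C x - a *\<^sub>C (y :: 'a::complex_vector)"
  using scaleC_add_right[of a x "- y"] by (simp add: scaleC_minus_right)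

lemma norm_scaleC: "norm (a *\<^sub>C x) = cmod a * norm (x :: 'a::complex_hilbert)"
proof -
  have "cinner (a *\<^sub>C x) (a *\<^sub>C x) = a * cnj a * cinner x x"
    using cinner_commute[of x "a *\<^sub>C x"] cinner_commute[of x x]
    by (simp add: cinner_scaleC_left)
  also have "\<dots> = complex_of_real ((cmod a * norm x)\<^sup>2)"
    by (simp add: cinner_self complex_norm_square power_mult_distrib del: of_real_power)
  finally have "(norm (a *\<^sub>C x))\<^sup>2 = (cmod a * norm x)\<^sup>2"
    by (simp only: cinner_self of_real_eq_iff)
  then show ?thesis
    by (simp add: power2_eq_iff_nonneg)
qed

lemma bounded_linear_scaleC: "bounded_linear (\<lambda>x :: 'a::complex_hilbert. a *\<^sub>C x)"
  by (rule bounded_linear_intro[where K = "cmod a"])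
    (simp_all add: scaleC_add_right scaleR_scaleC scaleC_scaleC norm_scaleC mult.commute)

instantiation bop :: (complex_hilbert) "{real_normed_algebra, monoid_mult}"
begin

lift_definition zero_bop :: "'a bop" is 0 by (simp add: scaleC_zero_right)
lift_definition one_bop :: "'a bop" is id_blinfun by simp
lift_definition plus_bop :: "'a bop \<Rightarrow> 'a bop \<Rightarrow> 'a bop" is "(+)"
  by (simp add: blinfun.add_left scaleC_add_right)
lift_definition minus_bop :: "'a bop \<Rightarrow> 'a bop \<Rightarrow> 'a bop" is "(-)"
  by (simp add: blinfun.diff_left scaleC_diff_right)
lift_definition uminus_bop :: "'a bop \<Rightarrow> 'a bop" is uminus
  by (simp add: blinfun.minus_left scaleC_minus_right)
lift_definition times_bop :: "'a bop \<Rightarrow> 'a bop \<Rightarrow> 'a bop" is "(o\<^sub>L)" by simp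
lift_definition scaleR_bop :: "real \<Rightarrow> 'a bop \<Rightarrow> 'a bop" is "(*\<^sub>R)"
  by (simp add: blinfun.scaleR_left scaleR_scaleC scaleC_scaleC mult.commute)
lift_definition norm_bop :: "'a bop \<Rightarrow> real" is norm .

definition dist_bop :: "'a bop \<Rightarrow> 'a bop \<Rightarrow> real"
  where "dist_bop A B = norm (A - B)"
definition sgn_bop :: "'a bop \<Rightarrow> 'a bop"
  where "sgn_bop A = inverse (norm A) *\<^sub>R A"
definition uniformity_bop :: "('a bop \<times> 'a bop) filter"
  where "uniformity_bop = (INF e\<in>{0 <..}. principal {(A, B). dist A B < e})"
definition open_bop :: "'a bop set \<Rightarrow> bool"
  where "open_bop U = (\<forall>A\<in>U. \<forall>\<^sub>F (A', B) in uniformity. A' = A \<longrightarrow> B \<in> U)"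

instance
proof
  fix A B C :: "'a bop" and r s :: real
  show "A + B + C = A + (B + C)" by transfer simp
  show "A + B = B + A" by transfer simp
  show "0 + A = A" by transfer simp
  show "- A + A = 0" by transfer simp
  show "A - B = A + - B" by transfer simp
  show "r *\<^sub>R (A + B) = r *\<^sub>R A + r *\<^sub>R B" by transfer (rule scaleR_add_right)
  show "(r + s) *\<^sub>R A = r *\<^sub>R A + s *\<^sub>R A" by transfer (rule scaleR_add_left)
  show "r *\<^sub>R s *\<^sub>R A = (r * s) *\<^sub>R A" by transfer simp
  show "1 *\<^sub>R A = A" by transfer simp
  show "A * B * C = A * (B * C)" by transfer (rule blinfun_eqI, simp)
  show "1 * A = A" by transfer (rule blinfun_eqI, simp)
  show "A * 1 = A" by transfer (rule blinfun_eqI, simp)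
  show "(A + B) * C = A * C + B * C" by transfer (rule blinfun_eqI, simp add: blinfun.add_left)
  show "A * (B + C) = A * B + A * C"
    by transfer (rule blinfun_eqI, simp add: blinfun.add_left blinfun.add_right)
  show "(r *\<^sub>R A) * B = r *\<^sub>R (A * B)"
    by transfer (rule blinfun_eqI, simp add: blinfun.scaleR_left)
  show "A * (r *\<^sub>R B) = r *\<^sub>R (A * B)"
    by transfer (rule blinfun_eqI, simp add: blinfun.scaleR_left blinfun.scaleR_right)
  show "dist A B = norm (A - B)" by (rule dist_bop_def)
  show "sgn A = inverse (norm A) *\<^sub>R A" by (rule sgn_bop_def)
  show "(uniformity :: ('a bop \<times> 'a bop) filter) = (INF e\<in>{0 <..}. principal {(x, y). dist x y < e})"
    by (rule uniformity_bop_def)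
  show "open U = (\<forall>x\<in>U. \<forall>\<^sub>F (x', y) in uniformity. x' = x \<longrightarrow> y \<in> U)" for U :: "'a bop set"
    by (rule open_bop_def)
  show "norm A = 0 \<longleftrightarrow> A = 0" by transfer simp
  show "norm (A + B) \<le> norm A + norm B" by transfer (rule norm_triangle_ineq)
  show "norm (r *\<^sub>R A) = \<bar>r\<bar> * norm A" by transfer simp
  show "norm (A * B) \<le> norm A * norm B" by transfer (rule norm_blinfun_compose)
qed

end

instantiation bop :: (complex_hilbert) complex_vector
begin

lift_definition scaleC_bop :: "complex \<Rightarrow> 'a bop \<Rightarrow> 'a bop"
  is "\<lambda>c A. blinfun_compose (Blinfun (\<lambda>x. c *\<^sub>C x)) A"
  by (simp add: bounded_linear_Blinfun_apply bounded_linear_scaleC scaleC_scaleC mult.commute)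

lemma bop_apply_scaleC: "bop_apply (c *\<^sub>C A) x = c *\<^sub>C bop_apply A x"
  by transfer (simp add: bounded_linear_Blinfun_apply bounded_linear_scaleC)

instance
proof
  fix A B :: "'a bop" and a b :: complex and r :: real
  have add: "bop_apply (C + D) x = bop_apply C x + bop_apply D x" for C D :: "'a bop" and x
    by transfer (rule blinfun.add_left)
  have scaleR: "bop_apply (s *\<^sub>R C) x = s *\<^sub>R bop_apply C x" for C :: "'a bop" and s x
    by transfer (rule blinfun.scaleR_left)
  show "a *\<^sub>C (A + B) = a *\<^sub>C A + a *\<^sub>C B"
    by (rule bop_eqI) (simp add: bop_apply_scaleC add scaleC_add_right)
  show "(a + b) *\<^sub>C A = a *\<^sub>C A + b *\<^sub>C A"
    by (rule bop_eqI) (simp add: bop_apply_scaleC add scaleC_add_left)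
  show "a *\<^sub>C b *\<^sub>C A = (a * b) *\<^sub>C A"
    by (rule bop_eqI) (simp add: bop_apply_scaleC scaleC_scaleC)
  show "1 *\<^sub>C A = A"
    by (rule bop_eqI) (simp add: bop_apply_scaleC scaleC_one)
  show "r *\<^sub>R A = complex_of_real r *\<^sub>C A"
    by (rule bop_eqI) (simp add: bop_apply_scaleC scaleR scaleR_scaleC)
qed

end

text \<open>The operator determined by the adjoint equation exists and is unique by the Riesz
  representation theorem, so the definite description is always defined.\<close>

definition adj :: "'h::complex_hilbert bop \<Rightarrow> 'h bop"
  where "adj A = (THE B. \<forall>x y. cinner (bop_apply A x) y = cinner x (bop_apply B y))"

section \<open>Von Neumann algebras\<close>

definition commutant :: "'h::complex_hilbert bop set \<Rightarrow> 'h bop set"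
  where "commutant S = {B. \<forall>A\<in>S. A * B = B * A}"

text \<open>A self-adjoint set that equals its double commutant is automatically a unital subalgebra.\<close>

definition von_neumann_algebra :: "'h::complex_hilbert bop set \<Rightarrow> bool"
  where "von_neumann_algebra M \<longleftrightarrow> (\<forall>A\<in>M. adj A \<in> M) \<and> commutant (commutant M) = M"

text \<open>The rings underlying \<open>M\<close> and the full matrix algebra over \<open>M\<close>, so that units and ring
  isomorphisms are those of \<open>HOL-Algebra\<close>.\<close>

definition op_ring :: "'h::complex_hilbert bop set \<Rightarrow> 'h bop ring"
  where "op_ring M = \<lparr>carrier = M, mult = (*), one = 1, zero = 0, add = (+)\<rparr>"

definition op_mat_ring :: "nat \<Rightarrow> 'h::complex_hilbert bop set \<Rightarrow> 'h bop mat ring"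
  where "op_mat_ring n M =
    \<lparr>carrier = {X \<in> carrier_mat n n. elements_mat X \<subseteq> M},
     mult = (*), one = 1\<^sub>m n, zero = 0\<^sub>m n n, add = (+)\<rparr>"

definition op_mat_adj :: "'h::complex_hilbert bop mat \<Rightarrow> 'h bop mat"
  where "op_mat_adj X = transpose_mat (map_mat adj X)"

definition star_iso_to_mat ::
    "('h::complex_hilbert bop \<Rightarrow> 'k::complex_hilbert bop mat) \<Rightarrow>
     'h bop set \<Rightarrow> nat \<Rightarrow> 'k bop set \<Rightarrow> bool"
  where "star_iso_to_mat \<phi> M n A \<longleftrightarrow>
    \<phi> \<in> ring_iso (op_ring M) (op_mat_ring n A) \<and>
    (\<forall>c. \<forall>S\<in>M. \<phi> (c *\<^sub>C S) = map_mat (\<lambda>a. c *\<^sub>C a) (\<phi> S)) \<and>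
    (\<forall>S\<in>M. \<phi> (adj S) = op_mat_adj (\<phi> S))"

text \<open>The abelian algebra may act on another Hilbert space than \<open>M\<close>; the type argument names it.\<close>

definition type_I_algebra ::
    "'k::complex_hilbert itself \<Rightarrow> nat \<Rightarrow> 'h::complex_hilbert bop set \<Rightarrow> bool"
  where "type_I_algebra _ n M \<longleftrightarrow> von_neumann_algebra M \<and>
    (\<exists>(A :: 'k bop set) \<phi>. von_neumann_algebra A \<and> (\<forall>a\<in>A. \<forall>b\<in>A. a * b = b * a) \<and>
      star_iso_to_mat \<phi> M n A)"

section \<open>Similarity and property (J)\<close>

definition similar_in :: "('a, 'b) monoid_scheme \<Rightarrow> 'a \<Rightarrow> 'a \<Rightarrow> bool"
  where "similar_in N A B \<longleftrightarrow> (\<exists>X\<in>Units N. X \<otimes>\<^bsub>N\<^esub> A \<otimes>\<^bsub>N\<^esub> inv\<^bsub>N\<^esub> X = B)"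

definition diag2 :: "'a::zero \<Rightarrow> 'a \<Rightarrow> 'a mat"
  where "diag2 S T = mat_of_rows_list 2 [[S, 0], [0, T]]"

definition abelian_idempotent_family :: "'a::times set \<Rightarrow> 'a set \<Rightarrow> bool"
  where "abelian_idempotent_family N F \<longleftrightarrow>
    F \<subseteq> N \<and> (\<forall>P\<in>F. P * P = P) \<and> (\<forall>P\<in>F. \<forall>Q\<in>F. P * Q = Q * P)"

definition property_J :: "'h::complex_hilbert bop set \<Rightarrow> 'h bop \<Rightarrow> bool"
  where "property_J M T \<longleftrightarrow>
    (\<exists>F. bounded F \<and> abelian_idempotent_family (commutant {T} \<inter> M) F \<and>
      (\<forall>G. abelian_idempotent_family (commutant {T} \<inter> M) G \<and> F \<subseteq> G \<longrightarrow> G = F))"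

end

theory Submission
  imports Defs "HOL-Analysis.Infinite_Sum"
begin

text \<open>
  Why the theorem holds. Write \<open>Z\<close> for the centre of \<open>M\<close> and \<open>B\<close> for its Boolean algebra of projections. A
  similarity between \<open>T1\<close> and \<open>T2\<close> may be built piecewise over finitely many orthogonal \<open>z \<in> B\<close>, so
  by compactness it suffices to find, for every ultrafilter \<open>U\<close> on \<open>B\<close>, some \<open>z \<in> U\<close> over which
  \<open>T1\<close> and \<open>T2\<close> are similar (\<open>ultrafilter_exists\<close>, \<open>isomorphic_add\<close>). This replaces the direct
  integral decomposition over the spectrum of \<open>Z\<close> and works without separability.

  Near \<open>U\<close> the claim is a Krull-Schmidt argument: in any ring, if \<open>E1\<close> is a finite orthogonal sum of
  idempotents with local corners, then \<open>2[E1] = 2[F1]\<close> implies \<open>[E1] = [F1]\<close> for classes of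
  idempotents up to isomorphism (\<open>halving\<close>). It is applied to the commutant of
  \<open>T1 \<oplus> T1\<close> in the matrices over \<open>M\<close>: conjugating the two coordinate projections by the given similarity
  makes the two copies of \<open>T2\<close> into idempotents of that same ring. Each isomorphism of
  idempotents is a genuine equation after multiplication by one \<open>z \<in> U\<close>, so no bound is lost.

  Property (J) provides the local summands. Let \<open>J U\<close> be the operators whose norm can be made
  arbitrarily small by a \<open>z \<in> U\<close>. The projections of \<open>Z\<close> separate the values of a central
  operator (\<open>sign_split\<close>), hence every central operator is a scalar modulo \<open>J U\<close>, and the matrix units
  make the quotient of \<open>M\<close> by \<open>J U\<close> finite-dimensional (\<open>dependent_mod_J\<close>). A bounded maximal
  family \<open>F\<close> therefore contains only boundedly many orthogonal members that are nonzero near \<open>U\<close>, and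
  \<open>1\<close> is near \<open>U\<close> a finite sum of members \<open>p\<close> that do not split there. Boundedness of \<open>F\<close> is what turns
  this pointwise statement into one over a whole \<open>z \<in> U\<close>: splittings of \<open>p\<close> over
  infinitely many orthogonal central projections add up strongly to a single operator, which lies in \<open>F\<close> by
  maximality (\<open>patch_split_system\<close>, \<open>unsplittable_uniform\<close>). So over some \<open>z\<close> every idempotent below \<open>p\<close>
  that commutes with \<open>T1\<close> is central in the corner. In the finite-dimensional quotient, each
  \<open>x\<close> of the corner splits off an idempotent on which it is invertible, leaving a nilpotent rest; the
  idempotent lifts, so it is \<open>0\<close> or \<open>p\<close> near \<open>U\<close>, and \<open>x\<close> or \<open>p - x\<close> is invertible there
  (\<open>locality\<close>).
\<close>

section \<open>Complex Hilbert spaces and adjoints\<close>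

text \<open>Turns a relation into a rewrite rule for right-nested products, so that products in a noncommutative
  ring can be reduced by the simplifier.\<close>
lemma mult_eq_ext: "a * b = c \<Longrightarrow> a * (b * t) = c * (t::'a::semigroup_mult)"
  by (simp add: mult.assoc[symmetric])

lemma commutes_mult:
  fixes a b c :: "'a::semigroup_mult"
  assumes "c * a = a * c" "c * b = b * c"
  shows "c * (a * b) = a * b * c"
  using assms by (metis mult.assoc)

lemma commutes_add: "c * a = a * c \<Longrightarrow> c * b = b * c \<Longrightarrow> c * (a + b) = (a + b) * (c::'a::ring)"
  by (simp add: distrib_left distrib_right)

lemma commutes_diff: "c * a = a * c \<Longrightarrow> c * b = b * c \<Longrightarrow> c * (a - b) = (a - b) * (c::'a::ring)"
  by (simp add: left_diff_distrib right_diff_distrib)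

lemma commutes_power: "c * a = a * c \<Longrightarrow> c * a ^ n = a ^ n * (c::'a::monoid_mult)"
  by (induction n) (simp_all add: commutes_mult)

lemma commutes_sum: "(\<And>i. i \<in> S \<Longrightarrow> c * f i = f i * c) \<Longrightarrow> c * sum f S = sum f S * (c::'a::ring)"
  by (simp add: sum_distrib_left sum_distrib_right)

lemmas commutes = commutes_mult commutes_add commutes_diff commutes_power commutes_sum

lemma cinner_add_right: "cinner x (y + z) = cinner x y + cinner x (z::'a::complex_hilbert)"
  by (metis cinner_commute cinner_add_left complex_cnj_add)

lemma cinner_scaleC_right: "cinner x (a *\<^sub>C y) = cnj a * cinner x (y::'a::complex_hilbert)"
  by (metis cinner_commute cinner_scaleC_left complex_cnj_mult)

lemma scaleC_zero_left: "0 *\<^sub>C (x::'a::complex_vector) = 0"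
  using scaleC_add_left[of 0 0 x] by simp

lemma scaleC_minus1: "(-1) *\<^sub>C (x::'a::complex_vector) = - x"
  using scaleR_scaleC[of "-1" x] by simp

lemma scaleC_minus_left: "(- a) *\<^sub>C (x::'a::complex_vector) = - (a *\<^sub>C x)"
  using scaleC_scaleC[of "-1" a x] by (simp add: scaleC_minus1)

lemma scaleC_sum_right: "c *\<^sub>C sum f S = (\<Sum>s\<in>S. c *\<^sub>C (f s :: 'a::complex_vector))"
  by (induction S rule: infinite_finite_induct) (auto simp: scaleC_add_right scaleC_zero_right)

lemma scaleC_sum_left: "sum g S *\<^sub>C (y :: 'a::complex_vector) = (\<Sum>s\<in>S. g s *\<^sub>C y)"
  by (induction S rule: infinite_finite_induct) (auto simp: scaleC_add_left scaleC_zero_left)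

lemma cinner_zero_left [simp]: "cinner 0 (x::'a::complex_hilbert) = 0"
  using cinner_add_left[of 0 0 x] by simp

lemma cinner_zero_right [simp]: "cinner (x::'a::complex_hilbert) 0 = 0"
  using cinner_add_right[of x 0 0] by simp

lemma cinner_minus_left: "cinner (- x) (y::'a::complex_hilbert) = - cinner x y"
  using cinner_add_left[of "-x" x y] by (simp add: eq_neg_iff_add_eq_0)

lemma cinner_minus_right: "cinner x (- y::'a::complex_hilbert) = - cinner x y"
  using cinner_add_right[of x "-y" y] by (simp add: eq_neg_iff_add_eq_0)

lemma cinner_diff_left: "cinner (x - y) (z::'a::complex_hilbert) = cinner x z - cinner y z"
  using cinner_add_left[of x "-y" z] by (simp add: cinner_minus_left)

lemma cinner_diff_right: "cinner z (x - y::'a::complex_hilbert) = cinner z x - cinner z y"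
  using cinner_add_right[of z x "-y"] by (simp add: cinner_minus_right)

lemmas cinner_simps = cinner_add_left cinner_add_right cinner_diff_left cinner_diff_right
  cinner_minus_left cinner_minus_right cinner_scaleC_left cinner_scaleC_right

lemma cinner_sum_left: "cinner (sum f I) (z::'a::complex_hilbert) = (\<Sum>i\<in>I. cinner (f i) z)"
  by (induction I rule: infinite_finite_induct) (auto simp: cinner_add_left)

lemma norm_sq_cinner: "(norm (x::'a::complex_hilbert))\<^sup>2 = Re (cinner x x)"
  by (simp add: cinner_self)

lemma norm_add_sq: "(norm (x + y::'a::complex_hilbert))\<^sup>2 = (norm x)\<^sup>2 + 2 * Re (cinner x y) + (norm y)\<^sup>2"
proof -
  have "Re (cinner y x) = Re (cinner x y)" by (subst cinner_commute) simp
  then show ?thesis by (simp add: norm_sq_cinner cinner_simps)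
qed

lemma norm_diff_sq: "(norm (x - y::'a::complex_hilbert))\<^sup>2 = (norm x)\<^sup>2 - 2 * Re (cinner x y) + (norm y)\<^sup>2"
  using norm_add_sq[of x "-y"] by (simp add: cinner_minus_right)

lemma pythagoras: "cinner x y = 0 \<Longrightarrow> (norm (x + y::'a::complex_hilbert))\<^sup>2 = (norm x)\<^sup>2 + (norm y)\<^sup>2"
  by (simp add: norm_add_sq)

lemma parallelogram:
  "(norm (x + y))\<^sup>2 + (norm (x - y::'a::complex_hilbert))\<^sup>2 = 2 * (norm x)\<^sup>2 + 2 * (norm y)\<^sup>2"
  by (simp add: norm_add_sq norm_diff_sq)

lemma cinner_cauchy_schwarz: "cmod (cinner x y) \<le> norm x * norm (y::'a::complex_hilbert)"
proof (cases "y = 0")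
  case False
  define t where "t = cinner x y / complex_of_real ((norm y)\<^sup>2)"
  have ny: "(norm y)\<^sup>2 > 0" using False by simp
  have tt: "t * complex_of_real ((norm y)\<^sup>2) = cinner x y"
    using ny by (simp add: t_def)
  have "cinner (x - t *\<^sub>C y) (t *\<^sub>C y) = 0"
    using tt by (simp add: cinner_simps cinner_self)
  then have "(norm x)\<^sup>2 = (norm (x - t *\<^sub>C y))\<^sup>2 + (norm (t *\<^sub>C y))\<^sup>2"
    using pythagoras[of "x - t *\<^sub>C y" "t *\<^sub>C y"] by simp
  then have "norm (t *\<^sub>C y) \<le> norm x"
    using abs_le_square_iff[of "norm (t *\<^sub>C y)" "norm x"] by simp
  then have "cmod t * norm y * norm y \<le> norm x * norm y"
    by (simp add: norm_scaleC mult_right_mono)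
  moreover have "cmod (cinner x y) = cmod t * norm y * norm y"
    by (subst tt[symmetric]) (simp add: norm_mult power2_eq_square)
  ultimately show ?thesis by simp
qed simp

lemma bounded_bilinear_cinner: "bounded_bilinear (cinner :: 'a::complex_hilbert \<Rightarrow> 'a \<Rightarrow> complex)"
proof
  show "\<exists>K. \<forall>a b. cmod (cinner (a::'a) b) \<le> norm a * norm b * K"
    by (rule exI[of _ 1]) (simp add: cinner_cauchy_schwarz)
qed (simp_all add: cinner_simps scaleR_scaleC scaleR_conv_of_real)

lemma cinner_right_eqI: "(\<And>x. cinner x y = cinner x z) \<Longrightarrow> y = (z::'a::complex_hilbert)"
  using cinner_self[of "y - z"] by (simp add: cinner_diff_right)

definition csubspace :: "'a::complex_hilbert set \<Rightarrow> bool"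
  where "csubspace V \<longleftrightarrow> 0 \<in> V \<and> (\<forall>x\<in>V. \<forall>y\<in>V. x + y \<in> V) \<and> (\<forall>c. \<forall>x\<in>V. c *\<^sub>C x \<in> V)"

lemma csubspace_diff: "csubspace V \<Longrightarrow> x \<in> V \<Longrightarrow> y \<in> V \<Longrightarrow> x - y \<in> V"
  unfolding csubspace_def by (metis diff_conv_add_uminus scaleC_minus1)

text \<open>By the parallelogram law a minimizing sequence is Cauchy: the midpoint of two almost nearest points is
  no nearer than the infimum.\<close>
lemma nearest_point_exists:
  fixes x :: "'a::complex_hilbert"
  assumes V: "csubspace V" "closed V"
  shows "\<exists>v\<in>V. \<forall>w\<in>V. norm (x - v) \<le> norm (x - w)"
proof -
  define d where "d = (INF w\<in>V. (norm (x - w))\<^sup>2)"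
  have ne: "V \<noteq> {}" using V(1) by (auto simp: csubspace_def)
  have bdd: "bdd_below ((\<lambda>w. (norm (x - w))\<^sup>2) ` V)" by (rule bdd_belowI[of _ 0]) auto
  have d_le: "d \<le> (norm (x - w))\<^sup>2" if "w \<in> V" for w
    unfolding d_def by (rule cINF_lower[OF bdd that])
  have "\<exists>w\<in>V. (norm (x - w))\<^sup>2 < d + inverse (real (Suc k))" for k
  proof -
    have "(INF w\<in>V. (norm (x - w))\<^sup>2) < d + inverse (real (Suc k))" by (simp add: d_def)
    then show ?thesis using cINF_less_iff[OF ne bdd] by blast
  qed
  then obtain s where s: "\<And>k. s k \<in> V" "\<And>k. (norm (x - s k))\<^sup>2 < d + inverse (real (Suc k))" by metis
  have close: "(norm (s k - s l))\<^sup>2 \<le> 2 * inverse (real (Suc k)) + 2 * inverse (real (Suc l))" for k l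
  proof -
    have mid: "(1/2) *\<^sub>C (s k + s l) \<in> V" using V(1) s(1) by (auto simp: csubspace_def)
    have tw: "2 *\<^sub>C ((1/2) *\<^sub>C y) = y" for y :: 'a by (simp add: scaleC_scaleC scaleC_one)
    have dbl: "2 *\<^sub>C y = y + y" for y :: 'a using scaleC_add_left[of 1 1 y] by (simp add: scaleC_one)
    have "(x - s k) + (x - s l) = 2 *\<^sub>C (x - (1/2) *\<^sub>C (s k + s l))"
      using tw[of "s k + s l"] unfolding scaleC_diff_right dbl by (simp add: algebra_simps)
    then have "(norm ((x - s k) + (x - s l)))\<^sup>2 = 4 * (norm (x - (1/2) *\<^sub>C (s k + s l)))\<^sup>2"
      by (simp add: norm_scaleC power_mult_distrib)
    also have "\<dots> \<ge> 4 * d" using d_le[OF mid] by simp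
    finally have "4 * d \<le> (norm ((x - s k) + (x - s l)))\<^sup>2" .
    moreover have "(norm ((x - s k) + (x - s l)))\<^sup>2 + (norm ((x - s k) - (x - s l)))\<^sup>2
        = 2 * (norm (x - s k))\<^sup>2 + 2 * (norm (x - s l))\<^sup>2" by (rule parallelogram)
    moreover have "norm ((x - s k) - (x - s l)) = norm (s k - s l)"
      by (simp add: norm_minus_commute)
    ultimately show ?thesis using s(2)[of k] s(2)[of l] by simp
  qed
  have "Cauchy s"
  proof (rule metric_CauchyI)
    fix e :: real assume e: "e > 0"
    obtain N where N: "inverse (real (Suc N)) < e\<^sup>2 / 4" using reals_Archimedean[of "e\<^sup>2/4"] e by auto
    have "dist (s k) (s l) < e" if "k \<ge> N" "l \<ge> N" for k l
    proof -
      have "inverse (real (Suc k)) \<le> inverse (real (Suc N))" "inverse (real (Suc l)) \<le> inverse (real (Suc N))"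
        using that by (auto intro!: le_imp_inverse_le)
      then have "(norm (s k - s l))\<^sup>2 < e\<^sup>2" using close[of k l] N by linarith
      then show ?thesis using e by (simp add: dist_norm power2_less_imp_less)
    qed
    then show "\<exists>M. \<forall>m\<ge>M. \<forall>n\<ge>M. dist (s m) (s n) < e" by blast
  qed
  then obtain v where v: "s \<longlonglongrightarrow> v" using Cauchy_convergent_iff convergent_def by blast
  have vV: "v \<in> V" using closed_sequentially[OF V(2) _ v] s(1) by blast
  have "(\<lambda>k. (norm (x - s k))\<^sup>2) \<longlonglongrightarrow> (norm (x - v))\<^sup>2" by (intro tendsto_intros v)
  moreover have "(\<lambda>k. d + inverse (real (Suc k))) \<longlonglongrightarrow> d + 0"
    by (intro tendsto_intros LIMSEQ_inverse_real_of_nat)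
  ultimately have "(norm (x - v))\<^sup>2 \<le> d + 0"
    by (rule LIMSEQ_le) (use s(2) less_imp_le in blast)
  then have "(norm (x - v))\<^sup>2 \<le> (norm (x - w))\<^sup>2" if "w \<in> V" for w using d_le[OF that] by linarith
  then show ?thesis using vV power2_le_imp_le norm_ge_zero by blast
qed

text \<open>Moving from the nearest point in the direction \<open>w\<close> by the component of the error along \<open>w\<close> would come
  nearer unless that component vanishes.\<close>
lemma orthogonal_decomposition:
  fixes x :: "'a::complex_hilbert"
  assumes V: "csubspace V" "closed V"
  shows "\<exists>v\<in>V. \<forall>w\<in>V. cinner (x - v) w = 0"
proof -
  obtain v where v: "v \<in> V" "\<And>w. w \<in> V \<Longrightarrow> norm (x - v) \<le> norm (x - w)"
    using nearest_point_exists[OF V] by blast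
  have "cinner (x - v) w = 0" if w: "w \<in> V" for w
  proof (cases "w = 0")
    case False
    define t where "t = cinner (x - v) w / complex_of_real ((norm w)\<^sup>2)"
    have "(norm w)\<^sup>2 > 0" using False by simp
    then have tt: "t * complex_of_real ((norm w)\<^sup>2) = cinner (x - v) w" by (simp add: t_def)
    have "cinner (x - v - t *\<^sub>C w) (t *\<^sub>C w) = 0"
      using tt by (simp only: cinner_diff_left cinner_scaleC_left cinner_scaleC_right cinner_self) simp
    then have "(norm (x - v))\<^sup>2 = (norm (x - v - t *\<^sub>C w))\<^sup>2 + (norm (t *\<^sub>C w))\<^sup>2"
      using pythagoras[of "x - v - t *\<^sub>C w" "t *\<^sub>C w"] by simp
    moreover have "norm (x - v) \<le> norm (x - v - t *\<^sub>C w)"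
      using v(2)[of "v + t *\<^sub>C w"] V(1) v(1) w by (simp add: csubspace_def algebra_simps)
    ultimately have "norm (t *\<^sub>C w) = 0"
      using power_mono[of "norm (x - v)" "norm (x - v - t *\<^sub>C w)" 2] by simp
    then have "t = 0" using False by (simp add: norm_scaleC)
    then show ?thesis using tt by simp
  qed simp
  then show ?thesis using v(1) by blast
qed

lemma bop_apply_simps:
  "bop_apply (A + B) x = bop_apply A x + bop_apply B x"
  "bop_apply (A - B) x = bop_apply A x - bop_apply B x"
  "bop_apply (- A) x = - bop_apply A x"
  "bop_apply (A * B) x = bop_apply A (bop_apply B x)"
  "bop_apply 0 x = 0" "bop_apply 1 x = x"
  "bop_apply (r *\<^sub>R A) x = r *\<^sub>R bop_apply A x"
  by (transfer, simp add: blinfun.add_left blinfun.diff_left blinfun.minus_left blinfun.scaleR_left)+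

lemma bop_apply_linear:
  "bop_apply A (x + y) = bop_apply A x + bop_apply A y"
  "bop_apply A (x - y) = bop_apply A x - bop_apply A y"
  "bop_apply A (c *\<^sub>C x) = c *\<^sub>C bop_apply A x"
  "bop_apply A 0 = 0"
  by (transfer, simp add: blinfun.add_right blinfun.diff_right blinfun.zero_right)+

lemma bop_norm: "norm (bop_apply A x) \<le> norm A * norm x"
  by transfer (rule norm_blinfun)

lemma bop_norm_leI: "(\<And>x. norm (bop_apply A x) \<le> K * norm x) \<Longrightarrow> 0 \<le> K \<Longrightarrow> norm A \<le> K"
  by transfer (rule norm_blinfun_bound)

lemma bounded_linear_bop_apply: "bounded_linear (bop_apply A)"
  by transfer (rule blinfun.bounded_linear_right)

lemma bop_exists:
  assumes "\<And>x y. f (x + y) = f x + f y" "\<And>c x. f (c *\<^sub>C x) = c *\<^sub>C f x"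
    and "\<And>x. norm (f x) \<le> K * norm (x::'h::complex_hilbert)"
  shows "\<exists>A. \<forall>x. bop_apply A x = f x"
proof -
  have bl: "bounded_linear f"
    by (rule bounded_linear_intro[where K = K]) (use assms in \<open>simp_all add: scaleR_scaleC mult.commute\<close>)
  have "bop_apply (Bop (Blinfun f)) x = f x" for x
    unfolding bop_apply.rep_eq
    by (subst Bop_inverse) (auto simp: bounded_linear_Blinfun_apply[OF bl] assms(2))
  then show ?thesis by blast
qed

lemma complete_bop: "complete (UNIV :: 'h::complex_hilbert bop set)"
proof (rule completeI)
  fix S :: "nat \<Rightarrow> 'h bop" assume C: "Cauchy S"
  have "Cauchy (\<lambda>k. blinfun_of_bop (S k))"
  proof -
    have "dist (blinfun_of_bop (S k)) (blinfun_of_bop (S l)) = dist (S k) (S l)" for k l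
      by (simp add: dist_norm norm_bop.rep_eq minus_bop.rep_eq)
    then show ?thesis using C by (simp add: Cauchy_def)
  qed
  then obtain L where L: "(\<lambda>k. blinfun_of_bop (S k)) \<longlonglongrightarrow> L"
    using Cauchy_convergent_iff convergent_def by blast
  have ap: "(\<lambda>k. blinfun_apply (blinfun_of_bop (S k)) x) \<longlonglongrightarrow> blinfun_apply L x" for x
    by (intro blinfun.tendsto L tendsto_const)
  have "blinfun_apply L (c *\<^sub>C x) = c *\<^sub>C blinfun_apply L x" for c x
  proof (rule LIMSEQ_unique[OF ap])
    have "(\<lambda>k. c *\<^sub>C blinfun_apply (blinfun_of_bop (S k)) x) \<longlonglongrightarrow> c *\<^sub>C blinfun_apply L x"
      by (rule bounded_linear.tendsto[OF bounded_linear_scaleC ap])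
    then show "(\<lambda>k. blinfun_apply (blinfun_of_bop (S k)) (c *\<^sub>C x)) \<longlonglongrightarrow> c *\<^sub>C blinfun_apply L x"
      using blinfun_of_bop[of "S _"] by simp
  qed
  then have LB: "blinfun_of_bop (Bop L) = L" by (intro Bop_inverse) simp
  have "(\<lambda>k. norm (S k - Bop L)) \<longlonglongrightarrow> 0"
    unfolding norm_bop.rep_eq minus_bop.rep_eq LB using L by (simp add: LIM_zero_iff tendsto_norm_zero_iff)
  then show "\<exists>l\<in>UNIV. S \<longlonglongrightarrow> l"
    using LIM_zero_iff[of S "Bop L"] tendsto_norm_zero_iff by blast
qed

instance bop :: (complex_hilbert) banach
proof
  fix X :: "nat \<Rightarrow> 'a bop" assume "Cauchy X"
  then show "convergent X" using complete_bop unfolding complete_def convergent_def by blast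
qed

text \<open>The Riesz representation theorem: the functional \<open>x \<mapsto> \<langle>A x, y\<rangle>\<close> is represented by a multiple of any
  nonzero vector orthogonal to its kernel.\<close>
lemma adj_exists: "\<exists>B. \<forall>x y. cinner (bop_apply A x) y = cinner x (bop_apply B y)"
  for A :: "'h::complex_hilbert bop"
proof -
  have "\<exists>b. \<forall>x. cinner (bop_apply A x) y = cinner x b" for y
  proof -
    let ?V = "{x. cinner (bop_apply A x) y = 0}"
    have V: "csubspace ?V" by (simp add: csubspace_def bop_apply_linear cinner_simps)
    have "continuous_on UNIV (\<lambda>x. cinner (bop_apply A x) y)"
      by (intro bounded_bilinear.continuous_on[OF bounded_bilinear_cinner] continuous_on_const
          linear_continuous_on bounded_linear_bop_apply)
    then have Vc: "closed ?V" using closed_Collect_eq[of "\<lambda>x. cinner (bop_apply A x) y" "\<lambda>_. 0"] by simp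
    show ?thesis
    proof (cases "?V = UNIV")
      case True
      then show ?thesis by (intro exI[of _ 0]) auto
    next
      case False
      then obtain u where u: "u \<notin> ?V" by blast
      obtain v where v: "v \<in> ?V" "\<And>w. w \<in> ?V \<Longrightarrow> cinner (u - v) w = 0"
        using orthogonal_decomposition[OF V Vc] by blast
      define w where "w = u - v"
      define f where "f x = cinner (bop_apply A x) y" for x
      have fw: "f w \<noteq> 0" using u v(1) by (simp add: w_def f_def bop_apply_linear cinner_simps)
      then have w0: "w \<noteq> 0" by (auto simp: f_def bop_apply_linear)
      define b where "b = (cnj (f w) / complex_of_real ((norm w)\<^sup>2)) *\<^sub>C w"
      have "f x = cinner x b" for x
      proof -
        have "x - (f x / f w) *\<^sub>C w \<in> ?V"
          using fw by (simp add: f_def[symmetric]) (simp add: f_def bop_apply_linear cinner_simps)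
        then have "cinner w (x - (f x / f w) *\<^sub>C w) = 0" using v(2) by (simp add: w_def)
        then have "cinner (x - (f x / f w) *\<^sub>C w) w = 0" by (subst cinner_commute) simp
        then have e: "cinner x w = (f x / f w) * complex_of_real ((norm w)\<^sup>2)"
          by (simp add: cinner_simps cinner_self)
        show ?thesis using fw w0 by (simp add: b_def cinner_simps e)
      qed
      then show ?thesis unfolding f_def by blast
    qed
  qed
  then obtain g where g: "\<And>x y. cinner (bop_apply A x) y = cinner x (g y)" by metis
  have "\<exists>B. \<forall>y. bop_apply B y = g y"
  proof (rule bop_exists)
    show "g (y + z) = g y + g z" for y z
      by (rule cinner_right_eqI) (simp add: g[symmetric] cinner_simps)
    show "g (c *\<^sub>C y) = c *\<^sub>C g y" for c y
      by (rule cinner_right_eqI) (simp add: g[symmetric] cinner_simps)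
    show "norm (g y) \<le> norm A * norm y" for y
    proof -
      have "complex_of_real ((norm (g y))\<^sup>2) = cinner (bop_apply A (g y)) y" by (simp add: g cinner_self)
      then have "(norm (g y))\<^sup>2 = cmod (cinner (bop_apply A (g y)) y)" by (metis norm_of_real abs_power2)
      also have "\<dots> \<le> norm (bop_apply A (g y)) * norm y" by (rule cinner_cauchy_schwarz)
      also have "\<dots> \<le> (norm A * norm (g y)) * norm y" by (intro mult_right_mono bop_norm) simp
      finally have "norm (g y) * norm (g y) \<le> norm (g y) * (norm A * norm y)"
        by (simp add: power2_eq_square mult_ac)
      then show ?thesis by (cases "norm (g y) = 0") simp_all
    qed
  qed
  then show ?thesis using g by metis
qed

lemma cinner_adj: "cinner (bop_apply A x) y = cinner x (bop_apply (adj A) y)"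
proof -
  obtain B where B: "\<forall>x y. cinner (bop_apply A x) y = cinner x (bop_apply B y)" using adj_exists by blast
  have "adj A = B" unfolding adj_def
  proof (rule the_equality[where P = "\<lambda>B. \<forall>x y. cinner (bop_apply A x) y = cinner x (bop_apply B y)", OF B])
    fix C assume "\<forall>x y. cinner (bop_apply A x) y = cinner x (bop_apply C y)"
    then show "C = B" using B by (intro bop_eqI cinner_right_eqI) simp
  qed
  then show ?thesis using B by simp
qed

lemma cinner_adj': "cinner x (bop_apply A y) = cinner (bop_apply (adj A) x) y"
  by (metis cinner_adj cinner_commute)

lemma adj_eqI: "(\<And>x y. cinner (bop_apply A x) y = cinner x (bop_apply B y)) \<Longrightarrow> adj A = B"
  by (intro bop_eqI cinner_right_eqI) (simp add: cinner_adj[symmetric])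

lemma adj_adj [simp]: "adj (adj A) = A"
  by (rule adj_eqI) (simp add: cinner_adj')

lemma adj_mult: "adj (A * B) = adj B * adj A"
  by (rule adj_eqI) (simp add: bop_apply_simps cinner_adj)

lemma adj_add: "adj (A + B) = adj A + adj B"
  by (rule adj_eqI) (simp add: bop_apply_simps cinner_adj cinner_simps)

lemma adj_diff: "adj (A - B) = adj A - adj B"
  by (rule adj_eqI) (simp add: bop_apply_simps cinner_adj cinner_simps)

lemma adj_scaleC: "adj (c *\<^sub>C A) = cnj c *\<^sub>C adj A"
  by (rule adj_eqI) (simp add: bop_apply_scaleC cinner_adj cinner_simps)

lemma adj_scaleR: "adj (r *\<^sub>R A) = r *\<^sub>R adj A"
  by (simp add: scaleR_scaleC adj_scaleC)

lemma adj_one: "adj 1 = 1" by (rule adj_eqI) (simp add: bop_apply_simps)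

lemma norm_adj_le: "norm (adj A) \<le> norm A"
proof (rule bop_norm_leI)
  fix y
  let ?z = "bop_apply (adj A) y"
  have "complex_of_real ((norm ?z)\<^sup>2) = cinner (bop_apply A ?z) y" by (simp add: cinner_adj cinner_self)
  then have "(norm ?z)\<^sup>2 = cmod (cinner (bop_apply A ?z) y)" by (metis norm_of_real abs_power2)
  also have "\<dots> \<le> norm (bop_apply A ?z) * norm y" by (rule cinner_cauchy_schwarz)
  also have "\<dots> \<le> (norm A * norm ?z) * norm y" by (intro mult_right_mono bop_norm) simp
  finally have "norm ?z * norm ?z \<le> norm ?z * (norm A * norm y)"
    by (simp add: power2_eq_square mult_ac)
  then show "norm ?z \<le> norm A * norm y" by (cases "norm ?z = 0") simp_all
qed simp

lemma bounded_linear_adj: "bounded_linear (adj :: 'h::complex_hilbert bop \<Rightarrow> _)"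
  by (rule bounded_linear_intro[where K = 1]) (simp_all add: adj_add adj_scaleR norm_adj_le)

lemma scaleC_bop_mult: "(c *\<^sub>C A) * B = c *\<^sub>C (A * B)" "A * (c *\<^sub>C B) = c *\<^sub>C (A * (B::'h::complex_hilbert bop))"
  by (rule bop_eqI, simp add: bop_apply_simps bop_apply_scaleC bop_apply_linear)+

lemma norm_scaleC_bop_le: "norm (c *\<^sub>C A) \<le> cmod c * norm (A::'h::complex_hilbert bop)"
  by (rule bop_norm_leI) (simp_all add: bop_apply_scaleC norm_scaleC mult.assoc mult_left_mono bop_norm)

section \<open>Projections and central annihilators\<close>

lemma projection_exists:
  fixes V :: "'h::complex_hilbert set"
  assumes V: "csubspace V" "closed V"
  shows "\<exists>P. (\<forall>x. bop_apply P x \<in> V) \<and> (\<forall>x. \<forall>w\<in>V. cinner (x - bop_apply P x) w = 0) \<and>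
    (\<forall>x. \<forall>v\<in>V. (\<forall>w\<in>V. cinner (x - v) w = 0) \<longrightarrow> bop_apply P x = v)"
proof -
  obtain p where p: "\<And>x. p x \<in> V" "\<And>x w. w \<in> V \<Longrightarrow> cinner (x - p x) w = 0"
    using orthogonal_decomposition[OF V] by metis
  have uniq: "p x = v" if v: "v \<in> V" "\<And>w. w \<in> V \<Longrightarrow> cinner (x - v) w = 0" for x v
  proof -
    have "p x - v \<in> V" using csubspace_diff[OF V(1) p(1) v(1)] .
    then have "cinner (x - v) (p x - v) - cinner (x - p x) (p x - v) = 0" by (simp add: v(2) p(2))
    then have "cinner (p x - v) (p x - v) = 0" by (simp add: cinner_diff_left)
    then show ?thesis by (simp add: cinner_self)
  qed
  have "\<exists>P. \<forall>x. bop_apply P x = p x"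
  proof (rule bop_exists)
    show "p (x + y) = p x + p y" for x y
    proof (rule uniq)
      show "p x + p y \<in> V" using V(1) p(1) by (simp add: csubspace_def)
      show "cinner (x + y - (p x + p y)) w = 0" if "w \<in> V" for w
        using p(2)[OF that, of x] p(2)[OF that, of y] by (simp add: cinner_simps)
    qed
    show "p (c *\<^sub>C x) = c *\<^sub>C p x" for c x
    proof (rule uniq)
      show "c *\<^sub>C p x \<in> V" using V(1) p(1) by (simp add: csubspace_def)
      show "cinner (c *\<^sub>C x - c *\<^sub>C p x) w = 0" if "w \<in> V" for w
        using p(2)[OF that, of x] by (simp add: cinner_simps)
    qed
    show "norm (p x) \<le> 1 * norm x" for x
    proof -
      have "(norm x)\<^sup>2 = (norm (x - p x))\<^sup>2 + (norm (p x))\<^sup>2"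
        using pythagoras[of "x - p x" "p x"] p by simp
      then have "(norm (p x))\<^sup>2 \<le> (norm x)\<^sup>2" by simp
      then show ?thesis unfolding mult_1 by (rule power2_le_imp_le[OF _ norm_ge_zero])
    qed
  qed
  then obtain P where "\<And>x. bop_apply P x = p x" by blast
  then show ?thesis using p uniq by (intro exI[of _ P]) simp
qed

lemma norm_projection_le:
  fixes z :: "'h::complex_hilbert bop"
  assumes "z * z = z" "adj z = z"
  shows "norm z \<le> 1"
proof (rule bop_norm_leI)
  fix x
  have "bop_apply z (bop_apply z x) = bop_apply z x" by (metis assms(1) bop_apply_simps(4))
  then have "cinner (x - bop_apply z x) (bop_apply z x) = 0"
    by (simp add: cinner_adj' assms(2) bop_apply_linear)
  then have "(norm x)\<^sup>2 = (norm (x - bop_apply z x))\<^sup>2 + (norm (bop_apply z x))\<^sup>2"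
    using pythagoras[of "x - bop_apply z x" "bop_apply z x"] by simp
  then have "(norm (bop_apply z x))\<^sup>2 \<le> (norm x)\<^sup>2" by simp
  then show "norm (bop_apply z x) \<le> 1 * norm x" unfolding mult_1 by (rule power2_le_imp_le[OF _ norm_ge_zero])
qed simp

text \<open>Norm-closed commutative real subalgebras, not necessarily with unit: square roots and geometric series
  of an element stay in any such algebra that contains it.\<close>
definition comm_subalgebra :: "'a::real_normed_algebra set \<Rightarrow> bool"
  where "comm_subalgebra D \<longleftrightarrow> closed D \<and> 0 \<in> D \<and> (\<forall>a\<in>D. \<forall>b\<in>D. a + b \<in> D \<and> a * b \<in> D \<and> a * b = b * a) \<and>
    (\<forall>r. \<forall>a\<in>D. r *\<^sub>R a \<in> D)"

text \<open>For such \<open>y\<close> one has \<open>(1 - y)\<^sup>2 = 1 - x\<close>, so this is the square root of \<open>1 - x\<close>. The iteration from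
  \<open>0\<close> is dominated by the same iteration for the number \<open>r\<close>, which is increasing and bounded; hence it
  converges even for \<open>r = 1\<close>, where it is no contraction.\<close>
lemma quadratic_fixpoint:
  fixes x :: "'a::{real_normed_algebra, banach}"
  assumes D: "comm_subalgebra D" "x \<in> D" and r: "norm x \<le> r" "r \<le> 1"
  shows "\<exists>y\<in>D. 2 *\<^sub>R y = x + y * y \<and> norm y \<le> r"
proof -
  define f where "f y = (1/2) *\<^sub>R (x + y * y)" for y
  define g where "g t = (r + t\<^sup>2) / 2" for t
  define y where "y k = (f ^^ k) 0" for k
  define t where "t k = (g ^^ k) 0" for k
  have y0: "y 0 = 0" "\<And>k. y (Suc k) = f (y k)" and t0: "t 0 = 0" "\<And>k. t (Suc k) = g (t k)"
    by (simp_all add: y_def t_def)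
  have r0: "0 \<le> r" using r(1) norm_ge_zero[of x] by linarith
  have yD: "y k \<in> D" for k
  proof (induction k)
    case 0 then show ?case using D by (simp add: y0 comm_subalgebra_def)
  next
    case (Suc k)
    then have "y k * y k \<in> D" using D(1) unfolding comm_subalgebra_def by blast
    then have "x + y k * y k \<in> D" using D unfolding comm_subalgebra_def by blast
    then show ?case using D(1) unfolding y0 f_def comm_subalgebra_def by blast
  qed
  have tb: "0 \<le> t k \<and> t k \<le> r" for k
  proof (induction k)
    case (Suc k)
    then have "(t k)\<^sup>2 \<le> r * 1" using r(2) unfolding power2_eq_square by (intro mult_mono) auto
    then show ?case using r0 by (simp add: t0 g_def)
  qed (simp add: t0 r0)
  have n1: "norm (y k) \<le> t k" for k
  proof (induction k)
    case (Suc j)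
    have "norm (y (Suc j)) \<le> (norm x + norm (y j * y j)) / 2"
      using norm_triangle_ineq[of x "y j * y j"] by (simp add: y0 f_def)
    also have "norm (y j * y j) \<le> t j * t j"
      by (rule order_trans[OF norm_mult_ineq]) (intro mult_mono Suc, use tb in auto)
    finally show ?case using r(1) by (simp add: t0 g_def power2_eq_square)
  qed (simp add: y0 t0)
  have main: "norm (y (k + j) - y k) \<le> t (k + j) - t k" for k j
  proof (induction k)
    case 0
    show ?case using n1 by (simp add: y0 t0)
  next
    case (Suc k)
    have comm: "y k * y (k + j) = y (k + j) * y k" using D(1) yD unfolding comm_subalgebra_def by blast
    have "(y (k + j) - y k) * (y (k + j) + y k) = (x + y (k + j) * y (k + j)) - (x + y k * y k)"
      using comm by (simp add: distrib_left left_diff_distrib)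
    then have "y (Suc k + j) - y (Suc k) = (1/2) *\<^sub>R ((y (k + j) - y k) * (y (k + j) + y k))"
      by (simp only: add_Suc y0 f_def scaleR_diff_right)
    then have "norm (y (Suc k + j) - y (Suc k)) \<le> (norm (y (k + j) - y k) * norm (y (k + j) + y k)) / 2"
      by (simp add: norm_mult_ineq)
    also have "\<dots> \<le> ((t (k + j) - t k) * (t (k + j) + t k)) / 2"
      using order_trans[OF norm_triangle_ineq add_mono[OF n1[of "k+j"] n1[of k]]] Suc
        order_trans[OF norm_ge_zero Suc]
      by (intro divide_right_mono mult_mono) auto
    also have "\<dots> = t (Suc k + j) - t (Suc k)"
      by (simp add: t0 g_def power2_eq_square field_simps)
    finally show ?case .
  qed
  have tmono: "t k \<le> t (k + j)" for k j using main[of k j] norm_ge_zero[of "y (k + j) - y k"] by linarith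
  have "incseq t" using tmono[of _ 1] by (intro incseq_SucI) simp
  then obtain L where "t \<longlonglongrightarrow> L" using incseq_convergent[of t r] tb by blast
  then have "Cauchy t" by (rule LIMSEQ_imp_Cauchy)
  have le: "dist (y m) (y n) \<le> dist (t m) (t n)" for m n
  proof (cases "m \<le> n")
    case True then show ?thesis using main[of m "n - m"] by (simp add: dist_norm norm_minus_commute)
  next
    case False then show ?thesis using main[of n "m - n"] by (simp add: dist_norm)
  qed
  have "Cauchy y"
  proof (rule metric_CauchyI)
    fix e :: real assume "e > 0"
    then obtain N where "\<forall>m\<ge>N. \<forall>n\<ge>N. dist (t m) (t n) < e" using metric_CauchyD[OF \<open>Cauchy t\<close>] by blast
    then have "\<forall>m\<ge>N. \<forall>n\<ge>N. dist (y m) (y n) < e" using le_less_trans[OF le] by blast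
    then show "\<exists>N. \<forall>m\<ge>N. \<forall>n\<ge>N. dist (y m) (y n) < e" by blast
  qed
  then obtain l where l: "y \<longlonglongrightarrow> l" using Cauchy_convergent_iff convergent_def by blast
  have "l \<in> D" using closed_sequentially[of D y l] D(1) yD l unfolding comm_subalgebra_def by blast
  moreover have "norm l \<le> r"
  proof (rule LIMSEQ_le_const2[OF tendsto_norm[OF l]])
    show "\<exists>N. \<forall>k\<ge>N. norm (y k) \<le> r" using main[of 0] tb by (auto simp: y0 t0 intro: order_trans)
  qed
  moreover have "l = (1/2) *\<^sub>R (x + l * l)"
  proof (rule LIMSEQ_unique[OF LIMSEQ_Suc[OF l]])
    show "(\<lambda>k. y (Suc k)) \<longlonglongrightarrow> (1/2) *\<^sub>R (x + l * l)"
      unfolding y0 f_def by (intro tendsto_intros l)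
  qed
  then have "2 *\<^sub>R l = 2 *\<^sub>R ((1/2) *\<^sub>R (x + l * l))" by (rule arg_cong)
  then have "2 *\<^sub>R l = x + l * l" by simp
  ultimately show ?thesis by blast
qed

lemma closed_commutant: "closed (commutant (S :: 'h::complex_hilbert bop set))"
proof -
  have "commutant S = (\<Inter>A\<in>S. {B. A * B = B * A})" by (auto simp: commutant_def)
  then show ?thesis by (auto intro!: closed_INT closed_Collect_eq continuous_intros)
qed

locale vn_algebra =
  fixes M :: "'h::complex_hilbert bop set"
  assumes vN: "von_neumann_algebra M"
begin

lemma adj_in: "a \<in> M \<Longrightarrow> adj a \<in> M" using vN by (simp add: von_neumann_algebra_def)

text \<open>Membership is tested on the commutant. This makes \<open>M\<close> closed under all operations, including limits in
  the strong sense.\<close>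
lemma memI:
  assumes "\<And>b. b \<in> commutant M \<Longrightarrow> b * a = a * b"
  shows "a \<in> M"
proof -
  have "a \<in> commutant (commutant M)" using assms unfolding commutant_def[of "commutant M"] by blast
  then show ?thesis using vN by (simp add: von_neumann_algebra_def)
qed

lemma memD: "a \<in> M \<Longrightarrow> b \<in> commutant M \<Longrightarrow> b * a = a * b"
  by (simp add: commutant_def)

lemma closed_M: "closed M"
  using vN closed_commutant unfolding von_neumann_algebra_def by metis

lemma zero_in [simp]: "0 \<in> M" and one_in [simp]: "1 \<in> M"
  by (auto intro: memI)

lemma add_in: "a + b \<in> M" if "a \<in> M" "b \<in> M"
proof (rule memI)
  fix c assume "c \<in> commutant M"
  then have "c * a = a * c" "c * b = b * c" using that memD by blast+
  then show "c * (a + b) = (a + b) * c" by (simp add: distrib_left distrib_right)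
qed

lemma diff_in: "a - b \<in> M" if "a \<in> M" "b \<in> M"
proof (rule memI)
  fix c assume "c \<in> commutant M"
  then have "c * a = a * c" "c * b = b * c" using that memD by blast+
  then show "c * (a - b) = (a - b) * c" by (simp add: left_diff_distrib right_diff_distrib)
qed

lemma mult_in: "a \<in> M \<Longrightarrow> b \<in> M \<Longrightarrow> a * b \<in> M"
  by (rule memI) (metis memD[of a] memD[of b] mult.assoc[of a] mult.assoc[of _ a] mult.assoc[of _ _ b])

lemma sum_in: "(\<And>i. i \<in> S \<Longrightarrow> g i \<in> M) \<Longrightarrow> sum g S \<in> M"
  by (induction S rule: infinite_finite_induct) (auto simp: add_in)

lemma power_in: "a \<in> M \<Longrightarrow> a ^ k \<in> M"
  by (induction k) (auto simp: mult_in)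

lemma scaleC_in: "a \<in> M \<Longrightarrow> c *\<^sub>C a \<in> M"
  by (rule memI) (metis memD scaleC_bop_mult)

lemma scaleR_in: "a \<in> M \<Longrightarrow> r *\<^sub>R a \<in> M"
  by (simp add: scaleR_scaleC scaleC_in)

lemma adj_commutant: "b \<in> commutant M \<Longrightarrow> adj b \<in> commutant M"
  unfolding commutant_def mem_Collect_eq
proof
  fix a assume b: "\<forall>A\<in>M. A * b = b * A" and a: "a \<in> M"
  have "adj a * b = b * adj a" using b adj_in[OF a] by blast
  then have "adj (adj a * b) = adj (b * adj a)" by simp
  then show "a * adj b = adj b * a" by (simp add: adj_mult)
qed

definition Z where "Z = M \<inter> commutant M"

definition B where "B = {z \<in> Z. z * z = z \<and> adj z = z}"

lemma ZI: "a \<in> M \<Longrightarrow> (\<And>b. b \<in> M \<Longrightarrow> b * a = a * b) \<Longrightarrow> a \<in> Z"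
  by (simp add: Z_def commutant_def)

lemma Z_M: "a \<in> Z \<Longrightarrow> a \<in> M" by (simp add: Z_def)
lemma Z_comm: "a \<in> Z \<Longrightarrow> b \<in> M \<Longrightarrow> b * a = a * b" by (simp add: Z_def commutant_def)

lemma Z_zero [simp]: "0 \<in> Z" and Z_one [simp]: "1 \<in> Z" by (auto intro: ZI)
lemma Z_add: "a + b \<in> Z" if "a \<in> Z" "b \<in> Z"
proof (rule ZI)
  show "a + b \<in> M" using that by (simp add: Z_M add_in)
next
  fix c assume "c \<in> M"
  then have "c * a = a * c" "c * b = b * c" using that Z_comm by blast+
  then show "c * (a + b) = (a + b) * c" by (simp add: distrib_left distrib_right)
qed
lemma Z_diff: "a - b \<in> Z" if "a \<in> Z" "b \<in> Z"
proof (rule ZI)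
  show "a - b \<in> M" using that by (simp add: Z_M diff_in)
next
  fix c assume "c \<in> M"
  then have "c * a = a * c" "c * b = b * c" using that Z_comm by blast+
  then show "c * (a - b) = (a - b) * c" by (simp add: left_diff_distrib right_diff_distrib)
qed
lemma Z_mult: "a \<in> Z \<Longrightarrow> b \<in> Z \<Longrightarrow> a * b \<in> Z"
  by (rule ZI) (simp add: Z_M mult_in, metis Z_comm[of a] Z_comm[of b] mult.assoc[of a] mult.assoc[of _ a]
      mult.assoc[of _ _ b])
lemma Z_scaleC: "a \<in> Z \<Longrightarrow> c *\<^sub>C a \<in> Z"
  by (rule ZI) (simp add: Z_M scaleC_in, metis Z_comm scaleC_bop_mult)
lemma Z_scaleR: "a \<in> Z \<Longrightarrow> r *\<^sub>R a \<in> Z"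
  by (simp add: scaleR_scaleC Z_scaleC)
lemma Z_adj: "a \<in> Z \<Longrightarrow> adj a \<in> Z"
  unfolding Z_def by (auto simp: adj_in adj_commutant)
lemma closed_Z: "closed Z" unfolding Z_def by (intro closed_Int closed_M closed_commutant)

lemma B_Z: "z \<in> B \<Longrightarrow> z \<in> Z" and B_idem: "z \<in> B \<Longrightarrow> z * z = z" and B_adj: "z \<in> B \<Longrightarrow> adj z = z"
  by (simp_all add: B_def)
lemma B_M: "z \<in> B \<Longrightarrow> z \<in> M" by (simp add: B_Z Z_M)
lemma B_comm: "z \<in> B \<Longrightarrow> b \<in> M \<Longrightarrow> b * z = z * b" by (rule Z_comm[OF B_Z])
lemma B_norm: "z \<in> B \<Longrightarrow> norm z \<le> 1" by (simp add: B_def norm_projection_le)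
lemma B_zero [simp]: "0 \<in> B" and B_one [simp]: "1 \<in> B"
  using adj_scaleR[of 0 0] by (auto simp: B_def adj_one)
lemma B_mult: "z \<in> B \<Longrightarrow> w \<in> B \<Longrightarrow> z * w \<in> B"
  unfolding B_def by (auto simp: Z_mult adj_mult) (metis Z_M Z_comm mult.assoc)+
lemma B_compl: "z \<in> B \<Longrightarrow> 1 - z \<in> B"
  unfolding B_def by (auto simp: Z_diff adj_diff adj_one algebra_simps)
lemma B_add: "z \<in> B \<Longrightarrow> w \<in> B \<Longrightarrow> z * w = 0 \<Longrightarrow> z + w \<in> B"
  using B_comm[of z w] B_M[of w] unfolding B_def by (auto simp: Z_add adj_add algebra_simps)

lemma norm_mult_B: "z \<in> B \<Longrightarrow> norm (a * z) \<le> norm a"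
  using B_norm[of z] norm_mult_ineq[of a z] mult_left_mono[of "norm z" 1 "norm a"] by simp

text \<open>The vectors killed by the left ideals \<open>S M\<close> form a closed subspace invariant under \<open>M\<close> and under its
  commutant; both are closed under adjoints, so the projection onto the subspace commutes with both and
  is central. It is the largest central projection annihilated by \<open>S\<close>.\<close>
lemma annihilator_exists:
  assumes S: "S \<subseteq> M"
  shows "\<exists>z\<in>B. (\<forall>a\<in>S. a * z = 0) \<and> (\<forall>d\<in>M. (\<forall>a\<in>S. \<forall>m\<in>M. a * m * d = 0) \<longrightarrow> z * d = d)"
proof -
  define V where "V = {h. \<forall>a\<in>S. \<forall>m\<in>M. bop_apply (a * m) h = 0}"
  have sub: "csubspace V" by (auto simp: csubspace_def V_def bop_apply_linear scaleC_zero_right)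
  have "V = (\<Inter>a\<in>S. \<Inter>m\<in>M. {h. bop_apply (a * m) h = 0})" by (auto simp: V_def)
  then have cl: "closed V"
    by (auto intro!: closed_INT closed_Collect_eq linear_continuous_on bounded_linear_bop_apply)
  obtain P where P: "\<And>x. bop_apply P x \<in> V" "\<And>x w. w \<in> V \<Longrightarrow> cinner (x - bop_apply P x) w = 0"
    and uniq: "\<And>x v. v \<in> V \<Longrightarrow> (\<And>w. w \<in> V \<Longrightarrow> cinner (x - v) w = 0) \<Longrightarrow> bop_apply P x = v"
    using projection_exists[OF sub cl] by blast
  have fix_V: "bop_apply P v = v" if "v \<in> V" for v using that by (intro uniq) auto
  have idem: "P * P = P" by (rule bop_eqI) (simp add: bop_apply_simps fix_V P)
  have sa: "adj P = P"
  proof (rule adj_eqI)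
    fix x y
    have "cinner (bop_apply P x) y = cinner (bop_apply P x) (bop_apply P y)"
      using P(2)[OF P(1), of y x] by (subst (1 2) cinner_commute) (simp add: cinner_simps)
    moreover have "cinner x (bop_apply P y) = cinner (bop_apply P x) (bop_apply P y)"
      using P(2)[OF P(1), of x y] by (simp add: cinner_simps)
    ultimately show "cinner (bop_apply P x) y = cinner x (bop_apply P y)" by simp
  qed
  have comm: "b * P = P * b" if b: "\<And>v. v \<in> V \<Longrightarrow> bop_apply b v \<in> V" "\<And>v. v \<in> V \<Longrightarrow> bop_apply (adj b) v \<in> V" for b
  proof (rule bop_eqI)
    fix x
    have "bop_apply P (bop_apply b x) = bop_apply b (bop_apply P x)"
    proof (rule uniq)
      show "bop_apply b (bop_apply P x) \<in> V" using b(1) P(1) by blast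
      show "cinner (bop_apply b x - bop_apply b (bop_apply P x)) w = 0" if "w \<in> V" for w
        using P(2)[OF b(2)[OF that]] by (simp add: bop_apply_linear(2)[symmetric] cinner_adj)
    qed
    then show "bop_apply (b * P) x = bop_apply (P * b) x" by (simp add: bop_apply_simps)
  qed
  have invM: "bop_apply b v \<in> V" if "b \<in> M" "v \<in> V" for b v
    using that mult_in unfolding V_def by (auto simp flip: bop_apply_simps(4) simp: mult.assoc)
  have invM': "bop_apply b v \<in> V" if b: "b \<in> commutant M" and v: "v \<in> V" for b v
    unfolding V_def mem_Collect_eq
  proof (intro ballI)
    fix a m assume am: "a \<in> S" "m \<in> M"
    then have "a * m \<in> M" using S mult_in by blast
    then have "bop_apply (a * m * b) v = bop_apply (b * (a * m)) v" using memD[OF _ b] by simp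
    also have "\<dots> = 0" using v am unfolding bop_apply_simps V_def
        by (simp add: bop_apply_simps(4)[symmetric] bop_apply_linear)
    finally show "bop_apply (a * m) (bop_apply b v) = 0" by (simp add: bop_apply_simps)
  qed
  have PM: "P \<in> M" by (rule memI) (intro comm, auto intro: invM' adj_commutant)
  have PZ: "P \<in> Z" by (rule ZI[OF PM]) (intro comm, auto intro: invM adj_in)
  have "P \<in> B" using PZ idem sa by (simp add: B_def)
  moreover have "a * P = 0" if "a \<in> S" for a
  proof (rule bop_eqI)
    fix x
    have "bop_apply (a * 1) (bop_apply P x) = 0" using P(1)[of x] that one_in unfolding V_def by blast
    then show "bop_apply (a * P) x = bop_apply 0 x" by (simp add: bop_apply_simps)
  qed
  moreover have "P * d = d" if "d \<in> M" "\<forall>a\<in>S. \<forall>m\<in>M. a * m * d = 0" for d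
  proof (rule bop_eqI)
    fix x
    have "bop_apply d x \<in> V" unfolding V_def mem_Collect_eq
      using that(2) by (metis bop_apply_simps(4) bop_apply_simps(5))
    then show "bop_apply (P * d) x = bop_apply d x" by (simp add: bop_apply_simps fix_V)
  qed
  ultimately show ?thesis by blast
qed

lemma comm_subalgebra_selfadjoint: "comm_subalgebra {d \<in> Z. adj d = d}"
proof -
  have "closed {d :: 'h bop. adj d = d}"
    by (intro closed_Collect_eq linear_continuous_on bounded_linear_adj continuous_on_id)
  then have "closed (Z \<inter> {d. adj d = d})" by (intro closed_Int closed_Z)
  moreover have "Z \<inter> {d. adj d = d} = {d \<in> Z. adj d = d}" by blast
  ultimately show ?thesis
    using adj_scaleR[of 0 0]
    by (auto simp: comm_subalgebra_def Z_add Z_mult Z_scaleR adj_add adj_mult adj_scaleR Z_M Z_comm)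
qed

lemma cinner_scaleR_right: "cinner x (r *\<^sub>R y) = complex_of_real r * cinner x (y::'h)"
  by (simp add: scaleR_scaleC cinner_simps)

lemma sa_norm_sq: "adj a = a \<Longrightarrow> (norm (bop_apply a h))\<^sup>2 = Re (cinner (bop_apply (a * a) h) h)"
  by (simp add: bop_apply_simps norm_sq_cinner cinner_adj)

section \<open>Spectral cuts in the centre\<close>

text \<open>Let \<open>s\<close> be the absolute value of \<open>a\<close>. On the annihilator \<open>z\<close> of \<open>s - a\<close> one has \<open>a = s\<close>, and \<open>a = - s\<close>
  on its complement since \<open>(s - a) (s + a) = 0\<close>. As \<open>0 \<le> s \<le> 1\<close>, the operator \<open>s\<close> is within \<open>1/2\<close> of
  \<open>1/2\<close>.\<close>
lemma sign_split_unit: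
  assumes a: "a \<in> Z" "adj a = a" "norm a \<le> 1"
  shows "\<exists>z\<in>B. norm ((a - (1/2) *\<^sub>R 1) * z) \<le> 1/2 \<and> norm ((a + (1/2) *\<^sub>R 1) * (1 - z)) \<le> 1/2"
proof -
  let ?D = "{d \<in> Z. adj d = d}"
  note D = comm_subalgebra_selfadjoint
  have contr: "norm (bop_apply c h) \<le> norm h" if "norm c \<le> 1" for c :: "'h bop" and h
    using order_trans[OF bop_norm mult_right_mono[OF that norm_ge_zero]] by simp
  have xD: "1 - a * a \<in> ?D" using a by (auto simp: Z_diff Z_mult adj_diff adj_mult adj_one)
  have xn: "norm (1 - a * a) \<le> 1"
  proof (rule bop_norm_leI)
    fix h
    have "(norm (bop_apply (1 - a * a) h))\<^sup>2
        = (norm h)\<^sup>2 - 2 * (norm (bop_apply a h))\<^sup>2 + (norm (bop_apply a (bop_apply a h)))\<^sup>2"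
      by (simp add: bop_apply_simps norm_diff_sq norm_sq_cinner[of "bop_apply a h"] cinner_adj' a(2))
    moreover have "(norm (bop_apply a (bop_apply a h)))\<^sup>2 \<le> (norm (bop_apply a h))\<^sup>2"
      by (intro power_mono contr a) simp
    ultimately have "(norm (bop_apply (1 - a * a) h))\<^sup>2 \<le> (norm h)\<^sup>2"
      using zero_le_power2[of "norm (bop_apply a h)"] by linarith
    then show "norm (bop_apply (1 - a * a) h) \<le> 1 * norm h" unfolding mult_1
        by (rule power2_le_imp_le[OF _ norm_ge_zero])
  qed simp
  obtain y where y: "y \<in> ?D" "2 *\<^sub>R y = (1 - a * a) + y * y" "norm y \<le> 1"
    using quadratic_fixpoint[OF D xD xn] by auto
  obtain y' where y': "y' \<in> ?D" "2 *\<^sub>R y' = y + y' * y'"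
    using quadratic_fixpoint[OF D y(1) y(3)] by auto
  define s where "s = 1 - y"
  define t where "t = 1 - y'"
  \<comment> \<open>\<open>s\<close> is the square root of \<open>a\<^sup>2\<close>; a further square root \<open>t\<close> shows that \<open>s\<close> is positive\<close>
  have ss: "s * s = a * a" using y(2) by (simp add: s_def algebra_simps scaleR_2)
  have tt: "t * t = s" using y'(2) by (simp add: s_def t_def algebra_simps scaleR_2)
  have sa: "adj s = s" "adj t = t" and sZ: "s \<in> Z"
    using y(1) y'(1) by (auto simp: s_def t_def adj_diff adj_one Z_diff)
  have s_half: "norm (s - (1/2) *\<^sub>R 1) \<le> 1/2"
  proof (rule bop_norm_leI)
    fix h
    have ns: "(norm (bop_apply s k))\<^sup>2 = (norm (bop_apply a k))\<^sup>2" for k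
      using sa_norm_sq[OF sa(1)] sa_norm_sq[OF a(2)] ss by simp
    have sc: "norm (bop_apply s k) \<le> norm k" for k
      using ns[of k] contr[OF a(3), of k] by (simp add: power2_eq_iff_nonneg)
    have nt: "(norm (bop_apply t k))\<^sup>2 = Re (cinner (bop_apply s k) k)" for k
      using sa_norm_sq[OF sa(2)] tt by simp
    have tc: "(norm (bop_apply t k))\<^sup>2 \<le> (norm k)\<^sup>2" for k
    proof -
      have "Re (cinner (bop_apply s k) k) \<le> norm (bop_apply s k) * norm k"
        using cinner_cauchy_schwarz complex_Re_le_cmod order_trans by blast
      also have "\<dots> \<le> norm k * norm k" by (intro mult_right_mono sc) simp
      finally show ?thesis unfolding nt by (simp add: power2_eq_square)
    qed
    have "(norm (bop_apply s h))\<^sup>2 \<le> (norm (bop_apply t h))\<^sup>2"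
      using tc[of "bop_apply t h"] tt by (simp flip: bop_apply_simps(4))
    then have "(norm (bop_apply s h))\<^sup>2 \<le> Re (cinner (bop_apply s h) h)" using nt by simp
    moreover have "(norm (bop_apply (s - (1/2) *\<^sub>R 1) h))\<^sup>2
        = (norm (bop_apply s h))\<^sup>2 - Re (cinner (bop_apply s h) h) + (norm h)\<^sup>2 / 4"
      by (simp add: bop_apply_simps norm_diff_sq cinner_scaleR_right power_divide)
    ultimately have "(norm (bop_apply (s - (1/2) *\<^sub>R 1) h))\<^sup>2 \<le> (1/2 * norm h)\<^sup>2"
      by (simp add: power_mult_distrib power_divide)
    then show "norm (bop_apply (s - (1/2) *\<^sub>R 1) h) \<le> 1/2 * norm h" by (rule power2_le_imp_le) simp
  qed simp
  have as: "a * s = s * a" using Z_comm[OF sZ Z_M[OF a(1)]] .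
  have mZ: "s - a \<in> Z" using Z_diff[OF sZ a(1)] .
  obtain z where z: "z \<in> B" "(s - a) * z = 0"
    "\<And>d. d \<in> M \<Longrightarrow> (\<And>m. m \<in> M \<Longrightarrow> (s - a) * m * d = 0) \<Longrightarrow> z * d = d"
    using annihilator_exists[of "{s - a}"] Z_M[OF mZ] by auto
  have "z * (s + a) = s + a"
  proof (rule z(3))
    show "s + a \<in> M" using sZ a(1) by (simp add: Z_M add_in)
    fix m assume m: "m \<in> M"
    have "(s - a) * m * (s + a) = m * ((s - a) * (s + a))"
      using Z_comm[OF mZ m] by (simp only: mult.assoc[symmetric])
    also have "(s - a) * (s + a) = 0" using ss as by (simp add: algebra_simps)
    finally show "(s - a) * m * (s + a) = 0" by simp
  qed
  then have c: "(s + a) * z = s + a" using B_comm[OF z(1), of "s + a"] sZ a(1) by (simp add: Z_M add_in)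
  have "(a - (1/2) *\<^sub>R 1) * z = (s - (1/2) *\<^sub>R 1) * z" using z(2) by (simp add: algebra_simps)
  moreover have "(a + (1/2) *\<^sub>R 1) * (1 - z) = (-1) *\<^sub>R ((s - (1/2) *\<^sub>R 1) * (1 - z))"
    using c by (simp add: algebra_simps)
  ultimately show ?thesis
    using z(1) norm_mult_B[OF z(1), of "s - (1/2) *\<^sub>R 1"] norm_mult_B[OF B_compl[OF z(1)], of
        "s - (1/2) *\<^sub>R 1"] s_half
    by (intro bexI[of _ z]) auto
qed

text \<open>The bisection step: on each side the distance from \<open>a\<close> to a scalar is halved.\<close>
lemma sign_split:
  assumes a: "a \<in> Z" "adj a = a" "norm a \<le> r" and r: "r > 0"
  shows "\<exists>z\<in>B. norm ((a - (r/2) *\<^sub>R 1) * z) \<le> r/2 \<and> norm ((a + (r/2) *\<^sub>R 1) * (1 - z)) \<le> r/2"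
proof -
  have "(1/r) *\<^sub>R a \<in> Z" "adj ((1/r) *\<^sub>R a) = (1/r) *\<^sub>R a" "norm ((1/r) *\<^sub>R a) \<le> 1"
    using a r by (auto simp: Z_scaleR adj_scaleR)
  then obtain z where z: "z \<in> B" "norm (((1/r) *\<^sub>R a - (1/2) *\<^sub>R 1) * z) \<le> 1/2"
    "norm (((1/r) *\<^sub>R a + (1/2) *\<^sub>R 1) * (1 - z)) \<le> 1/2" using sign_split_unit by blast
  have "(a - (r/2) *\<^sub>R 1) * z = r *\<^sub>R (((1/r) *\<^sub>R a - (1/2) *\<^sub>R 1) * z)"
    "(a + (r/2) *\<^sub>R 1) * (1 - z) = r *\<^sub>R (((1/r) *\<^sub>R a + (1/2) *\<^sub>R 1) * (1 - z))"
    using r by (simp_all add: algebra_simps)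
  then show ?thesis using z r by (intro bexI[of _ z]) (auto simp: mult_left_mono[of _ "1/2" r, simplified])
qed

end

section \<open>Strong sums, linear dependence and small idempotents\<close>

text \<open>The vectors \<open>q i h\<close> are pairwise orthogonal and bounded by \<open>K\<close> times \<open>v i h\<close>, whose squared norms are
  summable by Bessel's inequality. The uniform bound \<open>K\<close> makes the finite partial sums Cauchy.\<close>
lemma orthogonal_sum_exists:
  fixes v q :: "'i \<Rightarrow> 'h::complex_hilbert bop"
  assumes v: "\<And>i. i \<in> A \<Longrightarrow> v i * v i = v i" "\<And>i. i \<in> A \<Longrightarrow> adj (v i) = v i"
    and orth: "\<And>i j. i \<in> A \<Longrightarrow> j \<in> A \<Longrightarrow> i \<noteq> j \<Longrightarrow> v i * v j = 0"
    and q: "\<And>i. i \<in> A \<Longrightarrow> v i * q i = q i" "\<And>i. i \<in> A \<Longrightarrow> q i * v i = q i"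
    and K: "\<And>i. i \<in> A \<Longrightarrow> norm (q i) \<le> K" "0 \<le> K"
  shows "\<exists>Q. \<forall>h. ((\<lambda>i. bop_apply (q i) h) has_sum bop_apply Q h) A"
proof -
  have pyth: "(norm (\<Sum>i\<in>F. f i))\<^sup>2 = (\<Sum>i\<in>F. (norm (f i))\<^sup>2)"
    if "finite F" "\<And>i j. i \<in> F \<Longrightarrow> j \<in> F \<Longrightarrow> i \<noteq> j \<Longrightarrow> cinner (f i) (f j) = 0" for F and f :: "'i \<Rightarrow> 'h"
    using that
  proof (induction F rule: finite_induct)
    case (insert a F)
    have "cinner (\<Sum>i\<in>F. f i) (f a) = 0" unfolding cinner_sum_left
      using insert by (intro sum.neutral) auto
    then have "(norm ((\<Sum>i\<in>F. f i) + f a))\<^sup>2 = (norm (\<Sum>i\<in>F. f i))\<^sup>2 + (norm (f a))\<^sup>2" by (rule pythagoras)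
    then show ?case using insert by (simp add: add.commute)
  qed simp
  have ov: "cinner (bop_apply (v i) h) (bop_apply (v j) k) = 0" if "i \<in> A" "j \<in> A" "i \<noteq> j" for i j h k
  proof -
    have "cinner (bop_apply (v i) h) (bop_apply (v j) k) = cinner h (bop_apply (v i * v j) k)"
      by (simp add: cinner_adj v that bop_apply_simps)
    then show ?thesis by (simp add: orth that bop_apply_simps)
  qed
  have oq: "cinner (bop_apply (q i) h) (bop_apply (q j) k) = 0" if "i \<in> A" "j \<in> A" "i \<noteq> j" for i j h k
    using ov[OF that, of "bop_apply (q i) h" "bop_apply (q j) k"] that
    by (simp flip: bop_apply_simps(4) add: q)
  have qv: "norm (bop_apply (q i) h) \<le> K * norm (bop_apply (v i) h)" if "i \<in> A" for i h
  proof -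
    have "bop_apply (q i) h = bop_apply (q i) (bop_apply (v i) h)" using q that by (simp flip: bop_apply_simps(4))
    then show ?thesis
      using order_trans[OF bop_norm mult_right_mono[OF K(1)[OF that] norm_ge_zero]] by simp
  qed
  define f where "f h i = (norm (bop_apply (v i) h))\<^sup>2" for h i
  have f0: "f h i \<ge> 0" for h i by (simp add: f_def)
  have bessel: "sum (f h) F \<le> (norm h)\<^sup>2" if F: "finite F" "F \<subseteq> A" for F h
  proof -
    let ?s = "\<Sum>i\<in>F. bop_apply (v i) h"
    have 1: "(norm ?s)\<^sup>2 = sum (f h) F" unfolding f_def
      by (rule pyth[OF F(1)]) (use ov F(2) in blast)
    have "Re (cinner ?s h) = sum (f h) F"
    proof -
      have "cinner (bop_apply (v i) h) h = complex_of_real (f h i)" if "i \<in> F" for i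
      proof -
        have i: "i \<in> A" using that F by blast
        have "cinner (bop_apply (v i) h) h = cinner (bop_apply (v i * v i) h) h" by (simp only: v(1)[OF i])
        also have "\<dots> = cinner (bop_apply (v i) h) (bop_apply (v i) h)"
            by (simp only: bop_apply_simps cinner_adj[of _ "bop_apply (v i) h"] v(2)[OF i])
        finally show ?thesis by (simp add: f_def cinner_self)
      qed
      then show ?thesis by (simp add: cinner_sum_left)
    qed
    moreover have "Re (cinner ?s h) \<le> norm ?s * norm h"
      using cinner_cauchy_schwarz complex_Re_le_cmod order_trans by blast
    ultimately have "norm ?s * norm ?s \<le> norm ?s * norm h" using 1 by (simp add: power2_eq_square)
    then have "norm ?s \<le> norm h" by (cases "norm ?s = 0") auto
    then have "(norm ?s)\<^sup>2 \<le> (norm h)\<^sup>2" by (intro power_mono) auto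
    then show ?thesis using 1 by simp
  qed
  have part: "(norm (\<Sum>i\<in>F. bop_apply (q i) h))\<^sup>2 \<le> K\<^sup>2 * sum (f h) F" if F: "finite F" "F \<subseteq> A" for F h
  proof -
    have "(norm (\<Sum>i\<in>F. bop_apply (q i) h))\<^sup>2 = (\<Sum>i\<in>F. (norm (bop_apply (q i) h))\<^sup>2)"
      by (rule pyth[OF F(1)]) (use oq F(2) in blast)
    also have "\<dots> \<le> (\<Sum>i\<in>F. K\<^sup>2 * f h i)"
      using qv F by (intro sum_mono) (auto simp: f_def power_mult_distrib[symmetric] intro!: power_mono)
    finally show ?thesis by (simp add: sum_distrib_left)
  qed
  have "(\<lambda>i. bop_apply (q i) h) summable_on A" for h
  proof -
    let ?g = "\<lambda>i. bop_apply (q i) h"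
    define s where "s = (SUP F\<in>{F. finite F \<and> F \<subseteq> A}. sum (f h) F)"
    have bdd: "bdd_above (sum (f h) ` {F. finite F \<and> F \<subseteq> A})" using bessel by (auto intro!: bdd_aboveI)
    have "\<exists>P. eventually P (finite_subsets_at_top A) \<and> (\<forall>F F'. P F \<and> P F' \<longrightarrow> dist (sum ?g F) (sum ?g F') < e)"
      if e: "e > 0" for e
    proof -
      define d where "d = (e/2)\<^sup>2 / (K\<^sup>2 + 1)"
      have pos: "K\<^sup>2 + 1 > 0" by (simp add: add_nonneg_pos)
      have d: "d > 0" using e pos by (simp add: d_def)
      have Kd: "K\<^sup>2 * d < (e/2)\<^sup>2"
      proof -
        have "K\<^sup>2 * d < (K\<^sup>2 + 1) * d" using d by simp
        also have "\<dots> = (e/2)\<^sup>2" using pos by (simp add: d_def)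
        finally show ?thesis .
      qed
      have "s - d < s" using d by simp
      then obtain F0 where F0: "finite F0" "F0 \<subseteq> A" "s - d < sum (f h) F0"
        unfolding s_def using less_cSUP_iff[OF _ bdd] by blast
      have near: "dist (sum ?g F) (sum ?g F0) < e/2" if F: "finite F" "F \<subseteq> A" "F0 \<subseteq> F" for F
      proof -
        have "sum (f h) F \<le> s" unfolding s_def using F by (intro cSUP_upper bdd) auto
        then have "sum (f h) (F - F0) \<le> d" using F F0 by (simp add: sum_diff)
        then have "K\<^sup>2 * sum (f h) (F - F0) \<le> K\<^sup>2 * d" by (rule mult_left_mono) simp
        moreover have "(norm (sum ?g (F - F0)))\<^sup>2 \<le> K\<^sup>2 * sum (f h) (F - F0)"
          by (rule part) (use F in auto)
        ultimately have "(norm (sum ?g (F - F0)))\<^sup>2 < (e/2)\<^sup>2" using Kd by linarith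
        then have "norm (sum ?g (F - F0)) < e/2" by (rule power2_less_imp_less) (use e in simp)
        then show ?thesis using F F0 by (simp add: sum_diff dist_norm)
      qed
      have ev: "eventually (\<lambda>F. finite F \<and> F \<subseteq> A \<and> F0 \<subseteq> F) (finite_subsets_at_top A)"
        unfolding eventually_finite_subsets_at_top using F0 by blast
      have "dist (sum ?g F) (sum ?g F') < e"
        if "finite F \<and> F \<subseteq> A \<and> F0 \<subseteq> F" "finite F' \<and> F' \<subseteq> A \<and> F0 \<subseteq> F'" for F F'
      proof -
        have "dist (sum ?g F) (sum ?g F0) < e/2" "dist (sum ?g F') (sum ?g F0) < e/2"
          by (rule near; use that in blast)+
        then show ?thesis using dist_triangle2[of "sum ?g F" "sum ?g F'" "sum ?g F0"] by linarith
      qed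
      then show ?thesis
        by (intro exI[of _ "\<lambda>F. finite F \<and> F \<subseteq> A \<and> F0 \<subseteq> F"] conjI[OF ev] allI impI) (elim conjE, simp)
    qed
    then have "\<forall>e>0. \<exists>P. eventually P (finite_subsets_at_top A) \<and> (\<forall>F F'. P F \<and> P F'
        \<longrightarrow> dist (sum ?g F) (sum ?g F') < e)"
      by (intro allI impI)
    then have "cauchy_filter (filtermap (sum ?g) (finite_subsets_at_top A))"
      by (simp only: cauchy_filter_metric_filtermap)
    moreover have "complete (UNIV::'h set)"
      by (meson Cauchy_convergent UNIV_I complete_def convergent_def)
    ultimately obtain L where "(sum ?g \<longlongrightarrow> L) (finite_subsets_at_top A)"
      using complete_uniform[where S=UNIV] by (force simp add: filterlim_def)
    then show ?thesis using summable_on_def has_sum_def by blast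
  qed
  then obtain Q where Q: "\<And>h. ((\<lambda>i. bop_apply (q i) h) has_sum Q h) A" unfolding summable_on_def by metis
  have "\<exists>B. \<forall>h. bop_apply B h = Q h"
  proof (rule bop_exists)
    show "Q (x + y) = Q x + Q y" for x y
      using has_sum_unique[OF Q[of "x + y"]] has_sum_add[OF Q[of x] Q[of y]] by (simp add: bop_apply_linear)
    show "Q (c *\<^sub>C x) = c *\<^sub>C Q x" for c x
      using has_sum_unique[OF Q[of "c *\<^sub>C x"]] has_sum_bounded_linear[OF bounded_linear_scaleC Q[of x]]
          by (simp add: bop_apply_linear)
    show "norm (Q x) \<le> K * norm x" for x
    proof (rule tendsto_upperbound)
      show "((\<lambda>F. norm (\<Sum>i\<in>F. bop_apply (q i) x)) \<longlongrightarrow> norm (Q x)) (finite_subsets_at_top A)"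
        using Q[of x] unfolding has_sum_def by (rule tendsto_norm)
      have "norm (\<Sum>i\<in>F. bop_apply (q i) x) \<le> K * norm x" if F: "finite F" "F \<subseteq> A" for F
      proof (rule power2_le_imp_le)
        have "K\<^sup>2 * sum (f x) F \<le> K\<^sup>2 * (norm x)\<^sup>2" using bessel[OF F] by (rule mult_left_mono) simp
        then show "(norm (\<Sum>i\<in>F. bop_apply (q i) x))\<^sup>2 \<le> (K * norm x)\<^sup>2"
          using part[OF F, of x] by (simp add: power_mult_distrib)
      qed (simp add: K)
      then show "\<forall>\<^sub>F F in finite_subsets_at_top A. norm (\<Sum>i\<in>F. bop_apply (q i) x) \<le> K * norm x"
        by (intro eventually_finite_subsets_at_top_weakI) auto
    qed simp
  qed
  then show ?thesis using Q by metis
qed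

lemma homogeneous_system_solvable:
  fixes v :: "'k \<Rightarrow> 'i \<Rightarrow> 'a::field"
  assumes "finite I" "finite K" "card I < card K"
  shows "\<exists>d. (\<exists>k\<in>K. d k \<noteq> 0) \<and> (\<forall>i\<in>I. (\<Sum>k\<in>K. d k * v k i) = 0)"
  using assms
proof (induction I arbitrary: K v rule: finite_induct)
  case empty
  then have "K \<noteq> {}" by auto
  then show ?case by (intro exI[of _ "\<lambda>_. 1"]) auto
next
  case (insert i I)
  show ?case
  proof (cases "\<forall>k\<in>K. v k i = 0")
    case True
    have "card I < card K" using insert by simp
    then obtain d where "\<exists>k\<in>K. d k \<noteq> 0" "\<forall>i\<in>I. (\<Sum>k\<in>K. d k * v k i) = 0"
      using insert.IH[of K v] insert.prems(1) by blast
    then show ?thesis using True by (intro exI[of _ d]) auto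
  next
    case False
    then obtain l where l: "l \<in> K" "v l i \<noteq> 0" by blast
    define u where "u k j = v k j - v k i / v l i * v l j" for k j
    have "card I < card (K - {l})" using insert l by simp
    then obtain d where d: "\<exists>k\<in>K - {l}. d k \<noteq> 0" "\<forall>j\<in>I. (\<Sum>k\<in>K - {l}. d k * u k j) = 0"
      using insert.IH[of "K - {l}" u] insert.prems(1) by blast
    define d' where "d' k = (if k = l then - (\<Sum>k\<in>K - {l}. d k * (v k i / v l i)) else d k)" for k
    have s: "(\<Sum>k\<in>K. d' k * v k j) = (\<Sum>k\<in>K - {l}. d k * u k j)" for j
    proof -
      have "(\<Sum>k\<in>K. d' k * v k j) = d' l * v l j + (\<Sum>k\<in>K - {l}. d' k * v k j)"
        using insert l by (simp add: sum.remove)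
      also have "(\<Sum>k\<in>K - {l}. d' k * v k j) = (\<Sum>k\<in>K - {l}. d k * v k j)"
        by (rule sum.cong) (auto simp: d'_def)
      also have "d' l * v l j = - (\<Sum>k\<in>K - {l}. d k * (v k i / v l i) * v l j)"
        by (simp add: d'_def sum_distrib_right)
      finally show ?thesis by (simp add: u_def right_diff_distrib sum_subtractf mult.assoc)
    qed
    have "(\<Sum>k\<in>K. d' k * v k i) = 0" unfolding s using l by (simp add: u_def)
    moreover have "\<exists>k\<in>K. d' k \<noteq> 0" using d(1) by (auto simp: d'_def)
    ultimately show ?thesis using s d(2) by (intro exI[of _ d']) auto
  qed
qed

lemma idempotent_small: "e * e = e \<Longrightarrow> norm e < 1 \<Longrightarrow> e = (0::'a::real_normed_algebra)"
proof (rule ccontr)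
  assume e: "e * e = e" "norm e < 1" "e \<noteq> 0"
  have "norm e * 1 \<le> norm e * norm e" using norm_mult_ineq[of e e] e(1) by simp
  then show False using e by (simp add: mult_le_cancel_left)
qed

context vn_algebra begin

section \<open>Localization at an ultrafilter of central projections\<close>

definition ultrafilter :: "'h bop set \<Rightarrow> bool"
  where "ultrafilter U \<longleftrightarrow> U \<subseteq> B \<and> 0 \<notin> U \<and> (\<forall>z\<in>U. \<forall>w\<in>U. z * w \<in> U) \<and> (\<forall>z\<in>B. z \<in> U \<or> 1 - z \<in> U)"

text \<open>Compactness of the Stone space of \<open>B\<close>: a property that passes to smaller central projections and to
  orthogonal sums holds for \<open>1\<close> as soon as every ultrafilter has a member with it. Otherwise the
  complements of the projections with the property generate a proper filter, and a maximal filter above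
  it avoids the property.\<close>
lemma ultrafilter_exists:
  assumes Q: "\<And>z w. z \<in> B \<Longrightarrow> w \<in> B \<Longrightarrow> Q z \<Longrightarrow> Q (z * w)"
    "\<And>z w. z \<in> B \<Longrightarrow> w \<in> B \<Longrightarrow> z * w = 0 \<Longrightarrow> Q z \<Longrightarrow> Q w \<Longrightarrow> Q (z + w)"
    and n: "Q 0" "\<not> Q 1"
  shows "\<exists>U. ultrafilter U \<and> (\<forall>z\<in>U. \<not> Q z)"
proof -
  let ?G0 = "{1 - z | z. z \<in> B \<and> Q z}"
  let ?\<F> = "{G. G \<subseteq> B \<and> 0 \<notin> G \<and> (\<forall>z\<in>G. \<forall>w\<in>G. z * w \<in> G) \<and> ?G0 \<subseteq> G}"
  have Bc: "z * w = w * z" if "z \<in> B" "w \<in> B" for z w using B_comm[OF that(2) B_M[OF that(1)]] .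
  have G0: "?G0 \<in> ?\<F>"
  proof -
    have "(1 - z) * (1 - w) \<in> ?G0" if zw: "z \<in> B" "Q z" "w \<in> B" "Q w" for z w
    proof -
      have t: "w * (1 - z) \<in> B" by (intro B_mult B_compl zw)
      have zt: "z * (w * (1 - z)) = 0"
        using Bc[OF zw(1,3)] B_idem[OF zw(1)] by (simp add: right_diff_distrib) (metis mult.assoc right_minus_eq)
      have "Q (z + w * (1 - z))" by (rule Q(2)[OF zw(1) t zt zw(2) Q(1)[OF zw(3) B_compl[OF zw(1)] zw(4)]])
      moreover have "z + w * (1 - z) \<in> B" by (rule B_add[OF zw(1) t zt])
      moreover have "(1 - z) * (1 - w) = 1 - (z + w * (1 - z))"
        using Bc[OF zw(1,3)] by (simp add: algebra_simps)
      ultimately show ?thesis by blast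
    qed
    then show ?thesis using n(2) B_compl by auto
  qed
  have chains: "\<Union>\<C> \<in> ?\<F>" if "\<C> \<noteq> {}" "subset.chain ?\<F> \<C>" for \<C>
  proof -
    have ch: "X \<subseteq> Y \<or> Y \<subseteq> X" if "X \<in> \<C>" "Y \<in> \<C>" for X Y
      using \<open>subset.chain ?\<F> \<C>\<close> that unfolding subset_chain_def by blast
    have F: "X \<in> ?\<F>" if "X \<in> \<C>" for X using \<open>subset.chain ?\<F> \<C>\<close> that unfolding subset_chain_def by blast
    have "z * w \<in> \<Union>\<C>" if zw: "z \<in> \<Union>\<C>" "w \<in> \<Union>\<C>" for z w
    proof -
      obtain X Y where XY: "X \<in> \<C>" "z \<in> X" "Y \<in> \<C>" "w \<in> Y" using zw by blast
      then obtain W where W: "W \<in> \<C>" "z \<in> W" "w \<in> W" using ch[OF XY(1,3)] by blast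
      then have "z * w \<in> W" using F[OF W(1)] by blast
      then show ?thesis using W(1) by blast
    qed
    moreover have "?G0 \<subseteq> \<Union>\<C>" using that(1) F by blast
    moreover have "\<Union>\<C> \<subseteq> B" "0 \<notin> \<Union>\<C>" using F by blast+
    ultimately show ?thesis by blast
  qed
  have ne: "?\<F> \<noteq> {}" using G0 by (metis empty_iff)
  have "\<exists>U\<in>?\<F>. \<forall>G\<in>?\<F>. U \<subseteq> G \<longrightarrow> G = U"
    by (rule subset_Zorn_nonempty[OF ne]) (rule chains)
  then obtain U where U: "U \<in> ?\<F>" and Umax': "\<forall>G\<in>?\<F>. U \<subseteq> G \<longrightarrow> G = U" by (elim bexE)
  have Umax: "G = U" if "G \<in> ?\<F>" "U \<subseteq> G" for G
    by (rule mp[OF bspec[OF Umax' that(1)] that(2)])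
  have UB: "U \<subseteq> B" "0 \<notin> U" "\<And>z w. z \<in> U \<Longrightarrow> w \<in> U \<Longrightarrow> z * w \<in> U" "?G0 \<subseteq> U" using U by blast+
  have "1 - 0 \<in> ?G0" using n(1) B_zero by blast
  then have U1: "1 \<in> U" using UB(4) by auto
  \<comment> \<open>by maximality, adjoining \<open>z\<close> must produce \<open>0\<close>\<close>
  have key: "\<exists>u\<in>U. u * z = 0" if z: "z \<in> B" "z \<notin> U" for z
  proof (rule ccontr)
    assume a: "\<not> ?thesis"
    let ?H = "U \<union> (\<lambda>u. u * z) ` U"
    have p: "u * z * v = u * v * z" "u * (v * z) = u * v * z" "u * z * (v * z) = u * v * z" if "u \<in> U"
        "v \<in> U" for u v
      using Bc[OF z(1), of v] that UB(1) B_idem[OF z(1)] by (simp_all add: mult.assoc subset_iff) (metis mult.assoc)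
    have "?H \<in> ?\<F>"
      using UB a z(1) B_mult by (auto simp: p subset_iff)
    then have "?H = U" by (rule Umax) blast
    moreover have "1 * z \<in> ?H" using U1 by blast
    ultimately show False using z by simp
  qed
  have "ultrafilter U" unfolding ultrafilter_def
  proof (intro conjI ballI)
    fix z assume z: "z \<in> B"
    show "z \<in> U \<or> 1 - z \<in> U"
    proof (rule ccontr)
      assume "\<not> ?thesis"
      then have nz: "z \<notin> U" "1 - z \<notin> U" by blast+
      obtain u where u: "u \<in> U" "u * z = 0" using key[OF z nz(1)] by blast
      obtain v where v: "v \<in> U" "v * (1 - z) = 0" using key[OF B_compl[OF z] nz(2)] by blast
      note uv = u v
      have "v * u = u * v" using Bc u(1) v(1) UB(1) by blast
      then have "u * v * z = v * (u * z)" by (simp add: mult.assoc[symmetric])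
      moreover have "u * v = u * v * z + u * (v * (1 - z))" by (simp add: right_diff_distrib mult.assoc)
      ultimately have "u * v = 0" using uv by simp
      then show False using UB(2) UB(3)[OF uv(1,3)] by simp
    qed
  qed (use UB in auto)
  moreover have "\<not> Q z" if z: "z \<in> U" for z
  proof
    assume "Q z"
    then have "1 - z \<in> U" using UB(1,4) z by blast
    then have "z * (1 - z) \<in> U" by (rule UB(3)[OF z])
    moreover have "z * (1 - z) = 0" using B_idem[of z] UB(1) z by (auto simp: right_diff_distrib)
    ultimately show False using UB(2) by simp
  qed
  ultimately show ?thesis by blast
qed

text \<open>The operators that vanish at the point of the spectrum of the centre given by \<open>U\<close>.\<close>
definition J :: "'h bop set \<Rightarrow> 'h bop set"
  where "J U = {x \<in> M. \<forall>e>0. \<exists>z\<in>U. norm (x * z) < e}"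

context
  fixes U assumes U: "ultrafilter U"
begin

lemma U_B: "z \<in> U \<Longrightarrow> z \<in> B" and U_zero: "0 \<notin> U" and U_mult: "z \<in> U \<Longrightarrow> w \<in> U \<Longrightarrow> z * w \<in> U"
  and U_dich: "z \<in> B \<Longrightarrow> z \<in> U \<or> 1 - z \<in> U"
  using U by (auto simp: ultrafilter_def)

lemma U_one: "1 \<in> U" using U_dich[of 0] U_zero by simp

lemma J_M: "x \<in> J U \<Longrightarrow> x \<in> M" by (simp add: J_def)

lemma J_zero: "0 \<in> J U" using U_one by (auto simp: J_def)

lemma J_D: "x \<in> J U \<Longrightarrow> e > 0 \<Longrightarrow> \<exists>z\<in>U. norm (x * z) < e" by (simp add: J_def)

lemma J_add: assumes "x \<in> J U" "y \<in> J U" shows "x + y \<in> J U"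
  unfolding J_def mem_Collect_eq
proof (intro conjI allI impI)
  show "x + y \<in> M" using assms by (simp add: J_M add_in)
  fix e :: real assume "e > 0"
  then obtain z w where zw: "z \<in> U" "norm (x * z) < e/2" "w \<in> U" "norm (y * w) < e/2"
    using J_D[OF assms(1), of "e/2"] J_D[OF assms(2), of "e/2"] by auto
  have "(x + y) * (z * w) = (x * z) * w + (y * w) * z"
    using B_comm[OF U_B[OF zw(3)] B_M[OF U_B[OF zw(1)]]] by (simp add: distrib_right mult.assoc)
  then have "norm ((x + y) * (z * w)) \<le> norm (x * z) + norm (y * w)"
    using norm_triangle_ineq[of "(x * z) * w" "(y * w) * z"] norm_mult_B[OF U_B[OF zw(3)], of "x * z"]
      norm_mult_B[OF U_B[OF zw(1)], of "y * w"] by simp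
  then show "\<exists>z\<in>U. norm ((x + y) * z) < e" using U_mult[OF zw(1,3)] zw(2,4) by (intro bexI[of _ "z * w"]) auto
qed

lemma J_bounded_image:
  assumes x: "x \<in> J U" and y: "y \<in> M" and K: "\<And>z. z \<in> U \<Longrightarrow> norm (y * z) \<le> K * norm (x * z)"
  shows "y \<in> J U"
  unfolding J_def mem_Collect_eq
proof (intro conjI y allI impI)
  fix e :: real assume e: "e > 0"
  obtain z where z: "z \<in> U" "norm (x * z) < e / (\<bar>K\<bar> + 1)" using J_D[OF x, of "e / (\<bar>K\<bar> + 1)"] e by auto
  have "norm (y * z) \<le> (\<bar>K\<bar> + 1) * norm (x * z)"
    using K[OF z(1)] mult_right_mono[of K "\<bar>K\<bar> + 1" "norm (x * z)"] by fastforce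
  also have "\<dots> < e" using z(2) by (simp add: pos_less_divide_eq mult.commute)
  finally show "\<exists>z\<in>U. norm (y * z) < e" using z by blast
qed

lemma J_mult_left: "x \<in> J U \<Longrightarrow> a \<in> M \<Longrightarrow> a * x \<in> J U"
  by (rule J_bounded_image[of x _ "norm a"]) (simp_all add: J_M mult_in mult.assoc norm_mult_ineq)

lemma J_mult_right: assumes x: "x \<in> J U" and a: "a \<in> M" shows "x * a \<in> J U"
proof (rule J_bounded_image[OF x])
  show "x * a \<in> M" using x a by (simp add: J_M mult_in)
  fix z assume "z \<in> U"
  then have "x * a * z = (x * z) * a" using B_comm[OF U_B a] by (simp add: mult.assoc)
  then show "norm (x * a * z) \<le> norm a * norm (x * z)" by (simp add: norm_mult_ineq mult.commute[of "norm a"])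
qed

lemma J_scaleC: "x \<in> J U \<Longrightarrow> c *\<^sub>C x \<in> J U"
  by (rule J_bounded_image[of x _ "cmod c"]) (simp_all add: J_M scaleC_in scaleC_bop_mult norm_scaleC_bop_le)

lemma J_sum: "(\<And>i. i \<in> I \<Longrightarrow> f i \<in> J U) \<Longrightarrow> sum f I \<in> J U"
  by (induction I rule: infinite_finite_induct) (auto simp: J_zero J_add)

text \<open>A nonzero idempotent has norm at least \<open>1\<close>, so an idempotent cannot be small without being zero.\<close>
lemma J_idempotent: assumes "q \<in> M" "q * q = q" shows "q \<in> J U \<longleftrightarrow> (\<exists>z\<in>U. q * z = 0)"
proof
  assume "q \<in> J U"
  then obtain z where z: "z \<in> U" "norm (q * z) < 1" using J_D[of q 1] by auto
  have "(q * z) * (q * z) = q * z"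
    using B_comm[OF U_B[OF z(1)] assms(1)] B_idem[OF U_B[OF z(1)]] assms(2) by (metis mult.assoc)
  then show "\<exists>z\<in>U. q * z = 0" using idempotent_small z by blast
next
  assume "\<exists>z\<in>U. q * z = 0"
  then obtain z where "z \<in> U" "norm (q * z) = 0" by auto
  then show "q \<in> J U" using assms(1) unfolding J_def by force
qed

lemma norm_U: "z \<in> U \<Longrightarrow> 1 \<le> norm z"
  using idempotent_small[of z] B_idem U_B U_zero by force

text \<open>Bisection with \<open>sign_split\<close>: for each \<open>k\<close> the ultrafilter picks a scalar that is within \<open>R / 2 ^ k\<close> of
  \<open>a\<close> over one of its members. Two such scalars are close, because any two members of \<open>U\<close> meet in a
  nonzero projection, so the scalars converge.\<close>
lemma selfadjoint_scalar_mod_J: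
  assumes a: "a \<in> Z" "adj a = a"
  shows "\<exists>c::real. a - c *\<^sub>R 1 \<in> J U"
proof -
  define R where "R = norm a + 1"
  have R: "R > 0" by (simp add: R_def add_nonneg_pos)
  have "\<exists>c. \<exists>z\<in>U. norm ((a - c *\<^sub>R 1) * z) \<le> R / 2 ^ k" for k
  proof (induction k)
    case 0 then show ?case using U_one by (intro exI[of _ 0] bexI[of _ 1]) (auto simp: R_def)
  next
    case (Suc k)
    then obtain c z where z: "z \<in> U" "norm ((a - c *\<^sub>R 1) * z) \<le> R / 2 ^ k" by blast
    let ?r = "R / 2 ^ k" and ?b = "(a - c *\<^sub>R 1) * z"
    note zB = U_B[OF z(1)]
    have bZ: "?b \<in> Z" using a(1) B_Z[OF zB] by (simp add: Z_mult Z_diff Z_scaleR)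
    have "adj ?b = z * (a - c *\<^sub>R 1)" using a zB by (simp add: adj_mult adj_diff adj_scaleR adj_one B_adj)
    also have "\<dots> = ?b" using B_comm[OF zB, of "a - c *\<^sub>R 1"] a by (simp add: Z_M diff_in scaleR_in)
    finally have ba: "adj ?b = ?b" .
    obtain s where s: "s \<in> B" "norm ((?b - (?r/2) *\<^sub>R 1) * s) \<le> ?r/2" "norm ((?b + (?r/2) *\<^sub>R 1) * (1 - s)) \<le> ?r/2"
      using sign_split[OF bZ ba z(2)] R by auto
    have zz: "z * z = z" using B_idem[OF zB] .
    have e: "(a - (c + d) *\<^sub>R 1) * (z * t) = ((?b - d *\<^sub>R 1) * t) * z" if "t \<in> B" for t d
    proof -
      have tz: "t * z = z * t" using B_comm[OF zB B_M[OF that]] .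
      have "((?b - d *\<^sub>R 1) * t) * z = (a - c *\<^sub>R 1) * (z * (t * z)) - d *\<^sub>R (t * z)"
        by (simp add: left_diff_distrib mult.assoc)
      also have "z * (t * z) = z * t" unfolding tz by (simp add: mult.assoc[symmetric] zz)
      finally show ?thesis unfolding tz by (simp add: left_diff_distrib scaleR_left_distrib distrib_right)
    qed
    have half: "\<exists>c. \<exists>z\<in>U. norm ((a - c *\<^sub>R 1) * z) \<le> R / 2 ^ Suc k"
      if t: "t \<in> U" and n: "norm ((?b - d *\<^sub>R 1) * t) \<le> ?r/2" for t d
      using norm_mult_B[OF zB, of "(?b - d *\<^sub>R 1) * t"] n e[OF U_B[OF t], of d] U_mult[OF z(1) t]
      by (intro exI[of _ "c + d"] bexI[of _ "z * t"]) auto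
    from U_dich[OF s(1)] show ?case
      using half[of s "?r/2"] half[of "1 - s" "- (?r/2)"] s(2,3) by auto
  qed
  then obtain c where c: "\<And>k. \<exists>z\<in>U. norm ((a - c k *\<^sub>R 1) * z) \<le> R / 2 ^ k" by metis
  have cc: "\<bar>c k - c l\<bar> \<le> R / 2 ^ k + R / 2 ^ l" for k l
  proof -
    obtain z w where zw: "z \<in> U" "w \<in> U" "norm ((a - c k *\<^sub>R 1) * z) \<le> R / 2 ^ k"
        "norm ((a - c l *\<^sub>R 1) * w) \<le> R / 2 ^ l"
      using c by blast
    have "(c k - c l) *\<^sub>R (z * w) = ((a - c l *\<^sub>R 1) * w) * z - ((a - c k *\<^sub>R 1) * z) * w"
      using B_comm[OF U_B[OF zw(1)] B_M[OF U_B[OF zw(2)]]] by (simp add: algebra_simps)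
    then have "\<bar>c k - c l\<bar> * norm (z * w) \<le> norm (((a - c l *\<^sub>R 1) * w) * z) + norm (((a - c k *\<^sub>R 1) * z) * w)"
      by (metis norm_scaleR norm_triangle_ineq4)
    also have "\<dots> \<le> R / 2 ^ l + R / 2 ^ k"
      using norm_mult_B[OF U_B[OF zw(1)], of "(a - c l *\<^sub>R 1) * w"] norm_mult_B[OF U_B[OF zw(2)], of
          "(a - c k *\<^sub>R 1) * z"] zw by linarith
    finally show ?thesis using norm_U[OF U_mult[OF zw(1,2)]] mult_left_mono[of 1 "norm (z * w)"
        "\<bar>c k - c l\<bar>"] by simp
  qed
  have lim0: "(\<lambda>k. R / 2 ^ k) \<longlonglongrightarrow> 0"
    using tendsto_mult_right_zero[OF LIMSEQ_power_zero[of "1/2::real"], of R] by (simp add: power_divide)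
  have "Cauchy c"
  proof (rule metric_CauchyI)
    fix e :: real assume "e > 0"
    then obtain N where N: "\<And>k. k \<ge> N \<Longrightarrow> \<bar>R / 2 ^ k\<bar> < e/2"
      using LIMSEQ_D[OF lim0, of "e/2"] by auto
    have "dist (c k) (c l) < e" if "k \<ge> N" "l \<ge> N" for k l
      using cc[of k l] N[OF that(1)] N[OF that(2)] unfolding dist_real_def by linarith
    then show "\<exists>N. \<forall>k\<ge>N. \<forall>l\<ge>N. dist (c k) (c l) < e" by blast
  qed
  then obtain L where L: "c \<longlonglongrightarrow> L" using Cauchy_convergent_iff convergent_def by blast
  have "a - L *\<^sub>R 1 \<in> J U" unfolding J_def mem_Collect_eq
  proof (intro conjI allI impI)
    show "a - L *\<^sub>R 1 \<in> M" using a by (simp add: Z_M diff_in scaleR_in)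
    fix e :: real assume e: "e > 0"
    have "(\<lambda>k. R / 2 ^ k + \<bar>c k - L\<bar>) \<longlonglongrightarrow> 0 + 0"
      using L by (intro tendsto_add lim0 tendsto_rabs_zero) (simp add: LIM_zero_iff)
    from LIMSEQ_D[OF this[unfolded add_0_left] e]
    obtain k where "norm (R / 2 ^ k + \<bar>c k - L\<bar> - 0) < e" by blast
    then have k: "R / 2 ^ k + \<bar>c k - L\<bar> < e"
      unfolding real_norm_def diff_0_right by (rule le_less_trans[OF abs_ge_self])
    obtain z where z: "z \<in> U" "norm ((a - c k *\<^sub>R 1) * z) \<le> R / 2 ^ k" using c by blast
    have "(a - L *\<^sub>R 1) * z = (a - c k *\<^sub>R 1) * z + (c k - L) *\<^sub>R z" by (simp add: algebra_simps)
    then have "norm ((a - L *\<^sub>R 1) * z) \<le> R / 2 ^ k + \<bar>c k - L\<bar> * norm z"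
      using norm_triangle_ineq[of "(a - c k *\<^sub>R 1) * z" "(c k - L) *\<^sub>R z"] z(2) by simp
    also have "\<dots> \<le> R / 2 ^ k + \<bar>c k - L\<bar>" using B_norm[OF U_B[OF z(1)]] mult_left_mono[of "norm z" 1
        "\<bar>c k - L\<bar>"] by simp
    finally show "\<exists>z\<in>U. norm ((a - L *\<^sub>R 1) * z) < e" using k z(1) by (intro bexI[of _ z]) auto
  qed
  then show ?thesis by blast
qed

lemma scalar_mod_J:
  assumes a: "a \<in> Z"
  shows "\<exists>c::complex. a - c *\<^sub>C 1 \<in> J U"
proof -
  define h where "h = (1/2) *\<^sub>C (a + adj a)"
  define k where "k = (- \<i>/2) *\<^sub>C (a - adj a)"
  have "h \<in> Z" "adj h = h" "k \<in> Z"
    using a by (simp_all add: h_def k_def Z_adj Z_add Z_diff Z_scaleC adj_scaleC adj_add add.commute)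
  moreover have "adj k = k"
    by (simp add: k_def adj_scaleC adj_diff scaleC_diff_right scaleC_minus_left)
  ultimately obtain r s where rs: "h - r *\<^sub>R 1 \<in> J U" "k - s *\<^sub>R 1 \<in> J U"
    using selfadjoint_scalar_mod_J by blast
  have "a = h + \<i> *\<^sub>C k"
  proof -
    have "h + \<i> *\<^sub>C k = (1/2 + 1/2) *\<^sub>C a"
      unfolding h_def k_def scaleC_scaleC
      by (simp only: scaleC_add_left) (simp add: scaleC_add_right scaleC_diff_right)
    then show ?thesis by (simp add: scaleC_one)
  qed
  then have "a - (complex_of_real r + \<i> * complex_of_real s) *\<^sub>C 1 = (h - r *\<^sub>R 1) + \<i> *\<^sub>C (k - s *\<^sub>R 1)"
    by (simp add: scaleC_add_left scaleC_diff_right scaleR_scaleC scaleC_scaleC)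
  then show ?thesis using J_add[OF rs(1) J_scaleC[OF rs(2), of \<i>]] by metis
qed

text \<open>If \<open>M\<close> is generated by finitely many elements \<open>b i\<close> over its centre, its quotient by \<open>J U\<close> is spanned
  by their classes over the complex numbers, since the coefficients become scalars.\<close>
lemma dependent_mod_J:
  assumes I: "finite I" "\<And>i. i \<in> I \<Longrightarrow> b i \<in> M"
    and co: "\<And>x i. x \<in> M \<Longrightarrow> i \<in> I \<Longrightarrow> cf i x \<in> Z" "\<And>x. x \<in> M \<Longrightarrow> x = (\<Sum>i\<in>I. cf i x * b i)"
    and K: "finite K" "card I < card K" "\<And>k. k \<in> K \<Longrightarrow> x k \<in> M"
  shows "\<exists>d. (\<exists>k\<in>K. d k \<noteq> 0) \<and> (\<Sum>k\<in>K. d k *\<^sub>C x k) \<in> J U"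
proof -
  have "\<exists>c. cf i (x k) - c *\<^sub>C 1 \<in> J U" if "i \<in> I" "k \<in> K" for i k
    using scalar_mod_J co(1) K(3) that by blast
  note ex = this
  define v where "v k i = (SOME c. cf i (x k) - c *\<^sub>C 1 \<in> J U)" for k i
  have v: "cf i (x k) - v k i *\<^sub>C 1 \<in> J U" if "i \<in> I" "k \<in> K" for i k
    unfolding v_def using ex[OF that] by (rule someI_ex)
  obtain d where d: "\<exists>k\<in>K. d k \<noteq> 0" "\<And>i. i \<in> I \<Longrightarrow> (\<Sum>k\<in>K. d k * v k i) = 0"
    using homogeneous_system_solvable[OF I(1) K(1,2), of v] by blast
  have red: "x k - (\<Sum>i\<in>I. v k i *\<^sub>C b i) \<in> J U" if "k \<in> K" for k
  proof -
    have "x k - (\<Sum>i\<in>I. v k i *\<^sub>C b i) = (\<Sum>i\<in>I. (cf i (x k) - v k i *\<^sub>C 1) * b i)"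
      by (subst co(2)[OF K(3)[OF that]]) (simp add: sum_subtractf left_diff_distrib scaleC_bop_mult)
    then show ?thesis using v I(2) that by (auto intro!: J_sum J_mult_right)
  qed
  have "(\<Sum>k\<in>K. d k *\<^sub>C (\<Sum>i\<in>I. v k i *\<^sub>C b i)) = (\<Sum>i\<in>I. (\<Sum>k\<in>K. d k * v k i) *\<^sub>C b i)"
    unfolding scaleC_sum_right scaleC_sum_left scaleC_scaleC by (rule sum.swap)
  also have "\<dots> = 0" using d(2) by (simp add: scaleC_zero_left)
  finally have "(\<Sum>k\<in>K. d k *\<^sub>C x k) = (\<Sum>k\<in>K. d k *\<^sub>C (x k - (\<Sum>i\<in>I. v k i *\<^sub>C b i)))"
    by (simp add: scaleC_diff_right sum_subtractf)
  also have "\<dots> \<in> J U" by (intro J_sum J_scaleC red)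
  finally show ?thesis using d(1) by blast
qed

end

end

section \<open>Inverses and idempotents in a corner\<close>

lemma neumann_fixpoint:
  fixes y :: "'a::{real_normed_algebra, banach}"
  assumes D: "comm_subalgebra D" "y \<in> D" and y: "norm y < 1"
  shows "\<exists>g\<in>D. g = y + y * g"
proof -
  have "\<exists>!g\<in>D. y + y * g = g"
  proof (rule Banach_fix[where c = "norm y"])
    show "complete D" using D(1) unfolding comm_subalgebra_def by (simp add: complete_eq_closed)
    show "D \<noteq> {}" using D by blast
    show "(\<lambda>g. y + y * g) ` D \<subseteq> D"
      using D unfolding comm_subalgebra_def by (intro image_subsetI) blast
    show "dist (y + y * g) (y + y * h) \<le> norm y * dist g h" for g h
      by (simp add: dist_norm right_diff_distrib[symmetric] norm_mult_ineq)
  qed (use y in auto)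
  then show ?thesis by metis
qed

context vn_algebra begin

text \<open>Functions of \<open>a\<close> in the corner \<open>p M p\<close>: what they commute with is controlled by \<open>a\<close> alone.\<close>
definition corner_bicommutant :: "'h bop \<Rightarrow> 'h bop \<Rightarrow> 'h bop set"
  where "corner_bicommutant p a = {d \<in> M. p * d = d \<and> d * p = d \<and> (\<forall>c\<in>M. c * a = a * c \<longrightarrow> c * d = d * c)}"

lemma comm_subalgebra_bicommutant:
  assumes a: "a \<in> M"
  shows "comm_subalgebra (corner_bicommutant p a)"
  unfolding comm_subalgebra_def
proof (intro conjI ballI allI)
  have "corner_bicommutant p a = M \<inter> {d. p * d = d} \<inter> {d. d * p = d} \<inter> (\<Inter>c\<in>{c\<in>M. c * a = a * c}. {d. c * d
      = d * c})"
    by (auto simp: corner_bicommutant_def)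
  then show "closed (corner_bicommutant p a)"
    by (auto intro!: closed_Int closed_M closed_INT closed_Collect_eq continuous_intros)
  show "0 \<in> corner_bicommutant p a" by (simp add: corner_bicommutant_def)
  fix d d' assume d: "d \<in> corner_bicommutant p a" "d' \<in> corner_bicommutant p a"
  show "d + d' \<in> corner_bicommutant p a" using d
      by (auto simp: corner_bicommutant_def add_in distrib_left distrib_right)
  show "d * d' \<in> corner_bicommutant p a"
    unfolding corner_bicommutant_def mem_Collect_eq
  proof (intro conjI ballI impI)
    show "d * d' \<in> M" "p * (d * d') = d * d'" "d * d' * p = d * d'"
      using d by (simp_all add: corner_bicommutant_def mult_in mult.assoc) (simp add: mult.assoc[symmetric])
    fix c assume "c \<in> M" "c * a = a * c"
    then have "c * d = d * c" "c * d' = d' * c" using d by (auto simp: corner_bicommutant_def)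
    then show "c * (d * d') = d * d' * c" by (metis mult.assoc)
  qed
  have "d * a = a * d" using d a by (auto simp: corner_bicommutant_def)
  then show "d * d' = d' * d" using d by (auto simp: corner_bicommutant_def)
next
  fix r d assume "d \<in> corner_bicommutant p a"
  then show "r *\<^sub>R d \<in> corner_bicommutant p a" by (auto simp: corner_bicommutant_def scaleR_in)
qed

text \<open>The inverse of \<open>p - s\<close> in the corner is \<open>p\<close> plus the geometric series of \<open>s\<close>.\<close>
lemma neumann_corner:
  assumes s: "s \<in> M" "p * s = s" "s * p = s" "norm s < 1" and p: "p * p = p"
  shows "\<exists>g\<in>M. (\<forall>c\<in>M. c * s = s * c \<longrightarrow> c * g = g * c) \<and> p * g = g \<and> g * p = g \<and>
    (p - s) * (p + g) = p"
proof -
  have "s \<in> corner_bicommutant p s" using s by (auto simp: corner_bicommutant_def)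
  then obtain g where g: "g \<in> corner_bicommutant p s" "g = s + s * g"
    using neumann_fixpoint[OF comm_subalgebra_bicommutant[OF s(1)] _ s(4)] by blast
  have "(p - s) * (p + g) = p + g - (s + s * g)"
    using g(1) s p by (simp add: corner_bicommutant_def algebra_simps)
  also have "\<dots> = p" using g(2) by simp
  finally show ?thesis using g(1) by (auto simp: corner_bicommutant_def)
qed

text \<open>Lifting of idempotents. With \<open>1 - y\<close> the square root of \<open>(1 - 2a)\<^sup>2\<close> and \<open>1 + g\<close> its inverse,
  \<open>(1 - 2a) (1 + g)\<close> has square \<open>1\<close>, hence is \<open>1 - 2e\<close> for an idempotent \<open>e\<close>.\<close>
lemma idempotent_near:
  assumes a: "a \<in> M" "p * a = a" "a * p = a" and d: "norm (4 *\<^sub>R (a - a * a)) \<le> r" "r \<le> 1/2"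
  shows "\<exists>e\<in>corner_bicommutant p a. e * e = e \<and> norm (e - a) \<le> (2 * norm a + 1) * r"
proof -
  let ?D = "corner_bicommutant p a" and ?x = "4 *\<^sub>R (a - a * a)"
  note D = comm_subalgebra_bicommutant[OF a(1), of p]
  have clos: "u + v \<in> ?D" "u * v \<in> ?D" "u * v = v * u" "t *\<^sub>R u \<in> ?D" if "u \<in> ?D" "v \<in> ?D" for u v t
    using D that unfolding comm_subalgebra_def by blast+
  have aD: "a \<in> ?D" using a by (auto simp: corner_bicommutant_def)
  have "(-1) *\<^sub>R (a * a) \<in> ?D" by (rule clos(4)[OF clos(2)[OF aD aD] aD])
  then have "a + (-1) *\<^sub>R (a * a) \<in> ?D" by (rule clos(1)[OF aD])
  from clos(4)[OF this this, of 4] have xD: "?x \<in> ?D" by simp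
  obtain y where y: "y \<in> ?D" "2 *\<^sub>R y = ?x + y * y" "norm y \<le> r"
    using quadratic_fixpoint[OF D xD d(1)] d(2) by auto
  obtain g where g: "g \<in> ?D" "g = y + y * g"
    using neumann_fixpoint[OF D y(1)] y(3) d(2) by force
  have yg: "y * g = g * y" and ag: "a * g = g * a" using clos(3) y(1) g(1) aD by blast+
  define e where "e = a + a * g - (1/2) *\<^sub>R g"
  have "(-1/2) *\<^sub>R g \<in> ?D" by (rule clos(4)[OF g(1) g(1)])
  then have "a + (a * g + (-1/2) *\<^sub>R g) \<in> ?D" by (intro clos(1,2) aD g(1))
  then have eD: "e \<in> ?D" by (simp add: e_def add_diff_eq)
  have e2: "1 - 2 *\<^sub>R e = (1 - 2 *\<^sub>R a) * (1 + g)"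
    by (simp add: e_def algebra_simps scaleR_2)
  have c1: "(1 - 2 *\<^sub>R a) * (1 + g) = (1 + g) * (1 - 2 *\<^sub>R a)" using ag by (simp add: algebra_simps)
  have c2: "(1 - y) * (1 + g) = 1" "(1 + g) * (1 - y) = 1"
    using g(2) yg by (simp_all add: algebra_simps)
  have sq: "(1 - 2 *\<^sub>R a) * (1 - 2 *\<^sub>R a) = (1 - y) * (1 - y)"
  proof -
    have "(1 - 2 *\<^sub>R a) * (1 - 2 *\<^sub>R a) = 1 - ?x" by (simp add: algebra_simps flip: scaleR_2)
    moreover have "(1 - y) * (1 - y) = 1 - ?x" using y(2) by (simp add: algebra_simps scaleR_2)
    ultimately show ?thesis by simp
  qed
  have "(1 - 2 *\<^sub>R e) * (1 - 2 *\<^sub>R e) = (1 + g) * ((1 - 2 *\<^sub>R a) * (1 - 2 *\<^sub>R a)) * (1 + g)"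
    unfolding e2 by (metis c1 mult.assoc)
  also have "\<dots> = ((1 + g) * (1 - y)) * ((1 - y) * (1 + g))" unfolding sq by (simp only: mult.assoc)
  also have "\<dots> = 1" by (simp add: c2)
  finally have "4 *\<^sub>R (e * e) = 4 *\<^sub>R e" by (simp add: algebra_simps flip: scaleR_2) 
  then have ee: "e * e = e" by simp
  have "norm g \<le> norm y + norm y * norm g"
    using g(2) norm_triangle_ineq[of y "y * g"] norm_mult_ineq[of y g] by simp
  also have "norm y * norm g \<le> 1/2 * norm g" using y(3) d(2) by (intro mult_right_mono) auto
  finally have ng: "norm g \<le> 2 * r" using y(3) by simp
  have "norm (e - a) \<le> norm (a * g) + norm ((1/2) *\<^sub>R g)"
    unfolding e_def using norm_triangle_ineq4[of "a * g" "(1/2) *\<^sub>R g"] by simp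
  also have "\<dots> \<le> norm a * norm g + 1/2 * norm g" using norm_mult_ineq[of a g] by simp
  also have "\<dots> = (norm a + 1/2) * norm g" by (simp add: algebra_simps)
  also have "\<dots> \<le> (norm a + 1/2) * (2 * r)" using ng by (intro mult_left_mono) auto
  finally show ?thesis using eD ee by (intro bexI[of _ e]) (auto simp: algebra_simps)
qed

end

section \<open>Bounded maximal families of idempotents\<close>

text \<open>The setting of property (J), with coordinates that express that \<open>M\<close> is generated by finitely many
  \<open>b i\<close> over its centre.\<close>
locale maximal_family = vn_algebra M for M :: "'h::complex_hilbert bop set" +
  fixes T :: "'h bop" and F :: "'h bop set" and K :: real
    and I :: "'i set" and b :: "'i \<Rightarrow> 'h bop" and cf :: "'i \<Rightarrow> 'h bop \<Rightarrow> 'h bop"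
  assumes TM: "T \<in> M"
    and fam: "abelian_idempotent_family (commutant {T} \<inter> M) F"
    and bdd: "\<And>q. q \<in> F \<Longrightarrow> norm q \<le> K"
    and maximal: "\<And>G. abelian_idempotent_family (commutant {T} \<inter> M) G \<Longrightarrow> F \<subseteq> G \<Longrightarrow> G = F"
    and I: "finite I" "\<And>i. i \<in> I \<Longrightarrow> b i \<in> M"
    and co: "\<And>x i. x \<in> M \<Longrightarrow> i \<in> I \<Longrightarrow> cf i x \<in> Z" "\<And>x. x \<in> M \<Longrightarrow> x = (\<Sum>i\<in>I. cf i x * b i)"
begin

lemma F_M: "q \<in> F \<Longrightarrow> q \<in> M" and F_T: "q \<in> F \<Longrightarrow> q * T = T * q" and F_idem: "q \<in> F \<Longrightarrow> q * q = q"
  and F_comm: "q \<in> F \<Longrightarrow> q' \<in> F \<Longrightarrow> q * q' = q' * q"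
  using fam by (auto simp: abelian_idempotent_family_def commutant_def)

text \<open>The form in which maximality is used: whatever commutes with \<open>T\<close> and with the family already belongs
  to it. In particular \<open>F\<close> contains the central projections and is closed under Boolean operations.\<close>
lemma F_max:
  assumes "q \<in> M" "q * T = T * q" "q * q = q" "\<And>f. f \<in> F \<Longrightarrow> q * f = f * q"
  shows "q \<in> F"
proof -
  have "abelian_idempotent_family (commutant {T} \<inter> M) (insert q F)"
    using fam assms unfolding abelian_idempotent_family_def commutant_def by auto
  then show ?thesis using maximal by blast
qed

lemma B_F: "z \<in> B \<Longrightarrow> z \<in> F"
  by (rule F_max[OF B_M B_comm[OF _ TM, symmetric] B_idem B_comm[OF _ F_M, symmetric]])

lemma F_mult: assumes "p \<in> F" "q \<in> F" shows "p * q \<in> F"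
proof (rule F_max)
  have c: "c * (p * q) = p * q * c" if "c * p = p * c" "c * q = q * c" for c using that by (metis mult.assoc)
  show "p * q * T = T * (p * q)" using c F_T assms by metis
  show "p * q * f = f * (p * q)" if "f \<in> F" for f using c F_comm assms that by metis
  show "p * q * (p * q) = p * q" using c F_idem F_comm assms by (metis mult.assoc)
qed (use assms F_M mult_in in blast)

lemma F_diff: assumes "p \<in> F" "q \<in> F" "q * p = q" shows "p - q \<in> F"
proof (rule F_max)
  have "p * q = q" using assms F_comm by metis
  then show "(p - q) * (p - q) = p - q" using assms F_idem by (simp add: algebra_simps)
qed (use assms F_M diff_in F_T F_comm in \<open>auto simp: algebra_simps\<close>)

lemma F_sum:
  assumes "finite Q" "Q \<subseteq> F" "\<And>p q. p \<in> Q \<Longrightarrow> q \<in> Q \<Longrightarrow> p \<noteq> q \<Longrightarrow> p * q = 0"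
  shows "\<Sum>Q \<in> F \<and> (\<forall>q\<in>Q. q * \<Sum>Q = q \<and> \<Sum>Q * q = q)"
proof -
  have 1: "q * \<Sum>Q = q \<and> \<Sum>Q * q = q" if q: "q \<in> Q" for q
  proof -
    have "q * \<Sum>Q = (\<Sum>p\<in>Q. q * p)" "\<Sum>Q * q = (\<Sum>p\<in>Q. p * q)" by (simp_all add: sum_distrib_left sum_distrib_right)
    moreover have "(\<Sum>p\<in>Q. q * p) = q * q + (\<Sum>p\<in>Q - {q}. q * p)" "(\<Sum>p\<in>Q. p * q) = q * q + (\<Sum>p\<in>Q - {q}. p * q)"
      using sum.remove[OF assms(1) q] by blast+
    moreover have "(\<Sum>p\<in>Q - {q}. q * p) = 0" "(\<Sum>p\<in>Q - {q}. p * q) = 0"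
      by (rule sum.neutral; use assms(3) q in blast)+
    ultimately show ?thesis using F_idem[of q] assms(2) q by auto
  qed
  have M: "sum g Q \<in> M" if "\<And>q. q \<in> Q \<Longrightarrow> g q \<in> M" for g
    using assms(1) that by (induction Q rule: finite_induct) (auto simp: add_in)
  have "\<Sum>Q \<in> F"
  proof (rule F_max)
    show "\<Sum>Q \<in> M" using M[of "\<lambda>x. x"] assms F_M by auto
    show "\<Sum>Q * T = T * \<Sum>Q" using assms F_T by (auto simp: sum_distrib_left sum_distrib_right intro!: sum.cong)
    show "\<Sum>Q * f = f * \<Sum>Q" if "f \<in> F" for f
      using assms F_comm that by (auto simp: sum_distrib_left sum_distrib_right intro!: sum.cong)
    have "\<Sum>Q * \<Sum>Q = (\<Sum>q\<in>Q. q * \<Sum>Q)" by (simp add: sum_distrib_right)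
    also have "\<dots> = \<Sum>Q" using 1 by simp
    finally show "\<Sum>Q * \<Sum>Q = \<Sum>Q" .
  qed
  then show ?thesis using 1 by blast
qed

text \<open>The idempotent \<open>q\<close> cuts \<open>p\<close> into two parts that are both nonzero over every nonzero part of \<open>v\<close>.\<close>
definition splits_on where
  "splits_on p v q \<longleftrightarrow> v \<in> B \<and> v \<noteq> 0 \<and> q \<in> F \<and> q * p = q \<and> q * v = q \<and>
    (\<forall>z\<in>B. z * v = z \<and> z \<noteq> 0 \<longrightarrow> q * z \<noteq> 0 \<and> (p - q) * z \<noteq> 0)"

definition split_system where
  "split_system p A \<longleftrightarrow> (\<forall>(v, q)\<in>A. splits_on p v q) \<and> (\<forall>i\<in>A. \<forall>j\<in>A. i \<noteq> j \<longrightarrow> fst i * fst j = 0)"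

lemma maximal_split_system:
  "\<exists>A. split_system p A \<and> (\<forall>A'. split_system p A' \<and> A \<subseteq> A' \<longrightarrow> A' = A)"
proof -
  have "\<exists>A\<in>{A. split_system p A}. \<forall>A'\<in>{A. split_system p A}. A \<subseteq> A' \<longrightarrow> A' = A"
  proof (rule subset_Zorn')
    fix C assume C: "subset.chain {A. split_system p A} C"
    have two: "\<exists>A\<in>C. i \<in> A \<and> j \<in> A" if ij: "i \<in> \<Union>C" "j \<in> \<Union>C" for i j
    proof -
      obtain X Y where XY: "X \<in> C" "i \<in> X" "Y \<in> C" "j \<in> Y" using ij by blast
      then have "X \<subseteq> Y \<or> Y \<subseteq> X" using C unfolding subset_chain_def by blast
      then show ?thesis using XY by blast
    qed
    have sys: "split_system p A" if "A \<in> C" for A using C that unfolding subset_chain_def by blast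
    have "splits_on p v q" if "(v, q) \<in> \<Union>C" for v q
      using two[OF that that] sys unfolding split_system_def by blast
    moreover have "fst i * fst j = 0" if "i \<in> \<Union>C" "j \<in> \<Union>C" "i \<noteq> j" for i j
      using two[OF that(1,2)] sys that(3) unfolding split_system_def by blast
    ultimately show "\<Union>C \<in> {A. split_system p A}" unfolding split_system_def by blast
  qed
  then show ?thesis by blast
qed

text \<open>The strong sum of the second components. This is the step that needs the norm bound on the family:
  without it the partial sums need not be bounded.\<close>
lemma patch_split_system:
  assumes p: "p \<in> F" and A: "split_system p A"
  shows "\<exists>Q\<in>F. Q * p = Q \<and> (\<forall>(v, q)\<in>A. Q * v = q)"
proof -
  have sp: "splits_on p (fst i) (snd i)" if "i \<in> A" for i using A that by (auto simp: split_system_def)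
  have vB: "fst i \<in> B" and qF: "snd i \<in> F" and qp: "snd i * p = snd i" and qv: "snd i * fst i = snd i" if
      "i \<in> A" for i
    using sp[OF that] by (auto simp: splits_on_def)
  have "\<exists>Q. \<forall>h. ((\<lambda>i. bop_apply (snd i) h) has_sum bop_apply Q h) A"
  proof (rule orthogonal_sum_exists[where v = fst])
    show "fst i * fst i = fst i" "adj (fst i) = fst i" "snd i * fst i = snd i" "norm (snd i) \<le> max K 0"
      if "i \<in> A" for i using vB[OF that] qv[OF that] bdd[OF qF[OF that]] B_idem B_adj by auto
    show "fst i * snd i = snd i" if "i \<in> A" for i
      using B_comm[OF vB[OF that] F_M[OF qF[OF that]]] qv[OF that] by simp
    show "fst i * fst j = 0" if "i \<in> A" "j \<in> A" "i \<noteq> j" for i j using A that by (auto simp: split_system_def)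
  qed simp
  then obtain Q where Q: "\<And>h. ((\<lambda>i. bop_apply (snd i) h) has_sum bop_apply Q h) A" by blast
  have comm: "c * Q = Q * c" if "\<And>i. i \<in> A \<Longrightarrow> c * snd i = snd i * c" for c
  proof (rule bop_eqI)
    fix h
    have "((\<lambda>i. bop_apply c (bop_apply (snd i) h)) has_sum bop_apply c (bop_apply Q h)) A"
      by (rule has_sum_bounded_linear[OF bounded_linear_bop_apply Q])
    moreover have "bop_apply c (bop_apply (snd i) h) = bop_apply (snd i) (bop_apply c h)" if "i \<in> A" for i
      using \<open>\<And>i. i \<in> A \<Longrightarrow> c * snd i = snd i * c\<close>[OF that] by (simp flip: bop_apply_simps(4))
    ultimately have "((\<lambda>i. bop_apply (snd i) (bop_apply c h)) has_sum bop_apply c (bop_apply Q h)) A"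
      by (simp cong: has_sum_cong)
    then show "bop_apply (c * Q) h = bop_apply (Q * c) h"
      using has_sum_unique[OF _ Q] by (simp add: bop_apply_simps)
  qed
  have Qc: "Q * c = d" if "\<And>h. ((\<lambda>i. bop_apply (snd i) (bop_apply c h)) has_sum bop_apply d h) A" for c d
    using has_sum_unique[OF that Q] by (intro bop_eqI) (simp add: bop_apply_simps)
  have Qv: "Q * fst i = snd i" if i: "i \<in> A" for i
  proof (rule Qc)
    fix h
    show "((\<lambda>j. bop_apply (snd j) (bop_apply (fst i) h)) has_sum bop_apply (snd i) h) A"
    proof (rule has_sum_finite_neutralI[of "{i}"])
      fix j assume j: "j \<in> A - {i}"
      have "snd j * fst i = snd j * (fst j * fst i)" using qv[of j] j by (simp add: mult.assoc[symmetric])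
      also have "\<dots> = 0" using A i j by (auto simp: split_system_def)
      finally show "bop_apply (snd j) (bop_apply (fst i) h) = 0"
          by (simp add: bop_apply_simps flip: bop_apply_simps(4))
    next
      show "bop_apply (snd i) h = (\<Sum>x\<in>{i}. bop_apply (snd x) (bop_apply (fst i) h))"
        using qv[OF i] by (simp flip: bop_apply_simps(4))
    qed (use i in auto)
  qed
  have Qp: "Q * p = Q"
  proof (rule Qc)
    fix h
    have "bop_apply (snd i) (bop_apply p h) = bop_apply (snd i) h" if "i \<in> A" for i
      using qp[OF that] by (simp flip: bop_apply_simps(4))
    then show "((\<lambda>i. bop_apply (snd i) (bop_apply p h)) has_sum bop_apply Q h) A"
      using Q[of h] by (simp cong: has_sum_cong)
  qed
  have fQ: "f * Q = Q * f" if "f \<in> F" for f by (rule comm) (use that qF F_comm in blast)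
  have "Q * Q = Q"
  proof (rule Qc)
    fix h
    have "bop_apply (snd i) (bop_apply Q h) = bop_apply (snd i) h" if i: "i \<in> A" for i
    proof -
      have "Q * snd i = (Q * fst i) * snd i"
        using qv[OF i] B_comm[OF vB[OF i] F_M[OF qF[OF i]]] by (simp add: mult.assoc)
      also have "\<dots> = snd i" using Qv[OF i] F_idem[OF qF[OF i]] by simp
      finally have "snd i * Q = snd i" using fQ[OF qF[OF i]] by simp
      then show ?thesis by (simp flip: bop_apply_simps(4))
    qed
    then show "((\<lambda>i. bop_apply (snd i) (bop_apply Q h)) has_sum bop_apply Q h) A"
      using Q[of h] by (simp cong: has_sum_cong)
  qed
  moreover have "Q \<in> M" by (rule memI) (rule comm, use memD F_M qF in blast)
  moreover have "T * Q = Q * T" by (rule comm) (use qF F_T in auto)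
  ultimately have "Q \<in> F" using fQ by (intro F_max) auto
  then show ?thesis using Qp Qv by (intro bexI[of _ Q]) auto
qed

context
  fixes U assumes U: "ultrafilter U"
begin

text \<open>If \<open>p\<close> does not split at \<open>U\<close>, the union of the supports of a maximal system of splittings is not in
  \<open>U\<close>, for otherwise the patched idempotent would split \<open>p\<close> at \<open>U\<close>. Over the complement \<open>z\<close> of that
  union nothing splits \<open>p\<close> any more: for \<open>q\<close> below \<open>p z\<close>, let \<open>s\<close> and \<open>t\<close> be the largest central
  projections annihilating \<open>q\<close> and \<open>p z - q\<close>; outside both of them \<open>q\<close> would be a further splitting, so
  \<open>q\<close> is \<open>p\<close> cut by a central projection.\<close>
lemma unsplittable_uniform:
  assumes p: "p \<in> F" and un: "\<And>q. q \<in> F \<Longrightarrow> q * p = q \<Longrightarrow> q \<in> J U \<or> p - q \<in> J U"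
  shows "\<exists>z\<in>U. \<forall>q\<in>F. q * (p * z) = q \<longrightarrow> (\<exists>z'\<in>B. q = p * z')"
proof -
  obtain A where A: "split_system p A" and Amax: "\<And>A'. split_system p A' \<Longrightarrow> A \<subseteq> A' \<Longrightarrow> A' = A"
    using maximal_split_system[of p] by blast
  have Asp: "splits_on p (fst i) (snd i)" if "i \<in> A" for i using A that by (auto simp: split_system_def)
  have vB: "fst i \<in> B" if "i \<in> A" for i using Asp[OF that] by (auto simp: splits_on_def)
  have "fst ` A \<subseteq> M" using vB B_M by blast
  from annihilator_exists[OF this] obtain z where z0: "z \<in> B" "\<forall>a\<in>fst ` A. a * z = 0"
    "\<forall>d\<in>M. (\<forall>a\<in>fst ` A. \<forall>m\<in>M. a * m * d = 0) \<longrightarrow> z * d = d" by blast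
  have z: "z \<in> B" "\<And>i. i \<in> A \<Longrightarrow> fst i * z = 0"
    "\<And>d. d \<in> M \<Longrightarrow> (\<And>i m. i \<in> A \<Longrightarrow> m \<in> M \<Longrightarrow> fst i * m * d = 0) \<Longrightarrow> z * d = d"
    using z0 by blast+
  \<comment> \<open>\<open>z\<close> is the complement of the union of the supports\<close>
  have zU: "z \<in> U"
  proof (rule ccontr)
    assume "z \<notin> U"
    then have z1: "1 - z \<in> U" using U_dich[OF U z(1)] by blast
    obtain Q where Q: "Q \<in> F" "Q * p = Q" "\<And>i. i \<in> A \<Longrightarrow> Q * fst i = snd i"
      using patch_split_system[OF p A] by fastforce
    have pq: "(p - Q) * (p - Q) = p - Q" "p - Q \<in> M" "Q \<in> M" "Q * Q = Q"
      using F_diff[OF p Q(1,2)] F_M F_idem Q(1) by auto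
    obtain u where u: "u \<in> U" "Q * u = 0 \<or> (p - Q) * u = 0"
      using un[OF Q(1,2)] J_idempotent[OF U pq(2,1)] J_idempotent[OF U pq(3,4)] by blast
    define u' where "u' = u * (1 - z)"
    have u'U: "u' \<in> U" using U_mult[OF U u(1) z1] by (simp add: u'_def)
    have uB: "u \<in> B" "u' \<in> B" using U_B[OF U] u(1) u'U by auto
    have "\<exists>i\<in>A. fst i * u' \<noteq> 0"
    proof (rule ccontr)
      assume "\<not> ?thesis"
      then have vu: "fst i * u' = 0" if "i \<in> A" for i using that by blast
      have "z * u' = u'"
      proof (rule z(3)[OF B_M[OF uB(2)]])
        fix i m assume "i \<in> A" "m \<in> M"
        then show "fst i * m * u' = 0" using vu B_comm[OF uB(2)] by (metis mult.assoc mult_zero_left)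
      qed
      moreover have "z * u' = u * (z * (1 - z))" unfolding u'_def using B_comm[OF z(1) B_M[OF uB(1)]]
          by (metis mult.assoc)
      moreover have "z * (1 - z) = 0" using B_idem[OF z(1)] by (simp add: right_diff_distrib)
      ultimately show False using U_zero[OF U] u'U by simp
    qed
    then obtain i where i: "i \<in> A" "fst i * u' \<noteq> 0" by blast
    define t where "t = fst i * u'"
    have tB: "t \<in> B" using B_mult[OF vB[OF i(1)] uB(2)] by (simp add: t_def)
    have tv: "t * fst i = t"
      using B_comm[OF uB(2) B_M[OF vB[OF i(1)]]] B_idem[OF vB[OF i(1)]] unfolding t_def by (metis mult.assoc)
    have tu: "t = u * (fst i * (1 - z))"
      unfolding t_def u'_def using B_comm[OF uB(1) B_M[OF vB[OF i(1)]]] by (metis mult.assoc)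
    have Qt: "Q * t = snd i * t" 
    proof -
      have "Q * t = Q * fst i * t" using tv B_comm[OF tB B_M[OF vB[OF i(1)]]] by (simp add: mult.assoc)
      then show ?thesis by (simp add: Q(3)[OF i(1)])
    qed
    have "snd i * t \<noteq> 0" "(p - snd i) * t \<noteq> 0"
      using Asp[OF i(1)] tB tv i(2) unfolding splits_on_def t_def[symmetric] by auto
    moreover have "Q * t = 0 \<or> (p - Q) * t = 0"
      unfolding tu using u(2) by (auto simp: mult.assoc[symmetric])
    ultimately show False using Qt by (simp add: left_diff_distrib)
  qed
  have "\<exists>z'\<in>B. q = p * z'" if q: "q \<in> F" "q * (p * z) = q" for q
  proof -
    have qM: "q \<in> M" and pM: "p \<in> M" using q p F_M by auto
    have zz: "z * z = z" by (rule B_idem[OF z(1)])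
    have qz: "q * z = q" using q(2) zz by (metis mult.assoc)
    have qp: "q * p = q" using q(2) qz B_comm[OF z(1) pM] F_idem[OF p] by (metis mult.assoc)
    obtain s where s: "s \<in> B" "q * s = 0" "\<And>d. d \<in> M \<Longrightarrow> (\<And>m. m \<in> M \<Longrightarrow> q * m * d = 0) \<Longrightarrow> s * d = d"
      using annihilator_exists[of "{q}"] qM by auto
    have rM: "p * z - q \<in> M" using pM qM z(1) by (simp add: diff_in mult_in B_M)
    obtain t where t: "t \<in> B" "(p * z - q) * t = 0" "\<And>d. d \<in> M \<Longrightarrow> (\<And>m. m \<in> M \<Longrightarrow> (p * z - q) * m * d = 0) \<Longrightarrow> t * d = d"
      using annihilator_exists[of "{p * z - q}"] rM by auto
    define v where "v = z * ((1 - s) * (1 - t))"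
    have vB': "v \<in> B" unfolding v_def by (intro B_mult B_compl z(1) s(1) t(1))
    have vz: "v * z = v" unfolding v_def using zz B_comm[OF z(1), of
        "(1 - s) * (1 - t)"] B_mult[OF B_compl[OF s(1)] B_compl[OF t(1)]] B_M
      by (metis mult.assoc)
    have sv: "s * v = 0"
    proof -
      have "s * (1 - s) = 0" using B_idem[OF s(1)] by (simp add: right_diff_distrib)
      moreover have "s * v = z * ((s * (1 - s)) * (1 - t))" unfolding v_def
          using B_comm[OF s(1) B_M[OF z(1)]] by (metis mult.assoc)
      ultimately show ?thesis by simp
    qed
    have tv: "t * v = 0"
    proof -
      have "(1 - t) * t = 0" using B_idem[OF t(1)] by (simp add: left_diff_distrib)
      moreover have "t * v = z * ((1 - s) * ((1 - t) * t))"
        using B_comm[OF t(1) B_M[OF vB']] unfolding v_def by (metis mult.assoc)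
      ultimately show ?thesis by simp
    qed
    \<comment> \<open>otherwise \<open>(v, q v)\<close> could be added to the maximal system\<close>
    have "v = 0"
    proof (rule ccontr)
      assume v0: "v \<noteq> 0"
      have "splits_on p v (q * v)" unfolding splits_on_def
      proof (intro conjI ballI impI; (elim conjE)?)
        show "v \<in> B" "v \<noteq> 0" by fact+
        show "q * v \<in> F" by (rule F_mult[OF q(1) B_F[OF vB']])
        show "q * v * p = q * v" using B_comm[OF vB' pM] qp by (metis mult.assoc)
        show "q * v * v = q * v" by (simp add: mult.assoc B_idem[OF vB'])
        fix x assume x: "x \<in> B" "x * v = x" "x \<noteq> 0"
        have vx: "v * x = x" using x B_comm[OF vB' B_M[OF x(1)]] by simp
        have zx: "z * x = x" using vx vz B_comm[OF z(1) B_M[OF vB']] by (metis mult.assoc)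
        show "q * v * x \<noteq> 0"
        proof
          assume "q * v * x = 0"
          then have qx: "q * x = 0" using vx by (simp add: mult.assoc)
          have "s * x = x"
          proof (rule s(3)[OF B_M[OF x(1)]])
            fix m assume "m \<in> M"
            then show "q * m * x = 0" using qx B_comm[OF x(1)] by (metis mult.assoc mult_zero_left)
          qed
          then show False using sv vx x(3) by (metis mult.assoc mult_zero_left)
        qed
        show "(p - q * v) * x \<noteq> 0"
        proof
          assume "(p - q * v) * x = 0"
          then have px: "(p * z - q) * x = 0" using vx zx by (simp add: left_diff_distrib mult.assoc)
          have "t * x = x"
          proof (rule t(3)[OF B_M[OF x(1)]])
            fix m assume "m \<in> M"
            then show "(p * z - q) * m * x = 0" using px B_comm[OF x(1)] by (metis mult.assoc mult_zero_left)
          qed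
          then show False using tv vx x(3) by (metis mult.assoc mult_zero_left)
        qed
      qed
      moreover have vi: "v * fst i = 0" "fst i * v = 0" if "i \<in> A" for i
      proof -
        show "fst i * v = 0" unfolding v_def using z(2)[OF that] by (simp add: mult.assoc[symmetric])
        then show "v * fst i = 0" using B_comm[OF vB' B_M[OF vB[OF that]]] by simp
      qed
      ultimately have "split_system p (insert (v, q * v) A)"
        using A unfolding split_system_def by auto
      then have "(v, q * v) \<in> A" using Amax by blast
      then have "v * z = 0" using z(2) by force
      then show False using vz v0 by simp
    qed
    have qt: "q * t = p * z * t" using t(2) by (simp add: left_diff_distrib)
    have "q = q * s + q * (1 - s) * t + q * ((1 - s) * (1 - t))" by (simp add: algebra_simps)
    also have "q * ((1 - s) * (1 - t)) = q * v" unfolding v_def using qz by (simp add: mult.assoc[symmetric])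
    also have "q * (1 - s) * t = (q * t) * (1 - s)" using B_comm[OF t(1), of
        "1 - s"] B_M[OF B_compl[OF s(1)]] by (simp add: mult.assoc)
    also have "\<dots> = p * (z * (t * (1 - s)))" by (simp add: qt mult.assoc)
    finally have "q = p * (z * (t * (1 - s)))" using \<open>v = 0\<close> s(2) by simp
    moreover have "z * (t * (1 - s)) \<in> B" by (intro B_mult B_compl z(1) s(1) t(1))
    ultimately show ?thesis by blast
  qed
  then show ?thesis using zU by blast
qed

end

text \<open>Over such a \<open>p\<close> each member of \<open>F\<close> acts as a central projection, so an idempotent of the corner
  commutes with all of \<open>F\<close> and belongs to \<open>F\<close> by maximality.\<close>
lemma corner_idempotent_central:
  assumes p: "p \<in> F" and un: "\<forall>q\<in>F. q * p = q \<longrightarrow> (\<exists>z\<in>B. q = p * z)"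
    and e: "e \<in> M" "e * T = T * e" "p * e = e" "e * p = e" "e * e = e"
  shows "\<exists>z\<in>B. e = p * z"
proof -
  have "e \<in> F"
  proof (rule F_max[OF e(1,2,5)])
    fix f assume f: "f \<in> F"
    have "f * p * p = f * p" using F_idem[OF p] by (simp add: mult.assoc)
    then obtain z where z: "z \<in> B" "f * p = p * z" using un F_mult[OF f p] by blast
    have "f * e = f * p * e" using e(3) by (simp add: mult.assoc)
    also have "\<dots> = z * e" using z e(3) B_comm[OF z(1) F_M[OF p]] by (simp add: mult.assoc)
    also have "\<dots> = e * z" using B_comm[OF z(1) e(1)] by simp
    also have "\<dots> = e * (p * z)" using e(4) by (simp add: mult.assoc[symmetric])
    also have "\<dots> = e * (p * f)" using z(2) F_comm[OF f p] by simp
    also have "\<dots> = e * f" using e(4) by (simp add: mult.assoc[symmetric])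
    finally show "e * f = f * e" by simp
  qed
  then show ?thesis using un e(4) by blast
qed

context
  fixes U assumes U: "ultrafilter U"
begin

text \<open>Lift \<open>a z\<close>, for a \<open>z \<in> U\<close> over which \<open>a\<close> is almost idempotent, to a nearby idempotent \<open>p t\<close> of the
  corner. The ultrafilter decides between \<open>t\<close> and \<open>1 - t\<close>, and so whether \<open>a\<close> is close to \<open>p\<close> or to \<open>0\<close>.\<close>
lemma almost_idempotent_trivial:
  assumes p: "p \<in> F" and un: "\<forall>q\<in>F. q * p = q \<longrightarrow> (\<exists>z\<in>B. q = p * z)"
    and a: "a \<in> M" "a * T = T * a" "p * a = a" "a * p = a" and aa: "a - a * a \<in> J U"
  shows "a \<in> J U \<or> p - a \<in> J U"
proof (rule ccontr)
  assume "\<not> ?thesis"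
  moreover have pM: "p \<in> M" using p F_M by blast
  ultimately obtain d1 d2 where d: "d1 > 0" "\<And>z. z \<in> U \<Longrightarrow> d1 \<le> norm (a * z)"
     "d2 > 0" "\<And>z. z \<in> U \<Longrightarrow> d2 \<le> norm ((p - a) * z)"
    using a(1) diff_in[OF pM a(1)] unfolding J_def by (auto simp: not_less)
  \<comment> \<open>the constant of \<open>idempotent_near\<close>: the lift is then within \<open>C * r\<close>, less than both lower bounds\<close>
  define C where "C = 2 * norm a + 1"
  have C: "C > 0" by (simp add: C_def add_nonneg_pos)
  define r where "r = min (1/2) (min d1 d2 / (2 * C))"
  have r: "r > 0" "r \<le> 1/2" using d C by (auto simp: r_def)
  have Cr: "C * r < d1" "C * r < d2"
  proof -
    have "C * r \<le> C * (min d1 d2 / (2 * C))" using C by (intro mult_left_mono) (auto simp: r_def)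
    also have "\<dots> = min d1 d2 / 2" using C by simp
    finally show "C * r < d1" "C * r < d2" using d by auto
  qed
  have "4 *\<^sub>C (a - a * a) \<in> J U" by (rule J_scaleC[OF U aa])
  then have "4 *\<^sub>R (a - a * a) \<in> J U" by (simp add: scaleR_scaleC)
  then obtain z where z: "z \<in> U" "norm (4 *\<^sub>R (a - a * a) * z) < r" using J_D[OF U _ r(1)] by blast
  note zB = U_B[OF U z(1)]
  define a' where "a' = a * z"
  have za: "z * a = a * z" and zp: "z * p = p * z" using B_comm[OF zB] a(1) pM by auto
  have a'M: "a' \<in> M" "p * a' = a'" "a' * p = a'" "a' * T = T * a'"
    unfolding a'_def using a B_M[OF zB] zp B_comm[OF zB TM]
        by (simp add: mult_in) (metis a mult.assoc zp B_comm[OF zB TM])+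
  have "a' * a' = a * a * z" unfolding a'_def using za B_idem[OF zB] by (metis mult.assoc)
  then have "4 *\<^sub>R (a' - a' * a') = 4 *\<^sub>R (a - a * a) * z" by (simp add: a'_def left_diff_distrib)
  then have small: "norm (4 *\<^sub>R (a' - a' * a')) \<le> r" using z(2) by simp
  obtain e where e: "e \<in> corner_bicommutant p a'" "e * e = e" "norm (e - a') \<le> (2 * norm a' + 1) * r"
    using idempotent_near[OF a'M(1-3) small r(2)] by blast
  have "(2 * norm a' + 1) * r \<le> C * r"
    using norm_mult_B[OF zB, of a] r by (intro mult_right_mono) (auto simp: C_def a'_def)
  then have ea: "norm (e - a') \<le> C * r" using e(3) by linarith
  have "e * T = T * e" using e(1) a'M(4) TM by (auto simp: corner_bicommutant_def)
  then obtain t where t: "t \<in> B" "e = p * t"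
    using corner_idempotent_central[OF p un] e(1,2) by (auto simp: corner_bicommutant_def)
  show False
  proof (cases "t \<in> U")
    case True
    have zt: "z * t \<in> U" by (rule U_mult[OF U z(1) True])
    have tz: "t * z = z * t" using B_comm[OF zB B_M[OF t(1)]] .
    have "t * (z * t) = z * t" using tz B_idem[OF t(1)] by (metis mult.assoc)
    moreover have "z * (z * t) = z * t" using B_idem[OF zB] by (metis mult.assoc)
    ultimately have "(e - a') * z * t = (p - a) * (z * t)"
      unfolding t(2) a'_def by (simp add: left_diff_distrib mult.assoc)
    then have "norm ((p - a) * (z * t)) \<le> norm (e - a')"
      using norm_mult_B[OF t(1), of "(e - a') * z"] norm_mult_B[OF zB, of "e - a'"] by simp
    then show False using d(4)[OF zt] ea Cr by linarith
  next
    case False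
    then have t': "1 - t \<in> U" using U_dich[OF U t(1)] by blast
    have zt: "z * (1 - t) \<in> U" by (rule U_mult[OF U z(1) t'])
    have "e * (1 - t) = 0" unfolding t(2) using B_idem[OF t(1)] by (simp add: right_diff_distrib mult.assoc)
    then have "(e - a') * (1 - t) = - (a * (z * (1 - t)))" by (simp add: left_diff_distrib a'_def mult.assoc)
    then have "norm (a * (z * (1 - t))) \<le> norm (e - a')"
      using norm_mult_B[OF U_B[OF U t'], of "e - a'"] by simp
    then show False using d(2)[OF zt] ea Cr by linarith
  qed
qed

text \<open>The quotient by \<open>J U\<close> is finite-dimensional, so the powers of \<open>x\<close> satisfy a linear relation there;
  solve it for the lowest power that occurs.\<close>
lemma pi_regular_mod_J:
  assumes p: "p \<in> M" "p * p = p" "p * T = T * p" and x: "x \<in> M" "x * T = T * x" "p * x = x" "x * p = x"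
  shows "\<exists>k\<ge>1. \<exists>y\<in>M. y * T = T * y \<and> p * y = y \<and> y * p = y \<and> (\<forall>c\<in>M. c * p = p * c \<and> c * x = x * c \<longrightarrow> c * y = y * c)
    \<and> x ^ k - x ^ Suc k * y \<in> J U"
proof -
  note pw = power_in[OF x(1)]
  define N where "N = Suc (card I)"
  let ?K = "{1..N}"
  obtain d where d: "\<exists>k\<in>?K. d k \<noteq> 0" "(\<Sum>k\<in>?K. d k *\<^sub>C x ^ k) \<in> J U"
    using dependent_mod_J[OF U I co, of ?K "\<lambda>k. x ^ k"] pw by (auto simp: N_def)
  then have ex: "\<exists>k. k \<in> ?K \<and> d k \<noteq> 0" by blast
  define k where "k = (LEAST k. k \<in> ?K \<and> d k \<noteq> 0)"
  have k: "k \<in> ?K" "d k \<noteq> 0" using LeastI_ex[OF ex] unfolding k_def by blast+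
  have least: "d j = 0" if "j \<in> ?K" "j < k" for j using not_less_Least[of j "\<lambda>k. k \<in> ?K \<and> d k \<noteq> 0"] that
      unfolding k_def by blast
  let ?L = "{Suc k..N}"
  define Y where "Y = (\<Sum>j\<in>?L. (- (d j / d k)) *\<^sub>C x ^ (j - Suc k))"
  have YM: "Y \<in> M" unfolding Y_def by (intro sum_in scaleC_in pw)
  have cY: "c * Y = Y * c" if "c * x = x * c" for c
    unfolding Y_def by (simp add: sum_distrib_left sum_distrib_right scaleC_bop_mult commutes_power[OF that])
  define y where "y = p * Y"
  have pY: "p * Y = Y * p" using cY x by simp
  have yM: "y \<in> M" using p YM by (simp add: y_def mult_in)
  have py: "p * y = y" "y * p = y" unfolding y_def using p(2) pY by (metis mult.assoc)+
  have "(\<Sum>j\<in>?K. d j *\<^sub>C x ^ j) = (\<Sum>j\<in>insert k ?L. d j *\<^sub>C x ^ j)"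
  proof (rule sum.mono_neutral_right)
    show "\<forall>i\<in>?K - insert k ?L. d i *\<^sub>C x ^ i = 0"
    proof
      fix i assume "i \<in> ?K - insert k ?L"
      then have "i \<in> ?K" "i < k" by auto
      then show "d i *\<^sub>C x ^ i = 0" using least by (simp add: scaleC_zero_left)
    qed
  qed (use k in auto)
  also have "\<dots> = d k *\<^sub>C x ^ k + (\<Sum>j\<in>?L. d j *\<^sub>C x ^ j)" by simp
  finally have "(1 / d k) *\<^sub>C (\<Sum>j\<in>?K. d j *\<^sub>C x ^ j) = x ^ k + (\<Sum>j\<in>?L. (d j / d k) *\<^sub>C x ^ j)"
    using k(2) by (simp add: scaleC_add_right scaleC_scaleC scaleC_one scaleC_sum_right)
  also have "(\<Sum>j\<in>?L. (d j / d k) *\<^sub>C x ^ j) = - (x ^ Suc k * Y)"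
  proof -
    have "x ^ Suc k * Y = (\<Sum>j\<in>?L. (- (d j / d k)) *\<^sub>C x ^ j)"
      unfolding Y_def sum_distrib_left scaleC_bop_mult
      by (intro sum.cong refl) (simp only: power_add[symmetric], simp)
    then show ?thesis by (simp add: scaleC_minus_left sum_negf)
  qed
  also have "x ^ Suc k * Y = x ^ Suc k * y"
    unfolding y_def power_Suc2 using x(4) by (simp add: mult.assoc) (simp add: mult.assoc[symmetric] x(4))
  finally have "x ^ k - x ^ Suc k * y \<in> J U" using J_scaleC[OF U d(2), of "1 / d k"] by simp
  moreover have "c * y = y * c" if "c * p = p * c" "c * x = x * c" for c
    using cY[OF that(2)] that(1) unfolding y_def by (metis mult.assoc)
  moreover have "1 \<le> k" using k by simp
  ultimately show ?thesis using yM py p(3) x(2) by (intro exI[of _ k]) (auto intro!: bexI[of _ y])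
qed

text \<open>Over a member of \<open>U\<close> that makes \<open>p - u\<close> have norm less than \<open>1\<close>, the geometric series inverts \<open>u\<close>.\<close>
lemma corner_inverse_near:
  assumes p: "p \<in> M" "p * p = p" and u: "u \<in> M" "p * u = u" "u * p = u" "p - u \<in> J U"
  shows "\<exists>z\<in>U. \<exists>w\<in>M. u * w = p * z \<and> (\<forall>c\<in>M. c * p = p * c \<and> c * u = u * c \<longrightarrow> c * w = w * c)"
proof -
  obtain z where z: "z \<in> U" "norm ((p - u) * z) < 1" using J_D[OF U u(4), of 1] by auto
  note zB = U_B[OF U z(1)]
  have zc: "c * z = z * c" if "c \<in> M" for c using B_comm[OF zB that] .
  define s where "s = (p - u) * z"
  have s: "s \<in> M" "p * s = s" "s * p = s"
  proof -
    show "s \<in> M" unfolding s_def by (intro mult_in diff_in p u(1) B_M zB)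
    have "p * (p - u) = p - u" "(p - u) * p = p - u" using p u
        by (simp_all add: left_diff_distrib right_diff_distrib)
    then show "p * s = s" "s * p = s" unfolding s_def mult.assoc zc[OF p(1), symmetric]
      by (simp_all only: mult.assoc[symmetric])
  qed
  obtain g where g: "g \<in> M" "\<And>c. c \<in> M \<Longrightarrow> c * s = s * c \<Longrightarrow> c * g = g * c" "(p - s) * (p + g) = p"
    using neumann_corner[OF s z(2)[folded s_def] p(2)] by blast
  have cg: "c * g = g * c" if "c \<in> M" "c * p = p * c" "c * u = u * c" for c
    by (rule g(2)[OF that(1)]) (unfold s_def, intro commutes that zc)
  have "c * ((p + g) * z) = (p + g) * z * c" if "c \<in> M" "c * p = p * c" "c * u = u * c" for c
    by (intro commutes that zc cg)
  moreover have "u * ((p + g) * z) = p * z"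
  proof -
    have pgz: "(p + g) * z = z * (p + g)" by (intro zc add_in p g(1))
    have "(p - s) * z = u * z" unfolding s_def using B_idem[OF zB] by (simp add: left_diff_distrib mult.assoc)
    then have "u * ((p + g) * z) = (p - s) * z * (p + g)" unfolding pgz by (simp only: mult.assoc)
    also have "\<dots> = p * z" unfolding mult.assoc pgz[symmetric] by (simp only: mult.assoc[symmetric] g(3))
    finally show ?thesis .
  qed
  moreover have "(p + g) * z \<in> M" by (intro mult_in add_in p g(1) B_M zB)
  ultimately show ?thesis using z(1) by blast
qed

text \<open>From \<open>x\<^sup>k \<equiv> x\<^sup>k\<^sup>+\<^sup>1 y\<close> modulo \<open>J U\<close> one gets the Fitting idempotent \<open>a = x\<^sup>k y\<^sup>k\<close>, with \<open>x\<^sup>k a \<equiv> x\<^sup>k\<close>.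
  If \<open>a \<equiv> p\<close>, then \<open>x\<close> is invertible near \<open>U\<close>; if \<open>a \<equiv> 0\<close>, then \<open>x\<^sup>k\<close> is small and the geometric sum
  inverts \<open>p - x\<close>.\<close>
lemma locality:
  assumes p: "p \<in> F" and un: "\<forall>q\<in>F. q * p = q \<longrightarrow> (\<exists>z\<in>B. q = p * z)"
    and x: "x \<in> M" "x * T = T * x" "p * x = x" "x * p = x"
  shows "\<exists>z\<in>U. \<exists>w\<in>M. w * T = T * w \<and>
    (w * x = p * z \<and> x * w = p * z \<or> w * (p - x) = p * z \<and> (p - x) * w = p * z)"
proof -
  have pp: "p \<in> M" "p * p = p" "p * T = T * p" using p F_M F_idem F_T by auto
  obtain k y where k: "k \<ge> 1" and y: "y \<in> M" "y * T = T * y" "p * y = y" "y * p = y"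
    "\<And>c. c \<in> M \<Longrightarrow> c * p = p * c \<Longrightarrow> c * x = x * c \<Longrightarrow> c * y = y * c" "x ^ k - x ^ Suc k * y \<in> J U"
    using pi_regular_mod_J[OF pp x] by blast
  have xp: "x * p = p * x" using x by simp
  have xy: "x * y = y * x" using y(5)[OF x(1) xp refl] .
  note pw = power_in
  obtain l where l: "k = Suc l" using k by (cases k) auto
  have lpw: "p * u ^ Suc j = u ^ Suc j" if "p * u = u" for u j
    by (simp add: mult.assoc[symmetric] that)
  have rpw: "u ^ Suc j * p = u ^ Suc j" if "u * p = u" for u j
    unfolding power_Suc2 mult.assoc that ..
  have xyc: "x ^ i * y ^ j = y ^ j * x ^ i" for i j
    by (rule commutes_power, rule commutes_power[symmetric], rule xy[symmetric])
  have step: "x ^ k - x ^ (k + m) * y ^ m \<in> J U" for m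
  proof (induction m)
    case 0 then show ?case by (simp add: J_zero[OF U])
  next
    case (Suc m)
    have "x ^ (k + Suc m) * y ^ Suc m = (x ^ m * y ^ m) * (x ^ Suc k * y)"
    proof -
      have "x ^ (k + Suc m) = x ^ m * x ^ Suc k" by (simp only: power_add[symmetric]) (simp add: add.commute)
      then have "x ^ (k + Suc m) * y ^ Suc m = x ^ m * (x ^ Suc k * y ^ m) * y"
        by (simp only: power_Suc2[of y] mult.assoc)
      then show ?thesis by (simp only: xyc[of "Suc k" m] mult.assoc)
    qed
    moreover have "x ^ (k + m) * y ^ m = (x ^ m * y ^ m) * x ^ k"
    proof -
      have "x ^ (k + m) = x ^ m * x ^ k" by (simp only: power_add[symmetric] add.commute)
      then show ?thesis by (simp only: xyc[of k m] mult.assoc)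
    qed
    ultimately have e: "x ^ k - x ^ (k + Suc m) * y ^ Suc m
        = (x ^ k - x ^ (k + m) * y ^ m) + (x ^ m * y ^ m) * (x ^ k - x ^ Suc k * y)"
      by (simp add: right_diff_distrib del: power_Suc)
    show ?case unfolding e
      by (intro J_add[OF U] Suc J_mult_left[OF U y(6)] mult_in pw x(1) y(1))
  qed
  define a where "a = x ^ k * y ^ k"
  have aM: "a \<in> M" unfolding a_def by (intro mult_in pw x(1) y(1))
  have ca: "c * a = a * c" if "c * x = x * c" "c * y = y * c" for c
    unfolding a_def by (intro commutes that)
  have aT: "a * T = T * a" using ca[of T] x(2) y(2) by simp
  have ap: "p * a = a" "a * p = a"
    using lpw[OF x(3), of l, folded l] rpw[OF y(4), of l, folded l] unfolding a_def
    by (simp_all only: mult.assoc) (simp only: mult.assoc[symmetric])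
  have "a * a = x ^ k * (y ^ k * x ^ k) * y ^ k" unfolding a_def by (simp only: mult.assoc)
  then have "a - a * a = (x ^ k - x ^ (k + k) * y ^ k) * y ^ k"
    unfolding xyc[symmetric] by (simp add: a_def left_diff_distrib power_add mult.assoc)
  then have "a - a * a \<in> J U" using J_mult_right[OF U step[of k] pw[OF y(1)]] by simp
  from almost_idempotent_trivial[OF p un aM aT ap this] have alt: "p - a \<in> J U \<or> a \<in> J U" by blast
  then show ?thesis
  proof
    assume "p - a \<in> J U"
    then obtain z w where z: "z \<in> U" and w: "w \<in> M" "a * w = p * z"
      "\<And>c. c \<in> M \<Longrightarrow> c * p = p * c \<Longrightarrow> c * a = a * c \<Longrightarrow> c * w = w * c"
      using corner_inverse_near[OF pp(1,2) aM ap] by blast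
    define h where "h = x ^ l * y ^ k * w"
    have hM: "h \<in> M" unfolding h_def by (intro mult_in pw x(1) y(1) w(1))
    have ch: "c * h = h * c" if "c \<in> M" "c * p = p * c" "c * x = x * c" "c * y = y * c" for c
      unfolding h_def by (intro commutes that w(3) ca)
    have "x * h = p * z" unfolding w(2)[symmetric] h_def a_def l by (simp add: mult.assoc)
    moreover have "h * x = x * h" by (rule ch[OF x(1) xp refl xy, symmetric])
    moreover have "h * T = T * h" by (rule ch[OF TM pp(3)[symmetric] x(2)[symmetric] y(2)[symmetric], symmetric])
    ultimately show ?thesis using hM z by metis
  next
    assume aJ: "a \<in> J U"
    have e: "x ^ k = (x ^ k - x ^ (k + k) * y ^ k) + x ^ k * a"
      by (simp add: a_def power_add mult.assoc)
    have xkJ: "x ^ k \<in> J U" by (subst e) (intro J_add[OF U] step J_mult_left[OF U aJ] pw x(1))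
    have pxk: "p * x ^ k = x ^ k" "x ^ k * p = x ^ k" using lpw[OF x(3), of l] rpw[OF x(4), of l] l by simp_all
    have "p - x ^ k \<in> M" "p * (p - x ^ k) = p - x ^ k" "(p - x ^ k) * p = p - x ^ k" "p - (p - x ^ k) \<in> J U"
      using pp pxk xkJ by (simp_all add: diff_in pw x(1) left_diff_distrib right_diff_distrib)
    from corner_inverse_near[OF pp(1,2) this]
    obtain z w where z: "z \<in> U" and w: "w \<in> M" "(p - x ^ k) * w = p * z"
      "\<And>c. c \<in> M \<Longrightarrow> c * p = p * c \<Longrightarrow> c * (p - x ^ k) = (p - x ^ k) * c \<Longrightarrow> c * w = w * c" by blast
    have geo: "(\<Sum>j<m. x ^ j) - x * (\<Sum>j<m. x ^ j) = 1 - x ^ m" for m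
    proof (induction m)
      case (Suc m)
      have "(\<Sum>j<Suc m. x ^ j) - x * (\<Sum>j<Suc m. x ^ j)
          = ((\<Sum>j<m. x ^ j) - x * (\<Sum>j<m. x ^ j)) + (x ^ m - x * x ^ m)"
        by (simp add: distrib_left)
      then show ?case using Suc by simp
    qed simp
    define h where "h = p * (\<Sum>j<k. x ^ j) * w"
    have hM: "h \<in> M" unfolding h_def by (intro mult_in pp sum_in pw x(1) w(1))
    have ch: "c * h = h * c" if "c \<in> M" "c * x = x * c" "c * p = p * c" for c
      unfolding h_def by (intro commutes that w(3))
    have "p * (\<Sum>j<k. x ^ j) - x * (\<Sum>j<k. x ^ j) = p * ((\<Sum>j<k. x ^ j) - x * (\<Sum>j<k. x ^ j))"
      using x(3) by (simp add: right_diff_distrib mult.assoc[symmetric])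
    moreover have "(p - x) * (p * (\<Sum>j<k. x ^ j)) = p * (\<Sum>j<k. x ^ j) - x * (\<Sum>j<k. x ^ j)"
      using x(4) pp(2) by (simp add: left_diff_distrib mult.assoc[symmetric])
    ultimately have "(p - x) * (p * (\<Sum>j<k. x ^ j)) = p - x ^ k" unfolding geo using pxk
        by (simp add: right_diff_distrib)
    then have "(p - x) * h = p * z" unfolding h_def w(2)[symmetric] by (simp only: mult.assoc[symmetric])
    moreover have "h * (p - x) = (p - x) * h"
    proof (rule ch[symmetric])
      show "p - x \<in> M" using pp x by (simp add: diff_in)
      show "(p - x) * x = x * (p - x)" "(p - x) * p = p * (p - x)"
        using x(3,4) by (simp_all add: left_diff_distrib right_diff_distrib)
    qed
    moreover have "h * T = T * h" by (rule ch[OF TM x(2)[symmetric] pp(3)[symmetric], symmetric])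
    ultimately show ?thesis using hM z by metis
  qed
qed

text \<open>Multiplying a linear relation between orthogonal idempotents by one of them isolates its coefficient,
  so they are linearly independent modulo \<open>J U\<close>.\<close>
lemma orthogonal_card_bound:
  assumes Q: "finite Q" "\<And>q. q \<in> Q \<Longrightarrow> q \<in> M \<and> q * q = q \<and> q \<notin> J U"
    "\<And>p q. p \<in> Q \<Longrightarrow> q \<in> Q \<Longrightarrow> p \<noteq> q \<Longrightarrow> p * q = 0"
  shows "card Q \<le> card I"
proof (rule ccontr)
  assume "\<not> ?thesis"
  then obtain d where d: "\<exists>q\<in>Q. d q \<noteq> 0" "(\<Sum>q\<in>Q. d q *\<^sub>C q) \<in> J U"
    using dependent_mod_J[OF U I co Q(1), of "\<lambda>q. q"] Q(2) by auto
  then obtain q where q: "q \<in> Q" "d q \<noteq> 0" by blast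
  have "(\<Sum>p\<in>Q. d p *\<^sub>C p) * q = d q *\<^sub>C (q * q) + (\<Sum>p\<in>Q - {q}. d p *\<^sub>C (p * q))"
    by (simp add: sum.remove[OF Q(1) q(1)] distrib_right sum_distrib_right scaleC_bop_mult)
  also have "(\<Sum>p\<in>Q - {q}. d p *\<^sub>C (p * q)) = 0"
    using Q(3) q(1) by (intro sum.neutral) (auto simp: scaleC_zero_right)
  finally have "(\<Sum>p\<in>Q. d p *\<^sub>C p) * q = d q *\<^sub>C q" using Q(2)[OF q(1)] by simp
  then have "d q *\<^sub>C q \<in> J U" using J_mult_right[OF U d(2), of q] Q(2)[OF q(1)] by simp
  then have "(1 / d q) *\<^sub>C d q *\<^sub>C q \<in> J U" by (rule J_scaleC[OF U])
  then show False using q Q(2) by (simp add: scaleC_scaleC scaleC_one)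
qed

definition orthogonal_system where
  "orthogonal_system Q \<longleftrightarrow> finite Q \<and> Q \<subseteq> F \<and> (\<forall>q\<in>Q. q \<notin> J U) \<and> (\<forall>p\<in>Q. \<forall>q\<in>Q. p \<noteq> q \<longrightarrow> p * q = 0)"

text \<open>Take an orthogonal system of largest cardinality: it could be enlarged by its complement, or by
  replacing a member that splits with its two parts.\<close>
lemma maximal_orthogonal_system:
  "\<exists>Q. orthogonal_system Q \<and> 1 - \<Sum>Q \<in> J U \<and> (\<forall>p\<in>Q. \<forall>q\<in>F. q * p = q \<longrightarrow> q \<in> J U \<or> p - q \<in> J U)"
proof -
  have bound: "card Q \<le> card I" if "orthogonal_system Q" for Q
    by (rule orthogonal_card_bound) (use that F_M F_idem in \<open>auto simp: orthogonal_system_def\<close>)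
  have "orthogonal_system {}" by (simp add: orthogonal_system_def)
  then have "\<exists>Q. orthogonal_system Q \<and> (\<forall>Q'. orthogonal_system Q' \<longrightarrow> card Q' \<le> card Q)"
    by (rule ex_has_greatest_nat[of _ _ _ "Suc (card I)"]) (simp add: bound le_imp_less_Suc)
  then obtain Q where Q: "orthogonal_system Q" "\<And>Q'. orthogonal_system Q' \<Longrightarrow> card Q' \<le> card Q" by blast
  have Qf: "finite Q" "Q \<subseteq> F" "\<And>q. q \<in> Q \<Longrightarrow> q \<notin> J U" "\<And>p q. p \<in> Q \<Longrightarrow> q \<in> Q \<Longrightarrow> p \<noteq> q \<Longrightarrow> p * q = 0"
    using Q(1) by (auto simp: orthogonal_system_def)
  have sumQ: "\<Sum>Q \<in> F" "\<And>q. q \<in> Q \<Longrightarrow> q * \<Sum>Q = q \<and> \<Sum>Q * q = q" using F_sum[OF Qf(1,2,4)] by auto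
  have oneF: "1 \<in> F" by (rule B_F) simp
  have rF: "1 - \<Sum>Q \<in> F" by (rule F_diff[OF oneF sumQ(1)]) simp
  have "1 - \<Sum>Q \<in> J U"
  proof (rule ccontr)
    let ?r = "1 - \<Sum>Q"
    assume r: "?r \<notin> J U"
    have rq: "?r * q = 0" "q * ?r = 0" if "q \<in> Q" for q using sumQ(2)[OF that] by (simp_all add: algebra_simps)
    have "?r \<notin> Q" using rq(1)[of ?r] F_idem[OF rF] r J_zero[OF U] by auto
    moreover have "orthogonal_system (insert ?r Q)"
      using Q(1) rF r rq unfolding orthogonal_system_def by auto
    ultimately show False using Q(2)[of "insert ?r Q"] Qf(1) by simp
  qed
  moreover have "q \<in> J U \<or> p - q \<in> J U" if p: "p \<in> Q" and q: "q \<in> F" "q * p = q" for p q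
  proof (rule ccontr)
    assume n: "\<not> ?thesis"
    have pF: "p \<in> F" using p Qf by blast
    have pq: "p * q = q" using F_comm[OF pF q(1)] q(2) by simp
    let ?R = "Q - {p}"
    have dF: "p - q \<in> F" by (rule F_diff[OF pF q])
    have ppR: "r * p = 0" "p * r = 0" if "r \<in> ?R" for r using Qf(4) that p by auto
    have qR: "r * q = 0" "q * r = 0" if "r \<in> ?R" for r
      using ppR[OF that] pq q(2) by (metis mult.assoc mult_zero_left mult_zero_right)+
    have dR: "r * (p - q) = 0" "(p - q) * r = 0" if "r \<in> ?R" for r
      using ppR[OF that] qR[OF that] by (simp_all add: algebra_simps)
    have qd: "q * (p - q) = 0" "(p - q) * q = 0" using q(2) pq F_idem[OF q(1)] by (simp_all add: algebra_simps)
    have nJ: "q \<notin> J U" "p - q \<notin> J U" using n by auto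
    have "q \<notin> ?R" using qR(1)[of q] F_idem[OF q(1)] nJ(1) J_zero[OF U] by auto
    moreover have "p - q \<notin> ?R"
    proof
      assume "p - q \<in> ?R"
      from dR(1)[OF this] have "p - q = 0" by (simp only: F_idem[OF dF])
      then show False using nJ(2) J_zero[OF U] by simp
    qed
    moreover have "q \<noteq> p - q" using qd(1) F_idem[OF q(1)] nJ(1) J_zero[OF U] by metis
    ultimately have "card (insert q (insert (p - q) ?R)) = Suc (Suc (card ?R))"
      using Qf(1) by simp
    also have "\<dots> = Suc (card Q)" using card.remove[OF Qf(1) p] by simp
    finally have "card (insert q (insert (p - q) ?R)) = Suc (card Q)" .
    moreover have "orthogonal_system (insert q (insert (p - q) ?R))"
      using Q(1) q(1) dF nJ qR dR qd unfolding orthogonal_system_def by auto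
    ultimately show False using Q(2) by force
  qed
  ultimately show ?thesis using Q(1) by blast
qed

text \<open>All of the finitely many members of the system are made uniform over a common \<open>z \<in> U\<close>.\<close>
theorem local_decomposition:
  "\<exists>z\<in>U. \<exists>ps. sum_list ps = z \<and> sorted_wrt (\<lambda>p q. p * q = 0 \<and> q * p = 0) ps \<and>
    (\<forall>p\<in>set ps. p \<in> F \<and> (\<forall>q\<in>F. q * p = q \<longrightarrow> (\<exists>z\<in>B. q = p * z)))"
proof -
  obtain Q where Q: "orthogonal_system Q" "1 - \<Sum>Q \<in> J U" and
    un: "\<And>p q. p \<in> Q \<Longrightarrow> q \<in> F \<Longrightarrow> q * p = q \<Longrightarrow> q \<in> J U \<or> p - q \<in> J U"
    using maximal_orthogonal_system by blast
  have Qf: "finite Q" "Q \<subseteq> F" "\<And>p q. p \<in> Q \<Longrightarrow> q \<in> Q \<Longrightarrow> p \<noteq> q \<Longrightarrow> p * q = 0"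
    using Q(1) by (auto simp: orthogonal_system_def)
  have sumQ: "\<Sum>Q \<in> F" using F_sum[OF Qf] by blast
  have rF: "1 - \<Sum>Q \<in> F" by (rule F_diff[OF B_F[OF B_one] sumQ]) simp
  obtain z0 where z0: "z0 \<in> U" "(1 - \<Sum>Q) * z0 = 0"
    using J_idempotent[OF U F_M[OF rF] F_idem[OF rF]] Q(2) by blast
  have "\<exists>z\<in>U. \<forall>p\<in>P. \<forall>q\<in>F. q * (p * z) = q \<longrightarrow> (\<exists>z'\<in>B. q = p * z')" if P: "P \<subseteq> Q" for P
  proof -
    have "finite P" by (rule finite_subset[OF P Qf(1)])
    then show ?thesis using P
    proof (induction P rule: finite_induct)
      case empty then show ?case using U_one[OF U] by blast
    next
      case (insert p P)
      then obtain z where z: "z \<in> U" "\<And>p q. p \<in> P \<Longrightarrow> q \<in> F \<Longrightarrow> q * (p * z) = q \<Longrightarrow> \<exists>z'\<in>B. q = p * z'" by auto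
      have "p \<in> F" using insert Qf by blast
      then obtain u where u: "u \<in> U" "\<And>q. q \<in> F \<Longrightarrow> q * (p * u) = q \<Longrightarrow> \<exists>z'\<in>B. q = p * z'"
        using unsplittable_uniform[OF U, of p] un[of p] insert by auto
      have zu: "z * u \<in> U" by (rule U_mult[OF U z(1) u(1)])
      have red: "q * (p' * z) = q \<and> q * (p' * u) = q" if q: "q * (p' * (z * u)) = q" and p': "p' \<in> F" for p' q
      proof -
        note zuB = U_B[OF U zu]
        have zuz: "z * u * z = z * u" "z * u * u = z * u"
          using B_idem[OF U_B[OF U z(1)]] B_idem[OF U_B[OF U u(1)]] B_comm[OF U_B[OF U z(1)] B_M[OF U_B[OF U u(1)]]]
          by (simp_all add: mult.assoc) (simp add: mult.assoc[symmetric])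
        have q1: "q * (z * u) = q"
        proof -
          have "q * (z * u) = q * (p' * ((z * u) * (z * u)))" using q by (simp only: mult.assoc[symmetric])
          then show ?thesis by (simp only: B_idem[OF zuB] q)
        qed
        have "q * p' = q * (z * u) * p'" by (simp only: q1)
        also have "\<dots> = q * (p' * (z * u))" by (simp only: mult.assoc[of q] B_comm[OF zuB F_M[OF p']])
        finally have q2: "q * p' = q" using q by simp
        have "q * z = q * (z * u * z)" "q * u = q * (z * u * u)" using q1 by (simp_all only: mult.assoc[symmetric])
        then have "q * z = q" "q * u = q" by (simp_all only: zuz q1)
        then show ?thesis using q2 by (simp add: mult.assoc[symmetric])
      qed
      have "\<exists>z'\<in>B. q = p' * z'" if "p' \<in> insert p P" "q \<in> F" "q * (p' * (z * u)) = q" for p' q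
        using z(2)[of p' q] u(2)[of q] red[OF that(3)] that \<open>p \<in> F\<close> insert.prems Qf(2) by blast
      then show ?case using zu by blast
    qed
  qed
  from this[OF subset_refl] obtain z1 where z1: "z1 \<in> U" "\<And>p q. p \<in> Q \<Longrightarrow> q \<in> F \<Longrightarrow> q * (p * z1) = q \<Longrightarrow> \<exists>z'\<in>B. q
      = p * z'" by blast
  define z where "z = z0 * z1"
  have zU: "z \<in> U" unfolding z_def by (rule U_mult[OF U z0(1) z1(1)])
  note zB = U_B[OF U zU]
  have zz1: "z * z1 = z" unfolding z_def using B_idem[OF U_B[OF U z1(1)]] by (simp add: mult.assoc)
  obtain xs where xs: "set xs = Q" "distinct xs" using finite_distinct_list[OF Qf(1)] by blast
  define ps where "ps = map (\<lambda>p. p * z) xs"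
  have "sum_list ps = \<Sum>Q * z"
    unfolding ps_def using xs by (simp add: sum_list_distinct_conv_sum_set sum_distrib_right)
  also have "\<dots> = z" using z0(2) unfolding z_def by (simp add: left_diff_distrib mult.assoc[symmetric])
  finally have "sum_list ps = z" .
  moreover have "sorted_wrt (\<lambda>p q. p * q = 0 \<and> q * p = 0) ps"
  proof -
    have "p * z * (q * z) = 0" if "p \<in> Q" "q \<in> Q" "p \<noteq> q" for p q
    proof -
      have "p * z * (q * z) = p * q * z * z" using B_comm[OF zB F_M, of q] that Qf(2) by (metis subsetD mult.assoc)
      then show ?thesis using Qf(3)[OF that] by simp
    qed
    then have orth: "p * z * (q * z) = 0" if "p \<in> set xs" "q \<in> set xs" "p \<noteq> q" for p q
      using that xs(1) by blast
    show ?thesis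
      unfolding ps_def sorted_wrt_map unfolding sorted_wrt_iff_nth_less
    proof (intro allI impI)
      fix i j assume ij: "i < j" "j < length xs"
      then have ne: "xs ! i \<noteq> xs ! j" using nth_eq_iff_index_eq[OF xs(2)] by simp
      have m: "xs ! i \<in> set xs" "xs ! j \<in> set xs" using ij by simp_all
      show "xs ! i * z * (xs ! j * z) = 0 \<and> xs ! j * z * (xs ! i * z) = 0"
        by (rule conjI[OF orth[OF m ne] orth[OF m(2,1) ne[symmetric]]])
    qed
  qed
  moreover have "p' \<in> F \<and> (\<forall>q\<in>F. q * p' = q \<longrightarrow> (\<exists>z\<in>B. q = p' * z))" if "p' \<in> set ps" for p'
  proof -
    obtain p where p: "p \<in> Q" "p' = p * z" using \<open>p' \<in> set ps\<close> xs by (auto simp: ps_def)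
    have pF: "p \<in> F" using p Qf by blast
    have zp: "z * p = p * z" using B_comm[OF zB F_M[OF pF]] by simp
    have "\<exists>t\<in>B. q = p' * t" if q: "q \<in> F" "q * p' = q" for q
    proof -
      have qz: "q * z = q" using q(2) B_idem[OF zB] unfolding p(2) by (metis mult.assoc)
      have "q * p = q * z * p" by (simp only: qz)
      also have "\<dots> = q" using q(2) unfolding p(2) by (simp only: mult.assoc zp)
      finally have qp: "q * p = q" .
      have "q * z1 = q * (z * z1)" by (simp only: mult.assoc[symmetric] qz)
      then have "q * (p * z1) = q" by (simp only: zz1 qz mult.assoc[symmetric] qp)
      then obtain t where t: "t \<in> B" "q = p * t" using z1(2)[OF p(1) q(1)] by blast
      have "q = p' * t" using qz B_comm[OF zB B_M[OF t(1)]] unfolding p(2) t(2) by (simp add: mult.assoc)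
      then show ?thesis using t by blast
    qed
    then show ?thesis using F_mult[OF pF B_F[OF zB]] p(2) by blast
  qed
  ultimately show ?thesis using zU by blast
qed

end

end

section \<open>Krull-Schmidt cancellation for germs of idempotents\<close>

text \<open>A ring \<open>C\<close> with a multiplicative set \<open>U\<close> of central idempotents. Arguments in the localization, where
  every \<open>z \<in> U\<close> becomes \<open>1\<close>, are carried out as equations in \<open>C\<close> after cutting all elements by a common
  \<open>z\<close>, which avoids quotients.\<close>
locale germ_ring =
  fixes C :: "'a::ring set" and U :: "'a set"
  assumes C_add: "a \<in> C \<Longrightarrow> b \<in> C \<Longrightarrow> a + b \<in> C"
    and C_diff: "a \<in> C \<Longrightarrow> b \<in> C \<Longrightarrow> a - b \<in> C"
    and C_mult: "a \<in> C \<Longrightarrow> b \<in> C \<Longrightarrow> a * b \<in> C"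
    and C_zero: "0 \<in> C"
    and U_nonempty: "U \<noteq> {}"
    and U_C: "z \<in> U \<Longrightarrow> z \<in> C"
    and U_central: "z \<in> U \<Longrightarrow> c \<in> C \<Longrightarrow> z * c = c * z"
    and U_idem: "z \<in> U \<Longrightarrow> z * z = z"
    and U_mult: "z \<in> U \<Longrightarrow> w \<in> U \<Longrightarrow> z * w \<in> U"
begin

lemmas C_ops = C_add C_diff C_mult C_zero U_C

lemma cut_mult: "z \<in> U \<Longrightarrow> b \<in> C \<Longrightarrow> (a * z) * (b * z) = (a * b) * z"
  by (metis U_central U_idem mult.assoc)

lemma cut_move: "z \<in> U \<Longrightarrow> b \<in> C \<Longrightarrow> (a * z) * b = (a * b) * z"
  by (metis U_central mult.assoc)

text \<open>Algebraic equivalence of idempotents, with the intertwining elements normalized to the two corners.\<close>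
definition idem_iso :: "'a \<Rightarrow> 'a \<Rightarrow> bool"
  where "idem_iso p q \<longleftrightarrow> (\<exists>x\<in>C. \<exists>y\<in>C. y * x = p \<and> x * y = q \<and> q * x = x \<and> x * p = x \<and> p * y = y \<and> y * q = y)"

lemma idem_isoI:
  assumes "x \<in> C" "y \<in> C" "y * x = p" "x * y = q" "q * x = x" "x * p = x" "p * y = y" "y * q = y"
  shows "idem_iso p q"
  using assms unfolding idem_iso_def by blast

lemma idem_isoE:
  assumes "idem_iso p q"
  obtains x y where "x \<in> C" "y \<in> C" "y * x = p" "x * y = q" "q * x = x" "x * p = x" "p * y = y" "y * q = y"
    "p \<in> C" "q \<in> C" "p * p = p" "q * q = q"
proof -
  obtain x y where xy: "x \<in> C" "y \<in> C" "y * x = p" "x * y = q" "q * x = x" "x * p = x" "p * y = y" "y * q = y"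
    using assms unfolding idem_iso_def by blast
  have "p * p = p" using xy(3) xy(7) by (metis mult.assoc)
  moreover have "q * q = q" using xy(4) xy(5) by (metis mult.assoc)
  ultimately show ?thesis using that[OF xy] xy C_mult by blast
qed

lemma idem_iso_sym: "idem_iso p q \<Longrightarrow> idem_iso q p"
  unfolding idem_iso_def by blast

lemma idem_iso_refl: "p \<in> C \<Longrightarrow> p * p = p \<Longrightarrow> idem_iso p p"
  unfolding idem_iso_def by blast

lemma idem_iso_trans:
  assumes "idem_iso p q" "idem_iso q r" shows "idem_iso p r"
proof -
  obtain x y where 1: "x \<in> C" "y \<in> C" "y * x = p" "x * y = q" "q * x = x" "x * p = x" "p * y = y" "y * q = y"
    using assms(1) by (rule idem_isoE)
  obtain u v where 2: "u \<in> C" "v \<in> C" "v * u = q" "u * v = r" "r * u = u" "u * q = u" "q * v = v" "v * r = v"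
    using assms(2) by (rule idem_isoE)
  note rel = 1(3-8) 2(3-8)
  show ?thesis
    by (rule idem_isoI[of "u * x" "y * v"]) (simp_all add: C_mult 1(1,2) 2(1,2) mult.assoc rel rel[THEN
        mult_eq_ext])
qed

lemma idem_iso_cut:
  assumes "idem_iso p q" "z \<in> U" shows "idem_iso (p * z) (q * z)"
proof -
  obtain x y where 1: "x \<in> C" "y \<in> C" "y * x = p" "x * y = q" "q * x = x" "x * p = x" "p * y = y" "y * q
      = y" "p \<in> C" "q \<in> C"
    using assms(1) by (rule idem_isoE)
  show ?thesis
    by (rule idem_isoI[of "x * z" "y * z"]) (simp_all add: C_mult U_C cut_mult 1 assms(2))
qed

lemma idem_iso_add:
  assumes "idem_iso p q" "idem_iso p' q'" "p * p' = 0" "p' * p = 0" "q * q' = 0" "q' * q = 0"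
  shows "idem_iso (p + p') (q + q')"
proof -
  obtain x y where 1: "x \<in> C" "y \<in> C" "y * x = p" "x * y = q" "q * x = x" "x * p = x" "p * y = y" "y * q = y"
    using assms(1) by (rule idem_isoE)
  obtain x' y' where 2: "x' \<in> C" "y' \<in> C" "y' * x' = p'" "x' * y' = q'" "q' * x' = x'" "x' * p' = x'"
      "p' * y' = y'" "y' * q' = y'"
    using assms(2) by (rule idem_isoE)
  have "y * x' = (y * q) * (q' * x')" "y' * x = (y' * q') * (q * x)"
     "x * y' = (x * p) * (p' * y')" "x' * y = (x' * p') * (p * y)"
     "q * x' = q * (q' * x')" "q' * x = q' * (q * x)" "x * p' = (x * p) * p'" "x' * p = (x' * p') * p"
     "p * y' = p * (p' * y')" "p' * y = p' * (p * y)" "y * q' = (y * q) * q'" "y' * q = (y' * q') * q"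
    by (simp_all add: 1 2)
  then have 3: "y * x' = 0" "y' * x = 0" "x * y' = 0" "x' * y = 0" "q * x' = 0" "q' * x = 0" "x * p' = 0"
      "x' * p = 0"
     "p * y' = 0" "p' * y = 0" "y * q' = 0" "y' * q = 0"
    by (simp_all only: mult.assoc assms(3-6) assms(3-6)[THEN mult_eq_ext] mult_zero_left mult_zero_right)
  show ?thesis
    by (rule idem_isoI[of "x + x'" "y + y'"]) (simp_all add: C_add 1 2 3 distrib_left distrib_right)
qed

lemma idem_iso_restrict:
  assumes "idem_iso E F" "p \<in> C" "p * p = p" "E * p = p" "p * E = p"
  shows "\<exists>q\<in>C. idem_iso p q \<and> q * q = q \<and> F * q = q \<and> q * F = q \<and> idem_iso (E - p) (F - q)"
proof -
  obtain x y where 1: "x \<in> C" "y \<in> C" "y * x = E" "x * y = F" "F * x = x" "x * E = x" "E * y = y" "y * F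
      = y" "E \<in> C" "F \<in> C" "E * E = E" "F * F = F"
    using assms(1) by (rule idem_isoE)
  note rel = 1(3-8,11,12) assms(3-5)
  note simps = mult.assoc rel rel[THEN mult_eq_ext] left_diff_distrib right_diff_distrib
  have "x * p * y \<in> C" "idem_iso p (x * p * y)" "(x * p * y) * (x * p * y) = x * p * y" "F * (x * p * y)
      = x * p * y"
    "(x * p * y) * F = x * p * y"
    using 1(1,2) assms(2)
    by (auto intro!: idem_isoI[of "x * p" "p * y"] simp: simps C_mult)
  moreover have "idem_iso (E - p) (F - x * p * y)"
    using 1(1,2,9) assms(2)
    by (intro idem_isoI[of "x * (E - p)" "(E - p) * y"]) (simp_all add: simps C_mult C_diff)
  ultimately show ?thesis by blast
qed

text \<open>The corner of \<open>p\<close> becomes a local ring in the localization. The trivial corner is included.\<close>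
definition local_idem :: "'a \<Rightarrow> bool"
  where "local_idem p \<longleftrightarrow> p \<in> C \<and> p * p = p \<and> (\<forall>x\<in>C. p * x = x \<and> x * p = x \<longrightarrow>
    (\<exists>z\<in>U. \<exists>w\<in>C. w * x = p * z \<and> x * w = p * z \<or> w * (p - x) = p * z \<and> (p - x) * w = p * z))"

lemma local_idemD:
  assumes "local_idem p" "x \<in> C" "p * x = x" "x * p = x"
  obtains z w where "z \<in> U" "w \<in> C" "p * w = w" "w * p = w" "w * x = p * z" "x * w = p * z"
    | z w where "z \<in> U" "w \<in> C" "p * w = w" "w * p = w" "w * (p - x) = p * z" "(p - x) * w = p * z"
proof -
  have p: "p \<in> C" "p * p = p" using assms(1) by (simp_all add: local_idem_def)
  obtain z w where zw: "z \<in> U" "w \<in> C"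
    "w * x = p * z \<and> x * w = p * z \<or> w * (p - x) = p * z \<and> (p - x) * w = p * z"
    using assms unfolding local_idem_def by blast
  let ?w = "p * w * p"
  have w: "?w \<in> C" "p * ?w = ?w" "?w * p = ?w" using p zw
      by (simp_all add: C_mult mult.assoc p(2)[THEN mult_eq_ext])
  have gen: "?w * u = p * z \<and> u * ?w = p * z" if "p * u = u" "u * p = u" "w * u = p * z" "u * w = p * z" for u
  proof
    have "?w * u = p * (w * u)" using that by (simp add: mult.assoc)
    then show "?w * u = p * z" using that p by (simp add: p(2)[THEN mult_eq_ext])
    have "u * ?w = (u * w) * p" using that by (simp add: mult.assoc[symmetric])
    then show "u * ?w = p * z" using that p zw(1) by (simp add: cut_move)
  qed
  have "p * (p - x) = p - x" "(p - x) * p = p - x" using assms p by (simp_all add: algebra_simps)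
  then show ?thesis using zw(3) gen[of x] gen[of "p - x"] assms(3,4) that zw(1) w by blast
qed

lemma local_idem_cut:
  assumes p: "local_idem p" and z: "z \<in> U"
  shows "local_idem (p * z)"
  unfolding local_idem_def
proof (intro conjI ballI impI)
  have pC: "p \<in> C" "p * p = p" using p by (simp_all add: local_idem_def)
  show "p * z \<in> C" "p * z * (p * z) = p * z" using pC z by (simp_all add: C_mult U_C cut_mult)
  fix x assume x: "x \<in> C" "p * z * x = x \<and> x * (p * z) = x"
  have xz: "x * z = x" using x pC z by (metis U_idem mult.assoc)
  have "p * x = p * (p * z * x)" using x by simp
  also have "\<dots> = (p * p) * z * x" by (simp only: mult.assoc)
  also have "\<dots> = x" using x pC by simp
  finally have px: "p * x = x" .
  have "x * p = x * (p * z) * p" using x by simp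
  also have "\<dots> = x" using x pC z U_central[OF z pC(1)] by (metis mult.assoc)
  finally have xp: "x * p = x" .
  have cut: "(w * z) * u = p * z * z' \<and> u * (w * z) = p * z * z'"
    if "w \<in> C" "u \<in> C" "z' \<in> U" "w * u = p * z'" "u * w = p * z'" for w u z'
  proof
    have e: "p * z' * z = p * z * z'" by (simp add: mult.assoc U_central[OF z U_C[OF that(3)]])
    show "(w * z) * u = p * z * z'" using that e z by (simp add: cut_move)
    show "u * (w * z) = p * z * z'" using that e z by (simp add: mult.assoc[symmetric])
  qed
  have "(w * z) * (p * z - x) = (w * z) * (p - x)" "(p * z - x) * (w * z) = (p - x) * (w * z)" if "w \<in> C" for w
  proof -
    have "p * z - x = (p - x) * z" using xz by (simp add: algebra_simps)
    moreover have "(w * z) * ((p - x) * z) = (w * z) * (p - x)" "((p - x) * z) * (w * z) = (p - x) * (w * z)"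
      using cut_mult[OF z, of "p - x" w] cut_move[OF z, of "p - x" w] cut_mult[OF z that, of "p - x"] pC x(1) C_diff
      by (simp_all add: mult.assoc)
    ultimately show "(w * z) * (p * z - x) = (w * z) * (p - x)" "(p * z - x) * (w * z) = (p - x) * (w * z)"
        by simp_all
  qed
  note red = this
  from p x(1) px xp
  show "\<exists>z'\<in>U. \<exists>w\<in>C. w * x = p * z * z' \<and> x * w = p * z * z' \<or>
     w * (p * z - x) = p * z * z' \<and> (p * z - x) * w = p * z * z'"
  proof (cases rule: local_idemD)
    case (1 z' w)
    then show ?thesis using cut[OF 1(2) x(1) 1(1) 1(5,6)] C_mult[OF 1(2) U_C[OF z]] by blast
  next
    case (2 z' w)
    then show ?thesis using cut[OF 2(2) C_diff[OF pC(1) x(1)] 2(1) 2(5,6)] C_mult[OF 2(2) U_C[OF z]] red[OF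
        2(2)] by metis
  qed
qed

lemma local_idem_miso:
  assumes p: "local_idem p" and iso: "idem_iso p q"
  shows "local_idem q"
  unfolding local_idem_def
proof (intro conjI ballI impI)
  obtain x y where 1: "x \<in> C" "y \<in> C" "y * x = p" "x * y = q" "q * x = x" "x * p = x" "p * y = y" "y * q
      = y" "p \<in> C" "q \<in> C" "p * p = p" "q * q = q"
    using iso by (rule idem_isoE)
  show "q \<in> C" "q * q = q" by fact+
  fix c assume c: "c \<in> C" "q * c = c \<and> c * q = c"
  note rel = 1(3-8,11,12) c(2)[THEN conjunct1] c(2)[THEN conjunct2]
  note simps = mult.assoc rel rel[THEN mult_eq_ext] left_diff_distrib right_diff_distrib
  have c': "y * c * x \<in> C" "p * (y * c * x) = y * c * x" "y * c * x * p = y * c * x"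
    using 1 c by (simp_all add: C_mult simps)
  have tr: "(x * w * y) * u = q * z \<and> u * (x * w * y) = q * z"
    if "z \<in> U" "w \<in> C" "p * w = w" "w * p = w" "u \<in> C" "q * u = u" "u * q = u" "w * (y * u * x) = p * z"
        "(y * u * x) * w = p * z" for w z u
  proof
    have xpzy: "x * (p * z) * y = q * z"
      using cut_move[OF that(1) 1(2), of "x * p"] rel by (simp add: mult.assoc[symmetric])
    have "(x * w * y) * u = x * (w * (y * u * x)) * y" by (simp only: mult.assoc rel(2) that(7))
    then show "(x * w * y) * u = q * z" using that xpzy by simp
    have "u * (x * w * y) = x * ((y * u * x) * w) * y"
        by (simp only: mult.assoc rel(2)[THEN mult_eq_ext] that(6)[THEN mult_eq_ext])
    then show "u * (x * w * y) = q * z" using that xpzy by simp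
  qed
  have pd: "p - y * c * x = y * (q - c) * x" "q * (q - c) = q - c" "(q - c) * q = q - c" "q - c \<in> C"
    using 1(9,10) c(1) by (simp_all add: simps C_diff)
  from p c' show "\<exists>z\<in>U. \<exists>w\<in>C. w * c = q * z \<and> c * w = q * z \<or> w * (q - c) = q * z \<and> (q - c) * w = q * z"
  proof (cases rule: local_idemD)
    case (1 z w)
    then show ?thesis using tr[of z w c] c \<open>x \<in> C\<close> \<open>y \<in> C\<close> C_mult by metis
  next
    case (2 z w)
    then show ?thesis using tr[of z w "q - c"] pd \<open>x \<in> C\<close> \<open>y \<in> C\<close> C_mult by metis
  qed
qed

text \<open>If the \<open>(p, q)\<close> entry of an isomorphism from \<open>p + a\<close> to \<open>q + b\<close> is invertible, its Schur complement is
  an isomorphism from \<open>a\<close> to \<open>b\<close>.\<close>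
lemma schur_complement:
  assumes C: "x \<in> C" "y \<in> C" "W \<in> C" "V \<in> C" "w \<in> C" "p \<in> C" "q \<in> C" "a \<in> C" "b \<in> C"
    and xy: "y * x = p" "x * y = q" "q * x = x" "x * p = x" "p * y = y" "y * q = y"
    and idem: "a * a = a" "b * b = b" "p * a = 0" "a * p = 0" "q * b = 0" "b * q = 0" "p * p = p" "q * q = q"
    and VW: "V * W = p + a" "W * V = q + b" 
    and w: "w * (y * W * p) = p" "(y * W * p) * w = p" "p * w = w" "w * p = w"
  shows "idem_iso a b"
proof -
  have z: "b * x = 0" "y * b = 0" "a * w = 0" "w * a = 0" "a * y = 0" "x * a = 0"
  proof -
    have "b * x = (b * q) * x" "y * b = y * (q * b)" "a * w = (a * p) * w" "w * a = w * (p * a)"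
      "a * y = (a * p) * y" "x * a = x * (p * a)"
      unfolding mult.assoc xy w using xy w by (simp_all add: mult.assoc[symmetric])
    then show "b * x = 0" "y * b = 0" "a * w = 0" "w * a = 0" "a * y = 0" "x * a = 0" by (simp_all add: idem)
  qed
  have VbW: "V * (b * (W * t)) = p * t + a * t - V * (x * (y * (W * t)))" for t
  proof -
    have "V * (b * (W * t)) = V * (W * V - q) * (W * t)" by (simp add: VW mult.assoc)
    also have "\<dots> = (V * W) * ((V * W) * t) - V * (q * (W * t))" by (simp add: algebra_simps)
    also have "(V * W) * ((V * W) * t) = p * t + a * t"
      by (simp add: VW distrib_left distrib_right mult.assoc idem idem[THEN mult_eq_ext])
    also have "q * (W * t) = x * (y * (W * t))" by (simp add: xy(2)[symmetric] mult.assoc)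
    finally show ?thesis .
  qed
  have WaV: "W * (a * (V * t)) = q * t + b * t - W * (p * (V * t))" for t
  proof -
    have "W * (a * (V * t)) = W * (V * W - p) * (V * t)" by (simp add: VW mult.assoc)
    also have "\<dots> = (W * V) * ((W * V) * t) - W * (p * (V * t))" by (simp add: algebra_simps)
    also have "(W * V) * ((W * V) * t) = q * t + b * t"
      by (simp add: VW distrib_left distrib_right mult.assoc idem idem[THEN mult_eq_ext])
    finally show ?thesis .
  qed
  have ww: "w * (y * (W * (p * t))) = p * t" for t
    using arg_cong[OF w(1), of "\<lambda>s. s * t"] by (simp add: mult.assoc)
  have yWw: "y * (W * w) = p" using w(2,3) by (simp add: mult.assoc)
  have yWw': "y * (W * (w * t)) = p * t" for t using arg_cong[OF yWw, of "\<lambda>s. s * t"] by (simp add: mult.assoc)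
  note rel = xy(3-6) idem w(3,4) z
  let ?x = "b * W * a - b * W * w * y * W * a" and ?y = "a * V * b"
  note simps = mult.assoc left_diff_distrib right_diff_distrib distrib_left distrib_right
    rel rel[THEN mult_eq_ext] VbW WaV ww yWw yWw'
  show ?thesis
  proof (rule idem_isoI[of ?x ?y])
    show "?x \<in> C" "?y \<in> C" using C by (simp_all add: C_mult C_diff)
    show "?y * ?x = a" by (simp add: simps)
    show "?x * ?y = b" by (simp add: simps)
  qed (simp_all add: mult.assoc left_diff_distrib right_diff_distrib rel rel[THEN mult_eq_ext])
qed

text \<open>If \<open>D A\<close> is invertible in the local corner, then \<open>A\<close> has a left inverse \<open>l\<close>, and \<open>A\<close> is invertible
  because the idempotent \<open>A l\<close> can only be \<open>0\<close> or \<open>p\<close>, and \<open>0\<close> only when \<open>p\<close> vanishes.\<close>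
lemma local_idem_corner_unit:
  assumes p: "local_idem p" and AD: "A \<in> C" "D \<in> C" "p * A = A" "A * p = A" "p * D = D" "D * p = D"
  shows "(\<exists>z\<in>U. \<exists>w\<in>C. p * w = w \<and> w * p = w \<and> w * A = p * z \<and> A * w = p * z) \<or>
    (\<exists>z\<in>U. \<exists>u\<in>C. p * u = u \<and> u * p = u \<and> u * (p - D * A) = p * z)"
proof -
  have pC: "p \<in> C" "p * p = p" using p by (simp_all add: local_idem_def)
  have DA: "D * A \<in> C" "p * (D * A) = D * A" "(D * A) * p = D * A"
    using AD by (simp_all add: C_mult mult.assoc) (simp add: mult.assoc[symmetric])
  from p DA show ?thesis
  proof (cases rule: local_idemD)
    case (2 z u) then show ?thesis by blast
  next
    case (1 z u)
    define l where "l = u * D"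
    have l: "l \<in> C" "p * l = l" "l * p = l" "l * A = p * z"
      using 1 AD by (simp_all add: l_def C_mult mult.assoc) (simp add: mult.assoc[symmetric])
    have g: "A * l \<in> C" "p * (A * l) = A * l" "(A * l) * p = A * l"
      using AD l by (simp_all add: C_mult mult.assoc) (simp add: mult.assoc[symmetric])
    have zc: "z * c = c * z" if "c \<in> C" for c using U_central[OF 1(1) that] .
    from p g show ?thesis
    proof (cases rule: local_idemD)
      case (1 z' v)
      have "(l * A) * (l * v) = l * (A * l * v)" by (simp add: mult.assoc)
      then have "p * z * (l * v) = l * (p * z')" using l 1 by simp
      then have lv: "(l * v) * z = l * z'"
        using l(2,3) zc[of "l * v"] C_mult[OF l(1) 1(2)] by (metis mult.assoc)
      have zz: "z' * z = z * z'" using zc[OF U_C[OF 1(1)]] by simp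
      have "(l * z') * A = p * (z * z')" using cut_move[OF 1(1) AD(1), of l] l(4) by (simp add: mult.assoc)
      moreover have "A * (l * z') = p * (z * z')"
      proof -
        have "A * (l * z') = (A * l * v) * z" by (simp add: lv[symmetric] mult.assoc)
        also have "\<dots> = p * (z * z')" using 1 by (simp add: mult.assoc zz)
        finally show ?thesis .
      qed
      moreover have "p * (l * z') = l * z'" "(l * z') * p = l * z'"
        using l cut_move[OF 1(1) pC(1), of l] by (simp_all add: mult.assoc[symmetric])
      ultimately show ?thesis using U_mult[OF \<open>z \<in> U\<close> 1(1)] C_mult[OF l(1) U_C[OF 1(1)]] by blast
    next
      case (2 z' v)
      have zz: "z' * z = z * z'" using zc[OF U_C[OF 2(1)]] by simp
      have "(A * l) * (A * l) = A * (l * A) * l" by (simp add: mult.assoc)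
      also have "\<dots> = A * p * (z * l)" using l(4) by (simp add: mult.assoc)
      also have "\<dots> = A * l * z" using AD zc[OF l(1)] by (simp add: mult.assoc)
      finally have gg: "(A * l) * (A * l) = A * l * z" .
      have "(p - A * l) * (A * l * z) = 0"
      proof -
        have "(p - A * l) * (A * l * z) = p * (A * l) * z - ((A * l) * (A * l)) * z" by (simp add: algebra_simps)
        also have "\<dots> = 0" unfolding gg g using U_idem[OF \<open>z \<in> U\<close>] by (simp add: mult.assoc)
        finally show ?thesis .
      qed
      then have "(v * (p - A * l)) * (A * l * z) = 0" by (simp add: mult.assoc)
      then have "p * z' * (A * l * z) = 0" using 2 by simp
      then have "p * (A * l * z) * z' = 0" using cut_move[OF 2(1), of "A * l * z" p] C_ops g(1) \<open>z \<in> U\<close> by metis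
      then have "A * l * z * z' = 0" using g(2) by (metis mult.assoc)
      then have "l * (A * l * z * z') * A = 0" by simp
      moreover have "l * (A * l * z * z') * A = p * (z * z')"
      proof -
        have zz_c: "(z * z') * c = c * (z * z')" if "c \<in> C" for c using U_central[OF U_mult[OF \<open>z \<in> U\<close> 2(1)] that] .
        have "l * (A * l * z * z') * A = (l * A) * (l * ((z * z') * A))" by (simp add: mult.assoc)
        also have "\<dots> = (p * z) * (p * z) * (z * z')" unfolding zz_c[OF AD(1)] using l(4)
            by (simp add: mult.assoc[symmetric])
        also have "\<dots> = p * (z * z')" using cut_mult[OF \<open>z \<in> U\<close> pC(1), of p] pC U_idem[OF \<open>z \<in> U\<close>]
            by (metis mult.assoc)
        finally show ?thesis .
      qed
      ultimately have "p * (z * z') = 0" by simp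
      then show ?thesis using U_mult[OF \<open>z \<in> U\<close> 2(1)] C_zero by (intro disjI1 bexI[of _ "z * z'"] bexI[of _ 0]) auto
    qed
  qed
qed

text \<open>A summand with local endomorphism ring can be cancelled. The entry \<open>A\<close> of the isomorphism \<open>W\<close>
  satisfies \<open>D A + E W p = p\<close>, where \<open>D\<close> and \<open>E\<close> come from the inverse. If \<open>A\<close> is not invertible, then
  \<open>E W p\<close> has a left inverse \<open>u\<close>, and adding \<open>(p - A) u E\<close> times the second row to the first makes the
  entry \<open>p\<close>.\<close>
lemma cancellation:
  assumes p: "local_idem p" and pq: "idem_iso p q" and iso: "idem_iso (p + a) (q + b)"
    and ab: "a \<in> C" "b \<in> C" "a * a = a" "b * b = b" "p * a = 0" "a * p = 0" "q * b = 0" "b * q = 0"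
  shows "\<exists>z\<in>U. idem_iso (a * z) (b * z)"
proof -
  obtain x y where x: "x \<in> C" "y \<in> C" and xy: "y * x = p" "x * y = q" "q * x = x" "x * p = x" "p * y = y"
      "y * q = y"
    and pq: "p \<in> C" "q \<in> C" "p * p = p" "q * q = q"
    using pq by (rule idem_isoE)
  obtain W V where W: "W \<in> C" "V \<in> C" and VW: "V * W = p + a" "W * V = q + b"
    and WV': "(q + b) * W = W" "W * (p + a) = W" "(p + a) * V = V" "V * (q + b) = V"
    using iso by (rule idem_isoE)
  have b0: "b * x = 0" "y * b = 0"
    using ab(8) ab(7) xy(3,6) by (metis mult.assoc mult_zero_left mult_zero_right)+
  define A where "A = y * W * p"
  define D where "D = p * V * x"
  define E where "E = p * V * b"
  note rel = xy pq(3,4) ab(3-8) b0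
  note simps = mult.assoc left_diff_distrib right_diff_distrib distrib_left distrib_right rel rel[THEN mult_eq_ext]
  have AD: "A \<in> C" "D \<in> C" "p * A = A" "A * p = A" "p * D = D" "D * p = D"
    using x W pq by (simp_all add: A_def D_def C_mult simps)
  have E: "E \<in> C" "p * E = E" "E * b = E" using W pq ab by (simp_all add: E_def C_mult simps)
  have DAE: "E * W * p = p - D * A"
  proof -
    have "E * W * p = p * V * (W * V - q) * W * p" by (simp add: E_def VW mult.assoc)
    also have "\<dots> = p * ((V * W) * (V * W)) * p - p * V * (x * y) * W * p" by (simp add: xy algebra_simps)
    also have "p * ((V * W) * (V * W)) * p = p" by (simp add: VW simps)
    finally show ?thesis by (simp add: A_def D_def simps)
  qed
  \<comment> \<open>one elementary row operation makes the corner invertible\<close>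
  have "\<exists>z\<in>U. \<exists>c\<in>C. \<exists>w\<in>C. p * w = w \<and> w * p = w \<and> p * c = c \<and> c * b = c \<and>
      w * (A + c * W * p) = p * z \<and> (A + c * W * p) * w = p * z"
    using local_idem_corner_unit[OF p AD]
  proof (elim disjE bexE conjE)
    fix z w assume "z \<in> U" "w \<in> C" "p * w = w" "w * p = w" "w * A = p * z" "A * w = p * z"
    then show ?thesis by (intro bexI[of _ z] bexI[of _ 0] bexI[of _ w]) (simp_all add: C_zero)
  next
    fix z u assume u: "z \<in> U" "u \<in> C" "p * u = u" "u * p = u" "u * (p - D * A) = p * z"
    have zc: "z * c = c * z" if "c \<in> C" for c using U_central[OF u(1) that] .
    define c where "c = (p - A) * u * E"
    have c: "c \<in> C" "p * c = c" "c * b = c"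
      using pq(1) AD(1) E(1,3) u(2)
      by (simp_all add: c_def C_mult C_diff mult.assoc left_diff_distrib right_diff_distrib pq(3)[THEN mult_eq_ext]
          AD(3)[THEN mult_eq_ext] u(3)[THEN mult_eq_ext])
    have "c * W * p = (p - A) * (u * (E * W * p))" by (simp add: c_def mult.assoc)
    also have "\<dots> = (p - A) * (p * z)" by (simp add: DAE u)
    finally have "A + c * W * p = A + (p - A) * p * z" by (simp add: mult.assoc)
    then have e: "A + c * W * p = A + (p - A) * z" using pq AD by (simp add: left_diff_distrib)
    have "(A + (p - A) * z) * z = p * z"
      using U_idem[OF u(1)] by (simp add: distrib_right left_diff_distrib mult.assoc)
    moreover have "p * (A + (p - A) * z) = A + (p - A) * z" "(A + (p - A) * z) * p = A + (p - A) * z"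
      using AD pq cut_move[OF u(1) pq(1), of "p - A"]
      by (simp_all add: distrib_left distrib_right left_diff_distrib right_diff_distrib mult.assoc[symmetric])
    ultimately have "(p * z) * (A + c * W * p) = p * z" "(A + c * W * p) * (p * z) = p * z"
      unfolding e using zc[of "A + (p - A) * z"] C_ops AD pq u(1) by (metis mult.assoc)+
    moreover have "p * (p * z) = p * z" "(p * z) * p = p * z" "p * z \<in> C"
      using pq zc[OF pq(1)] U_C[OF u(1)] by (simp_all add: C_mult mult.assoc pq(3)[THEN mult_eq_ext])
    ultimately show ?thesis using c u(1) by blast
  qed
  then obtain z c w where z: "z \<in> U" and c: "c \<in> C" "p * c = c" "c * b = c"
    and w: "w \<in> C" "p * w = w" "w * p = w" "w * (A + c * W * p) = p * z" "(A + c * W * p) * w = p * z" by blast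
  define W' where "W' = W + x * c * W"
  define V' where "V' = V - V * x * c"
  have WV'C: "W' \<in> C" "V' \<in> C" using W x c by (simp_all add: W'_def V'_def C_ops C_diff)
  have cx: "c * x = 0" "c * q = 0" using c(3) b0(1) ab(8) by (metis mult.assoc mult_zero_right)+
  note simps' = simps c(2,3) cx c(2,3)[THEN mult_eq_ext] cx[THEN mult_eq_ext]
  have V'W': "V' * W' = p + a" by (simp add: V'_def W'_def simps' VW)
  have "W' * V' = W * V + x * c * (W * V) - W * V * x * c - x * c * (W * V) * x * c"
    by (simp add: V'_def W'_def simps')
  then have W'V': "W' * V' = q + b" by (simp add: VW simps')
  have corner: "y * W' * p = A + c * W * p" by (simp add: W'_def A_def simps')
  have acC: "A + c * W * p \<in> C" using AD c W pq by (simp add: C_ops)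
  have pzz: "p * z * z = p * z" using U_idem[OF z] by (simp add: mult.assoc)
  let ?z = "\<lambda>s. s * z"
  have cm: "?z s * ?z t = ?z (s * t)" if "t \<in> C" for s t using cut_mult[OF z that] .
  have "idem_iso (?z a) (?z b)"
  proof (rule schur_complement[of "?z x" "?z y" "?z W'" "?z V'" "?z w" "?z p" "?z q"])
    show "w * z * (y * z * (W' * z) * (p * z)) = p * z" "y * z * (W' * z) * (p * z) * (w * z) = p * z"
      using corner by (simp_all add: cm WV'C w(1,4,5) pq x C_mult acC pzz)
  qed (use x WV'C w(1-3) pq ab xy V'W' W'V' z in \<open>simp_all add: cm C_mult U_C distrib_right[symmetric]\<close>)
  then show ?thesis using z by blast
qed

text \<open>If the factorization of \<open>p\<close> through \<open>F\<close> is invertible, the composite in the other order is an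
  idempotent below \<open>F\<close> isomorphic to \<open>p\<close>.\<close>
lemma exchange_step:
  assumes p: "p \<in> C" "p * p = p" and F: "F \<in> C" "F * F = F" and xy: "x \<in> C" "y \<in> C"
    and w: "z \<in> U" "w \<in> C" "p * w = w" "w * (p * y * F * x * p) = p * z"
  shows "\<exists>g\<in>C. idem_iso (p * z) g \<and> g * g = g \<and> F * z * g = g \<and> g * (F * z) = g"
proof -
  define \<alpha> where "\<alpha> = F * x * p * z"
  define \<beta> where "\<beta> = w * p * y * F * z"
  have C: "\<alpha> \<in> C" "\<beta> \<in> C" using assms by (simp_all add: \<alpha>_def \<beta>_def C_mult U_C)
  have zc: "z * c = c * z" if "c \<in> C" for c using U_central[OF w(1) that] .
  have \<beta>\<alpha>: "\<beta> * \<alpha> = p * z"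
  proof -
    have "\<beta> * \<alpha> = (w * p * y * F) * (F * x * p) * z"
      unfolding \<alpha>_def \<beta>_def using assms by (simp add: cut_mult C_mult)
    also have "\<dots> = (w * (p * y * F * x * p)) * z" by (simp add: mult.assoc F(2)[THEN mult_eq_ext])
    also have "\<dots> = p * z" using w(4) U_idem[OF w(1)] by (simp add: mult.assoc)
    finally show ?thesis .
  qed
  have \<alpha>: "F * \<alpha> = \<alpha>" "\<alpha> * (p * z) = \<alpha>" "\<alpha> * z = \<alpha>"
    using assms U_idem[OF w(1)] unfolding \<alpha>_def
    by (simp_all add: cut_mult) (simp_all add: mult.assoc F(2)[THEN mult_eq_ext])
  have \<beta>: "\<beta> * F = \<beta>" "p * z * \<beta> = \<beta>" "\<beta> * z = \<beta>"
    using assms U_idem[OF w(1)] cut_move[OF w(1) F(1)] cut_mult[OF w(1), of "w * p * y * F" p] unfolding \<beta>_def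
    by (simp_all add: C_mult) (simp_all add: mult.assoc w(3)[THEN mult_eq_ext])
  let ?g = "\<alpha> * \<beta>"
  have g: "?g * \<alpha> = \<alpha>" using \<beta>\<alpha> \<alpha> by (simp add: mult.assoc)
  have "idem_iso (p * z) ?g"
    by (rule idem_isoI[OF C \<beta>\<alpha> refl g \<alpha>(2) \<beta>(2)]) (metis \<beta>\<alpha> \<beta>(2) mult.assoc)
  moreover have "?g * ?g = ?g" using g by (metis mult.assoc)
  moreover have "F * z * ?g = ?g"
    using \<alpha>(1) \<beta>(3) zc[OF C_mult[OF C]] by (metis mult.assoc)
  moreover have "?g * (F * z) = ?g" using \<beta>(1,3) by (metis mult.assoc)
  ultimately show ?thesis using C C_mult by blast
qed

text \<open>The identity of a local \<open>p\<close> is the sum of its two factorizations through \<open>F1\<close> and \<open>F2\<close>; one of them is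
  invertible, so \<open>p\<close> is isomorphic to a summand of \<open>F1\<close> or of \<open>F2\<close>.\<close>
lemma exchange:
  assumes p: "local_idem p" and iso: "idem_iso E (F1 + F2)" and pE: "E * p = p" "p * E = p"
    and F: "F1 \<in> C" "F1 * F1 = F1" "F2 \<in> C" "F2 * F2 = F2"
  shows "\<exists>z\<in>U. \<exists>g\<in>C. idem_iso (p * z) g \<and> g * g = g \<and>
    (F1 * z * g = g \<and> g * (F1 * z) = g \<or> F2 * z * g = g \<and> g * (F2 * z) = g)"
proof -
  obtain x y where x: "x \<in> C" "y \<in> C" "y * x = E" "x * y = F1 + F2" "(F1 + F2) * x = x" "x * E = x" "E * y
      = y" "y * (F1 + F2) = y"
    using iso by (rule idem_isoE)
  have pC: "p \<in> C" "p * p = p" using p by (simp_all add: local_idem_def)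
  let ?k = "p * y * F1 * x * p"
  have "p * y * F1 * x * p + p * y * F2 * x * p = p * (y * (F1 + F2)) * x * p" by (simp add: algebra_simps)
  also have "\<dots> = p * (y * x) * p" using x by (simp add: mult.assoc)
  also have "\<dots> = p" using x pE pC by simp
  finally have k2: "p - ?k = p * y * F2 * x * p" by (simp add: eq_diff_eq add.commute diff_eq_eq)
  have k: "?k \<in> C" "p * ?k = ?k" "?k * p = ?k"
    using pC x F by (simp_all add: C_mult mult.assoc pC(2)[THEN mult_eq_ext])
  from p k show ?thesis
  proof (cases rule: local_idemD)
    case (1 z w)
    then show ?thesis using exchange_step[OF pC F(1,2) x(1,2) 1(1,2,3,5)] by blast
  next
    case (2 z w)
    then show ?thesis using exchange_step[OF pC F(3,4) x(1,2) 2(1,2,3) 2(5)[unfolded k2]] by blast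
  qed
qed

lemma sum_list_orth:
  fixes p :: 'a
  assumes "\<And>q. q \<in> set ps \<Longrightarrow> p * q = 0 \<and> q * p = 0"
  shows "p * sum_list ps = 0 \<and> sum_list ps * p = 0"
  using assms by (induction ps) (auto simp: distrib_left distrib_right)

lemma sum_list_C: "set ps \<subseteq> C \<Longrightarrow> sum_list ps \<in> C"
  by (induction ps) (auto simp: C_zero C_add)

lemma idem_iso_zero_iff: "idem_iso 0 q \<longleftrightarrow> q = 0"
proof
  assume "idem_iso 0 q"
  then obtain x y where "x * y = q" "0 * y = y" unfolding idem_iso_def by blast
  then show "q = 0" by simp
qed (simp add: idem_iso_refl C_zero)

text \<open>Induction on the number of local summands of \<open>E1\<close>. A summand \<open>p\<close> of \<open>E1\<close> has copies in \<open>E2\<close>, in \<open>F1\<close>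
  and in \<open>F2\<close>; split all four off, cancel \<open>p\<close> twice, and apply the induction hypothesis to the
  complements \<open>e1\<close>, \<open>e2\<close>, \<open>f1\<close>, \<open>f2\<close>.\<close>
theorem halving:
  assumes "\<forall>p\<in>set ps. local_idem p" "sorted_wrt (\<lambda>p q. p * q = 0 \<and> q * p = 0) ps"
    and "idem_iso (sum_list ps) E2" "idem_iso F1 F2" "idem_iso (sum_list ps + E2) (F1 + F2)"
    and "sum_list ps * E2 = 0" "E2 * sum_list ps = 0" "F1 * F2 = 0" "F2 * F1 = 0"
  shows "\<exists>z\<in>U. idem_iso (sum_list ps * z) (F1 * z)"
  using assms
proof (induction "length ps" arbitrary: ps E2 F1 F2)
  case 0
  then have "E2 = 0" by (simp add: idem_iso_zero_iff)
  then have "F1 + F2 = 0" using 0 by (simp add: idem_iso_zero_iff)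
  moreover obtain "F1 * F1 = F1" using 0(5) by (rule idem_isoE)
  ultimately have "F1 = 0" using 0(9) by (metis distrib_left add.right_neutral mult_zero_right)
  then show ?case using 0 U_nonempty by (auto simp: idem_iso_zero_iff)
next
  case (Suc n qs)
  then obtain p ps where qs: "qs = p # ps" by (cases qs) auto
  define e where "e = sum_list ps"
  have len: "n = length ps" and p: "local_idem p" and ps: "\<forall>p\<in>set ps. local_idem p"
    and orth: "sorted_wrt (\<lambda>p q. p * q = 0 \<and> q * p = 0) ps"
    using Suc.hyps(2) Suc.prems(1,2) qs by auto
  have pe: "p * e = 0" "e * p = 0" using sum_list_orth[of ps p] Suc.prems(2) unfolding qs e_def by auto
  have pC: "p \<in> C" "p * p = p" using p by (simp_all add: local_idem_def)
  have eC: "e \<in> C" unfolding e_def using ps by (intro sum_list_C) (auto simp: local_idem_def)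
  let ?E1 = "p + e"
  have E: "idem_iso ?E1 E2" "idem_iso (?E1 + E2) (F1 + F2)" "?E1 * E2 = 0" "E2 * ?E1 = 0"
    using Suc.prems unfolding qs e_def by simp_all
  note F12 = \<open>idem_iso F1 F2\<close> \<open>F1 * F2 = 0\<close> \<open>F2 * F1 = 0\<close>
  obtain E1C: "?E1 * ?E1 = ?E1" "E2 \<in> C" "E2 * E2 = E2" using E(1) by (rule idem_isoE)
  obtain FC: "F1 \<in> C" "F2 \<in> C" "F1 * F1 = F1" "F2 * F2 = F2" using F12(1) by (rule idem_isoE)
  have pE1: "?E1 * p = p" "p * ?E1 = p" using pe pC by (simp_all add: distrib_left distrib_right)
  have ee: "e * e = e" using E1C(1) pe pC by (simp add: distrib_left distrib_right)
  have "E2 * p = (E2 * ?E1) * p" "p * E2 = p * (?E1 * E2)" using pE1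
      by (simp_all only: mult.assoc) (simp add: mult.assoc[symmetric])
  then have pE2: "E2 * p = 0" "p * E2 = 0" using E by simp_all
  have eE2: "E2 * e = 0" "e * E2 = 0" using E pE2 by (simp_all add: distrib_left distrib_right)
  \<comment> \<open>the summand \<open>p\<close> reappears below \<open>F1\<close> or \<open>F2\<close>, hence below both\<close>
  obtain z g where z: "z \<in> U" and g: "g \<in> C" "idem_iso (p * z) g" "g * g = g" "F1 * z * g = g" "g * (F1 * z) = g"
  proof -
    obtain z g where z: "z \<in> U" and g: "g \<in> C" "idem_iso (p * z) g" "g * g = g"
      and or: "F1 * z * g = g \<and> g * (F1 * z) = g \<or> F2 * z * g = g \<and> g * (F2 * z) = g"
      using exchange[OF p E(2) _ _ FC(1,3,2,4)] pE1 pE2 by (auto simp: distrib_left distrib_right pE1 pE2)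
    from or show ?thesis
    proof
      assume F2g: "F2 * z * g = g \<and> g * (F2 * z) = g"
      then obtain g' where "g' \<in> C" "idem_iso g g'" "g' * g' = g'" "F1 * z * g' = g'" "g' * (F1 * z) = g'"
        using idem_iso_restrict[OF idem_iso_cut[OF idem_iso_sym[OF F12(1)] z] g(1,3)] by blast
      then show ?thesis using that z idem_iso_trans[OF g(2)] by blast
    qed (use that z g in blast)
  qed
  have cm: "(s * z) * (t * z) = s * t * z" if "t \<in> C" for s t using cut_mult[OF z that] .
  have pz: "p * z \<in> C" "p * z * (p * z) = p * z" "?E1 * z * (p * z) = p * z" "p * z * (?E1 * z) = p * z"
    using pC eC pE1 z by (simp_all add: cm C_ops)
  obtain p' where p': "p' \<in> C" "idem_iso (p * z) p'" "p' * p' = p'" "E2 * z * p' = p'" "p' * (E2 * z) = p'"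
     "idem_iso (?E1 * z - p * z) (E2 * z - p')"
    using idem_iso_restrict[OF idem_iso_cut[OF E(1) z] pz] by blast
  obtain g' where g': "g' \<in> C" "idem_iso g g'" "g' * g' = g'" "F2 * z * g' = g'" "g' * (F2 * z) = g'"
     "idem_iso (F1 * z - g) (F2 * z - g')"
    using idem_iso_restrict[OF idem_iso_cut[OF F12(1) z] g(1,3,4,5)] by blast
  define e1 where "e1 = e * z"
  define e2 where "e2 = E2 * z - p'"
  define f1 where "f1 = F1 * z - g"
  define f2 where "f2 = F2 * z - g'"
  have C: "e1 \<in> C" "e2 \<in> C" "f1 \<in> C" "f2 \<in> C"
    using eC E1C FC g g' p' z by (simp_all add: e1_def e2_def f1_def f2_def C_mult U_C C_diff)
  have E1z: "?E1 * z = p * z + e1" "E2 * z = p' + e2" "F1 * z = g + f1" "F2 * z = g' + f2"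
    by (simp_all add: e1_def e2_def f1_def f2_def distrib_right)
  have e12: "idem_iso e1 e2" using p'(6) by (simp add: e1_def e2_def distrib_right)
  have f12: "idem_iso f1 f2" using g'(6) by (simp add: f1_def f2_def)
  have E12z: "(?E1 * z) * (E2 * z) = 0" "(E2 * z) * (?E1 * z) = 0" "(F1 * z) * (F2 * z) = 0"
      "(F2 * z) * (F1 * z) = 0"
    using E F12 FC E1C pC eC by (simp_all add: cm C_add)
  have z1: "(p * z) * e1 = 0" "e1 * (p * z) = 0" "e1 * e1 = e1" using pe ee eC pC by (simp_all add: e1_def cm)
  have z2: "p' * e2 = 0" "e2 * p' = 0" "e2 * e2 = e2"
    using p' cm[OF E1C(2), of E2] E1C(3) by (simp_all add: e2_def left_diff_distrib right_diff_distrib)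
  have z3: "g * f1 = 0" "f1 * g = 0" "f1 * f1 = f1"
    using g cm[OF FC(1), of F1] FC(3) by (simp_all add: f1_def left_diff_distrib right_diff_distrib)
  have z4: "g' * f2 = 0" "f2 * g' = 0" "f2 * f2 = f2"
    using g' cm[OF FC(2), of F2] FC(4) by (simp_all add: f2_def left_diff_distrib right_diff_distrib)
  have cross: "s * t = 0" if "s * S = s" "T * t = t" "S * T = 0" for s t S T :: 'a
    using that by (metis mult.assoc mult_zero_left mult_zero_right)
  have b1: "e1 * (?E1 * z) = e1" "(?E1 * z) * e1 = e1" unfolding E1z using z1
      by (simp_all add: distrib_left distrib_right)
  have b2: "e2 * (E2 * z) = e2" "(E2 * z) * e2 = e2" unfolding E1z using z2
      by (simp_all add: distrib_left distrib_right)
  have b3: "f1 * (F1 * z) = f1" "(F1 * z) * f1 = f1" unfolding E1z using z3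
      by (simp_all add: distrib_left distrib_right)
  have b4: "f2 * (F2 * z) = f2" "(F2 * z) * f2 = f2" unfolding E1z using z4
      by (simp_all add: distrib_left distrib_right)
  note o1 = cross[OF pz(4) p'(4) E12z(1)] cross[OF pz(4) b2(2) E12z(1)] cross[OF b1(1) p'(4) E12z(1)]
      cross[OF b1(1) b2(2) E12z(1)]
    cross[OF p'(5) pz(3) E12z(2)] cross[OF b2(1) pz(3) E12z(2)] cross[OF p'(5) b1(2) E12z(2)] cross[OF b2(1)
        b1(2) E12z(2)]
  note o2 = cross[OF g(5) g'(4) E12z(3)] cross[OF g(5) b4(2) E12z(3)] cross[OF b3(1) g'(4) E12z(3)] cross[OF
      b3(1) b4(2) E12z(3)]
    cross[OF g'(5) g(4) E12z(4)] cross[OF b4(1) g(4) E12z(4)] cross[OF g'(5) b3(2) E12z(4)] cross[OF b4(1)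
        b3(2) E12z(4)]
  note zs = distrib_left distrib_right o1 o2 z1 z2 z3 z4 p'(3) g(3) g'(3)
  have "idem_iso ((?E1 + E2) * z) ((F1 + F2) * z)" by (rule idem_iso_cut[OF E(2) z])
  then have "idem_iso (p * z + (p' + (e1 + e2))) (g + (g' + (f1 + f2)))"
    unfolding distrib_right E1z[unfolded distrib_right] by (simp add: E1z e1_def add_ac)
  from cancellation[OF local_idem_cut[OF p z] g(2) this]
  obtain u where u: "u \<in> U" "idem_iso ((p' + (e1 + e2)) * u) ((g' + (f1 + f2)) * u)"
    using C p'(1) g'(1) by (auto simp: C_add zs)
  have cu: "(s * u) * (t * u) = s * t * u" if "t \<in> C" for s t using cut_mult[OF u(1) that] .
  have "idem_iso p' g'" by (rule idem_iso_trans[OF idem_iso_sym[OF p'(2)] idem_iso_trans[OF g(2) g'(2)]])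
  then have "idem_iso (p' * u) (g' * u)" by (rule idem_iso_cut[OF _ u(1)])
  moreover have "local_idem (p' * u)"
    by (rule local_idem_cut[OF local_idem_miso[OF local_idem_cut[OF p z] p'(2)] u(1)])
  moreover have "idem_iso (p' * u + (e1 + e2) * u) (g' * u + (f1 + f2) * u)" using u(2) by (simp add: distrib_right)
  ultimately obtain v where v: "v \<in> U" "idem_iso ((e1 + e2) * u * v) ((f1 + f2) * u * v)"
    using cancellation[of "p' * u" "g' * u" "(e1 + e2) * u" "(f1 + f2) * u"] C p'(1) g'(1) U_C[OF u(1)]
    by (auto simp: C_add C_mult cu zs)
  let ?t = "u * v" and ?s = "z * (u * v)"
  have t: "?t \<in> U" and s: "?s \<in> U" using z u v U_mult by simp_all
  have ct: "(a * ?t) * (b * ?t) = a * b * ?t" if "b \<in> C" for a b using cut_mult[OF t that] .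
  have es: "sum_list (map (\<lambda>p. p * ?s) ps) = e1 * ?t"
    unfolding e1_def e_def by (induction ps) (simp_all add: distrib_right mult.assoc)
  have "\<exists>w\<in>U. idem_iso (sum_list (map (\<lambda>p. p * ?s) ps) * w) (f1 * ?t * w)"
  proof (rule Suc.hyps(1))
    show "n = length (map (\<lambda>p. p * ?s) ps)" by (simp add: len)
    show "\<forall>q\<in>set (map (\<lambda>p. p * ?s) ps). local_idem q" using ps local_idem_cut[OF _ s] by auto
    have "q * ?s * (q' * ?s) = 0" if "q \<in> set ps" "q' \<in> set ps" "q * q' = 0" for q q'
      using that ps cut_mult[OF s, of q' q] by (auto simp: local_idem_def)
    then show "sorted_wrt (\<lambda>p q. p * q = 0 \<and> q * p = 0) (map (\<lambda>p. p * ?s) ps)"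
      unfolding sorted_wrt_map by (intro sorted_wrt_mono_rel[OF _ orth]) blast
    show "idem_iso (sum_list (map (\<lambda>p. p * ?s) ps)) (e2 * ?t)" "idem_iso (f1 * ?t) (f2 * ?t)"
      unfolding es by (rule idem_iso_cut[OF e12 t], rule idem_iso_cut[OF f12 t])
    show "idem_iso (sum_list (map (\<lambda>p. p * ?s) ps) + e2 * ?t) (f1 * ?t + f2 * ?t)"
      unfolding es using v(2) by (simp add: distrib_right mult.assoc)
    show "sum_list (map (\<lambda>p. p * ?s) ps) * (e2 * ?t) = 0" "e2 * ?t * sum_list (map (\<lambda>p. p * ?s) ps) = 0"
      "f1 * ?t * (f2 * ?t) = 0" "f2 * ?t * (f1 * ?t) = 0"
      unfolding es using C by (simp_all add: ct zs)
  qed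
  then obtain w where w: "w \<in> U" "idem_iso (e1 * (?t * w)) (f1 * (?t * w))" unfolding es by (auto simp: mult.assoc)
  have tw: "?t * w \<in> U" using t w(1) U_mult by blast
  have "idem_iso (p * z * (?t * w)) (g * (?t * w))" by (rule idem_iso_cut[OF g(2) tw])
  then have "idem_iso (p * z * (?t * w) + e1 * (?t * w)) (g * (?t * w) + f1 * (?t * w))"
    using C pz(1) g(1) by (intro idem_iso_add w(2)) (simp_all add: cut_mult[OF tw] zs)
  then have "idem_iso (sum_list qs * (z * (?t * w))) (F1 * (z * (?t * w)))"
    unfolding qs using E1z by (simp add: e_def[symmetric] mult.assoc[symmetric] distrib_right[symmetric])
  then show ?case using U_mult[OF z tw] by blast
qed

end

section \<open>Two-by-two matrices and the similarity of the summands\<close>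

text \<open>Matrices of fixed size form a ring as a type, whereas matrices of arbitrary dimensions do not.\<close>
datatype 'a m2 = M2 (m00: 'a) (m01: 'a) (m10: 'a) (m11: 'a)

instantiation m2 :: (ring) ring
begin

definition "0 = M2 0 0 0 (0::'a)"
definition "A + B = M2 (m00 A + m00 B) (m01 A + m01 B) (m10 A + m10 B) (m11 A + m11 (B::'a m2))"
definition "A - B = M2 (m00 A - m00 B) (m01 A - m01 B) (m10 A - m10 B) (m11 A - m11 (B::'a m2))"
definition "- A = M2 (- m00 A) (- m01 A) (- m10 A) (- m11 (A::'a m2))"
definition "A * B = M2 (m00 A * m00 B + m01 A * m10 B) (m00 A * m01 B + m01 A * m11 B)
  (m10 A * m00 B + m11 A * m10 B) (m10 A * m01 B + m11 A * m11 (B::'a m2))"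

instance
  by standard (simp_all add: zero_m2_def plus_m2_def minus_m2_def uminus_m2_def times_m2_def
      algebra_simps)

end

lemma m2_simps [simp]:
  "M2 a b c d + M2 a' b' c' d' = M2 (a + a') (b + b') (c + c') (d + d')"
  "M2 a b c d - M2 a' b' c' d' = M2 (a - a') (b - b') (c - c') (d - d')"
  "M2 a b c d * M2 a' b' c' d' = M2 (a * a' + b * c') (a * b' + b * d') (c * a' + d * c') (c * b' + d * d')"
  by (simp_all add: plus_m2_def minus_m2_def times_m2_def)

lemma m2_zero: "0 = M2 0 0 0 0" by (rule zero_m2_def)

definition m2_of :: "'a mat \<Rightarrow> 'a m2"
  where "m2_of X = M2 (X $$ (0,0)) (X $$ (0,1)) (X $$ (1,0)) (X $$ (1,1))"

lemma m2_of_mult: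
  fixes X Y :: "'a::ring mat"
  assumes "X \<in> carrier_mat 2 2" "Y \<in> carrier_mat 2 2"
  shows "m2_of (X * Y) = m2_of X * m2_of Y"
  using assms by (simp add: m2_of_def scalar_prod_def numeral_2_eq_2)

lemma m2_of_one: "m2_of (1\<^sub>m 2) = M2 1 0 0 1"
  by (simp add: m2_of_def)

lemma m2_of_diag2: "m2_of (diag2 S T) = M2 S 0 0 T"
  by (simp add: m2_of_def diag2_def mat_of_rows_list_def)

lemma diag2_carrier: "diag2 S T \<in> carrier_mat 2 2"
  by (simp add: diag2_def mat_of_rows_list_def numeral_2_eq_2)

lemma elements_mat_carrier:
  "X \<in> carrier_mat m n \<Longrightarrow> elements_mat X \<subseteq> M \<longleftrightarrow> (\<forall>i<m. \<forall>j<n. X $$ (i,j) \<in> M)"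
  by (auto elim!: elements_matD intro: elements_matI)

text \<open>The matrix \<open>X\<close> with inverse \<open>Y\<close> is the given similarity from \<open>T1 \<oplus> T1\<close> to \<open>T2 \<oplus> T2\<close>.\<close>
locale doubled_similarity = maximal_family M T1 F K I b cf
  for M :: "'h::complex_hilbert bop set" and T1 :: "'h bop" and F K
    and I :: "'i set" and b cf +
  fixes T2 :: "'h bop" and X Y :: "'h bop m2"
  assumes T2M: "T2 \<in> M"
    and XM: "m00 X \<in> M" "m01 X \<in> M" "m10 X \<in> M" "m11 X \<in> M"
    and YM: "m00 Y \<in> M" "m01 Y \<in> M" "m10 Y \<in> M" "m11 Y \<in> M"
    and XY: "X * Y = M2 1 0 0 1" "Y * X = M2 1 0 0 1"
    and intertwine: "X * M2 T1 0 0 T1 = M2 T2 0 0 T2 * X"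
begin

definition "entries_in A \<longleftrightarrow> m00 A \<in> M \<and> m01 A \<in> M \<and> m10 A \<in> M \<and> m11 A \<in> M"

definition "intertwiners = {A. entries_in A \<and> A * M2 T1 0 0 T1 = M2 T1 0 0 T1 * A}"

lemma entries_mult: "entries_in A \<Longrightarrow> entries_in A' \<Longrightarrow> entries_in (A * A')"
  by (cases A; cases A') (simp add: entries_in_def add_in mult_in)

lemma m2_unit [simp]: "M2 1 0 0 1 * A = A" "A * M2 1 0 0 1 = (A :: 'h bop m2)"
  by (cases A; simp)+

lemma scalar_m2_comm:
  assumes "z \<in> B" "entries_in A" shows "M2 z 0 0 z * A = A * M2 z 0 0 z"
  using assms B_comm[OF assms(1)] by (cases A) (simp add: entries_in_def)

text \<open>Similarity of the parts of \<open>T1\<close> and \<open>T2\<close> over the central projection \<open>z\<close>; for \<open>z = 1\<close> it is the claim.\<close>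
definition isomorphic_over where
  "isomorphic_over z \<longleftrightarrow> (\<exists>x\<in>M. \<exists>y\<in>M. x * y = z \<and> y * x = z \<and> x * z = x \<and> z * x = x \<and> y * z = y \<and> z * y = y
      \<and> x * T1 = T2 * x)"

context
  fixes U assumes U: "ultrafilter U"
begin

lemma germ_ring_intertwiners: "germ_ring intertwiners ((\<lambda>z. M2 z 0 0 z) ` U)"
proof
  fix A A' assume "A \<in> intertwiners" "A' \<in> intertwiners"
  then have A: "entries_in A" "entries_in A'" "A * M2 T1 0 0 T1 = M2 T1 0 0 T1 * A" "A' * M2 T1 0 0 T1
      = M2 T1 0 0 T1 * A'"
    by (auto simp: intertwiners_def)
  show "A + A' \<in> intertwiners"
    using A by (cases A; cases A') (simp add: intertwiners_def entries_in_def add_in distrib_left distrib_right)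
  show "A - A' \<in> intertwiners"
    using A by (cases A; cases A') (simp add: intertwiners_def entries_in_def diff_in left_diff_distrib
        right_diff_distrib)
  show "A * A' \<in> intertwiners" unfolding intertwiners_def mem_Collect_eq
    using A(1,2) entries_mult commutes_mult[OF A(3)[symmetric] A(4)[symmetric], symmetric] by blast
next
  show "0 \<in> intertwiners" by (simp add: intertwiners_def entries_in_def m2_zero)
  show "(\<lambda>z. M2 z 0 0 z) ` U \<noteq> {}" using U_one[OF U] by blast
  fix Z assume "Z \<in> (\<lambda>z. M2 z 0 0 z) ` U"
  then obtain z where z: "z \<in> U" "Z = M2 z 0 0 z" by blast
  have zB: "z \<in> B" by (rule U_B[OF U z(1)])
  show "Z \<in> intertwiners" using B_comm[OF zB TM] B_M[OF zB] by (simp add: z intertwiners_def entries_in_def)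
  show "Z * Z = Z" using B_idem[OF zB] by (simp add: z)
  show "Z * c = c * Z" if "c \<in> intertwiners" for c using scalar_m2_comm[OF zB, of c] that
      by (simp add: z intertwiners_def)
  show "Z * W \<in> (\<lambda>z. M2 z 0 0 z) ` U" if W: "W \<in> (\<lambda>z. M2 z 0 0 z) ` U" for W
  proof -
    obtain w where w: "w \<in> U" "W = M2 w 0 0 w" using W by blast
    then show ?thesis using U_mult[OF U z(1) w(1)] by (simp add: z)
  qed
qed

text \<open>All idempotents live in the commutant of \<open>T1 \<oplus> T1\<close>: the coordinate projections, and their conjugates
  \<open>Y E X\<close>, which stand for the two copies of \<open>T2\<close>. Both pairs add up to the same central projection, so
  \<open>halving\<close> applies, and an isomorphism from the first coordinate projection to its conjugate becomes an
  intertwiner of \<open>T1\<close> and \<open>T2\<close> after multiplication by \<open>X\<close>.\<close>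
lemma isomorphic_near: "\<exists>z\<in>U. isomorphic_over z"
proof -
  interpret G: germ_ring intertwiners "(\<lambda>z. M2 z 0 0 z) ` U" by (rule germ_ring_intertwiners)
  obtain z0 ps where z0: "z0 \<in> U" and ps: "sum_list ps = z0" "sorted_wrt (\<lambda>p q. p * q = 0 \<and> q * p = 0) ps"
    "\<forall>p\<in>set ps. p \<in> F \<and> (\<forall>q\<in>F. q * p = q \<longrightarrow> (\<exists>z\<in>B. q = p * z))"
    using local_decomposition[OF U] by blast
  let ?d = "\<lambda>p. M2 p 0 0 (0::'h bop)" and ?T = "M2 T1 0 0 T1" and ?S = "M2 T2 0 0 T2"
  have loc: "G.local_idem (?d p)" if "p \<in> set ps" for p
    unfolding G.local_idem_def
  proof (intro conjI ballI impI)
    have p: "p \<in> F" and un: "\<forall>q\<in>F. q * p = q \<longrightarrow> (\<exists>z\<in>B. q = p * z)" using ps(3) that by auto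
    show "?d p \<in> intertwiners" using F_M[OF p] F_T[OF p] by (simp add: intertwiners_def entries_in_def)
    show "?d p * ?d p = ?d p" using F_idem[OF p] by simp
    fix A assume A: "A \<in> intertwiners" "?d p * A = A \<and> A * ?d p = A"
    obtain x where x: "A = ?d x" using A(2) by (cases A) auto
    have "x \<in> M" "x * T1 = T1 * x" "p * x = x" "x * p = x" using A unfolding x
        by (auto simp: intertwiners_def entries_in_def)
    from locality[OF U p un this]
    obtain z w where zw: "z \<in> U" "w \<in> M" "w * T1 = T1 * w"
      "w * x = p * z \<and> x * w = p * z \<or> w * (p - x) = p * z \<and> (p - x) * w = p * z" by blast
    have "?d w \<in> intertwiners" using zw by (simp add: intertwiners_def entries_in_def)
    moreover have "?d w * A = ?d p * M2 z 0 0 z \<and> A * ?d w = ?d p * M2 z 0 0 z \<or>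
       ?d w * (?d p - A) = ?d p * M2 z 0 0 z \<and> (?d p - A) * ?d w = ?d p * M2 z 0 0 z"
      using zw(4) by (auto simp: x)
    ultimately show "\<exists>z\<in>(\<lambda>z. M2 z 0 0 z) ` U. \<exists>w\<in>intertwiners. w * A = ?d p * z \<and> A * w = ?d p * z \<or>
       w * (?d p - A) = ?d p * z \<and> (?d p - A) * w = ?d p * z" using zw(1) by blast
  qed
  note z0B = U_B[OF U z0]
  let ?Z = "M2 z0 0 0 z0" and ?E1 = "?d z0" and ?E2 = "M2 0 0 0 z0"
  have YX: "entries_in X" "entries_in Y" using XM YM by (simp_all add: entries_in_def)
  have YS: "Y * ?S = ?T * Y"
  proof -
    have "Y * ?S = Y * (?S * X) * Y" using XY by (simp add: mult.assoc)
    also have "\<dots> = (Y * X) * ?T * Y" by (simp add: intertwine[symmetric] mult.assoc)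
    finally show ?thesis using XY by simp
  qed
  have conj_intertwiners: "Y * A * X \<in> intertwiners" if A: "entries_in A" "A * ?S = ?S * A" for A
  proof -
    have "Y * A * X * ?T = Y * (A * ?S) * X" by (simp add: mult.assoc intertwine)
    also have "\<dots> = (Y * ?S) * A * X" by (simp add: A mult.assoc)
    also have "\<dots> = ?T * (Y * A * X)" unfolding YS by (simp only: mult.assoc)
    finally show ?thesis unfolding intertwiners_def using A YX entries_mult by simp
  qed
  have conj_mult: "(Y * A * X) * (Y * A' * X) = Y * (A * A') * X" for A A'
  proof -
    have "(Y * A * X) * (Y * A' * X) = Y * A * (X * Y) * A' * X" by (simp only: mult.assoc)
    then show ?thesis using XY by (simp add: mult.assoc)
  qed
  let ?c = "\<lambda>A. Y * A * X"
  have z0M: "z0 \<in> M" "z0 * z0 = z0" using z0B B_M B_idem by auto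
  have zT: "z0 * T1 = T1 * z0" "z0 * T2 = T2 * z0" using B_comm[OF z0B] TM T2M by auto
  have sumE1: "sum_list (map ?d qs) = ?d (sum_list qs)" for qs
    by (induction qs) (simp_all add: m2_zero)
  have E: "G.idem_iso ?E1 ?E2"
    by (rule G.idem_isoI[of "M2 0 0 z0 0" "M2 0 z0 0 0"]) (simp_all add: intertwiners_def entries_in_def z0M zT)
  have Fi: "G.idem_iso (?c ?E1) (?c ?E2)"
    by (rule G.idem_isoI[of "?c (M2 0 0 z0 0)" "?c (M2 0 z0 0 0)"])
      (simp_all add: conj_mult z0M, auto intro!: conj_intertwiners simp: entries_in_def z0M zT)
  have cZ: "?c ?Z = ?Z"
  proof -
    have "?c ?Z = ?Z * (Y * X)" unfolding scalar_m2_comm[OF z0B YX(2), symmetric] by (simp only: mult.assoc)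
    then show ?thesis using XY by simp
  qed
  have csum: "?c ?E1 + ?c ?E2 = ?c ?Z"
  proof -
    have "?c ?E1 + ?c ?E2 = Y * (?E1 + ?E2) * X" by (simp only: distrib_left distrib_right)
    then show ?thesis by simp
  qed
  have EF: "G.idem_iso (?E1 + ?E2) (?c ?E1 + ?c ?E2)"
    unfolding csum cZ using z0M zT by (intro G.idem_isoI[of ?Z ?Z]) (simp_all add: intertwiners_def entries_in_def)
  have ortho: "?E1 * ?E2 = 0" "?E2 * ?E1 = 0" "?c ?E1 * ?c ?E2 = 0" "?c ?E2 * ?c ?E1 = 0"
    unfolding conj_mult by (simp_all add: m2_zero[symmetric])
  have "\<exists>W\<in>(\<lambda>z. M2 z 0 0 z) ` U. G.idem_iso (sum_list (map ?d ps) * W) (?c ?E1 * W)"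
  proof (rule G.halving)
    show "\<forall>p\<in>set (map ?d ps). G.local_idem p" using loc by auto
    show "sorted_wrt (\<lambda>p q. p * q = 0 \<and> q * p = 0) (map ?d ps)"
      unfolding sorted_wrt_map using ps(2) by (simp add: m2_zero)
    show "G.idem_iso (sum_list (map ?d ps)) ?E2" "G.idem_iso (sum_list (map ?d ps) + ?E2) (?c ?E1 + ?c ?E2)"
      "sum_list (map ?d ps) * ?E2 = 0" "?E2 * sum_list (map ?d ps) = 0"
      unfolding sumE1 ps(1) by (rule E, rule EF, rule ortho, rule ortho)
  qed (rule Fi, (rule ortho)+)
  then obtain w where w: "w \<in> U" "G.idem_iso (?E1 * M2 w 0 0 w) (?c ?E1 * M2 w 0 0 w)" unfolding sumE1 ps(1) by auto
  define z where "z = z0 * w"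
  have zU: "z \<in> U" unfolding z_def by (rule U_mult[OF U z0 w(1)])
  note zB = U_B[OF U zU] and wB = U_B[OF U w(1)]
  have zM: "z \<in> M" "z * z = z" using zB B_M B_idem by auto
  have "?c ?E1 * M2 w 0 0 w = Y * (?E1 * (X * M2 w 0 0 w))" by (simp only: mult.assoc)
  also have "\<dots> = Y * (?E1 * M2 w 0 0 w) * X"
    unfolding scalar_m2_comm[OF wB YX(1), symmetric] by (simp only: mult.assoc)
  finally have "?c ?E1 * M2 w 0 0 w = ?c (?d z)" by (simp add: z_def)
  then have iso: "G.idem_iso (?d z) (?c (?d z))" using w(2) by (simp add: z_def)
  obtain A A' where A: "A \<in> intertwiners" "A' \<in> intertwiners" "A' * A = ?d z" "A * A' = ?c (?d z)"
      "?c (?d z) * A = A" "A * ?d z = A"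
    "?d z * A' = A'" "A' * ?c (?d z) = A'" using iso by (rule G.idem_isoE)
  define V where "V = X * A"
  define V' where "V' = A' * Y"
  have Ve: "entries_in V" "entries_in V'" unfolding V_def V'_def using A YX entries_mult
      by (auto simp: intertwiners_def)
  have VV: "V' * V = ?d z" "V * V' = ?d z"
  proof -
    have "V' * V = A' * (Y * X) * A" by (simp add: V_def V'_def mult.assoc)
    then show "V' * V = ?d z" using A XY by simp
    have "V * V' = X * (A * A') * Y" by (simp add: V_def V'_def mult.assoc)
    also have "\<dots> = (X * Y) * ?d z * (X * Y)" unfolding A by (simp only: mult.assoc)
    finally show "V * V' = ?d z" using XY by simp
  qed
  have dV: "?d z * V = V" "V * ?d z = V" "?d z * V' = V'" "V' * ?d z = V'"
  proof -
    have "V = X * (?c (?d z) * A)" using A by (simp add: V_def)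
    also have "\<dots> = (X * Y) * ?d z * V" by (simp add: V_def mult.assoc)
    finally show "?d z * V = V" using XY by simp
    show "V * ?d z = V" using A by (simp add: V_def mult.assoc)
    show "?d z * V' = V'" using A by (simp add: V'_def mult.assoc[symmetric])
    have "V' = A' * ?c (?d z) * Y" using A by (simp add: V'_def)
    also have "\<dots> = V' * ?d z * (X * Y)" by (simp add: V'_def mult.assoc)
    finally show "V' * ?d z = V'" using XY by simp
  qed
  have VT: "V * ?T = ?S * V"
  proof -
    have "V * ?T = X * ?T * A" using A(1) by (simp add: V_def intertwiners_def mult.assoc)
    then show ?thesis by (simp add: intertwine V_def mult.assoc)
  qed
  obtain x where x: "V = ?d x" using dV(1,2) by (cases V) auto
  obtain y where y: "V' = ?d y" using dV(3,4) by (cases V') auto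
  have "isomorphic_over z" unfolding isomorphic_over_def
    using Ve VV dV VT unfolding x y entries_in_def by (intro bexI[of _ x] bexI[of _ y]) auto
  then show ?thesis using zU by blast
qed

end

lemma isomorphic_cut:
  assumes "isomorphic_over z" "z \<in> B" "w \<in> B" shows "isomorphic_over (z * w)"
proof -
  obtain x y where xy: "x \<in> M" "y \<in> M" "x * y = z" "y * x = z" "x * z = x" "z * x = x" "y * z = y" "z * y
      = y" "x * T1 = T2 * x"
    using assms(1) unfolding isomorphic_over_def by blast
  have c: "c * w = w * c" if "c \<in> M" for c using B_comm[OF assms(3) that] .
  have ww: "w * w = w" by (rule B_idem[OF assms(3)])
  have zM: "z \<in> M" "w \<in> M" using assms B_M by auto
  have wc: "w * (c * t) = c * (w * t)" if "c \<in> M" for c t using c[OF that] by (simp add: mult.assoc[symmetric])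
  have wT: "w * T1 = T1 * w" "w * T2 = T2 * w" using c TM T2M by auto
  have wwt: "w * (w * t) = w * t" for t by (simp add: mult.assoc[symmetric] ww)
  have rel: "x * (y * t) = z * t" "y * (x * t) = z * t" "x * (z * t) = x * t" "z * (x * t) = x * t"
     "y * (z * t) = y * t" "z * (y * t) = y * t" for t using xy by (simp_all add: mult.assoc[symmetric])
  have T': "x * (w * T1) = T2 * (x * w)" unfolding wT using xy(9) by (simp add: mult.assoc[symmetric])
  have g: "(c * w) * (d * w) = c * d * w" if "d \<in> M" for c d using c[OF that] by (simp add: mult.assoc wwt)
  show ?thesis unfolding isomorphic_over_def
    by (intro bexI[of _ "x * w"] bexI[of _ "y * w"] conjI)
      (simp_all add: g xy zM mult_in, simp add: mult.assoc T')
qed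

lemma isomorphic_add:
  assumes "isomorphic_over z" "isomorphic_over w" "z * w = 0" "w * z = 0"
  shows "isomorphic_over (z + w)"
proof -
  obtain x y where 1: "x \<in> M" "y \<in> M" "x * y = z" "y * x = z" "x * z = x" "z * x = x" "y * z = y" "z * y
      = y" "x * T1 = T2 * x"
    using assms(1) unfolding isomorphic_over_def by blast
  obtain x' y' where 2: "x' \<in> M" "y' \<in> M" "x' * y' = w" "y' * x' = w" "x' * w = x'" "w * x' = x'" "y' * w
      = y'" "w * y' = y'" "x' * T1 = T2 * x'"
    using assms(2) unfolding isomorphic_over_def by blast
  have cross: "s * t = 0" if "s * S = s" "R * t = t" "S * R = 0" for s t S R :: "'h bop"
    using that by (metis mult.assoc mult_zero_left mult_zero_right)
  have zz: "z * z = z" "w * w = w" using 1(3,6) 2(3,6) by (metis mult.assoc)+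
  note c = cross[OF 1(5) 2(8) assms(3)] cross[OF 1(7) 2(6) assms(3)] cross[OF 2(5) 1(8) assms(4)] cross[OF
      2(7) 1(6) assms(4)]
    cross[OF 1(5) zz(2) assms(3)] cross[OF 1(7) zz(2) assms(3)] cross[OF 2(5) zz(1) assms(4)] cross[OF 2(7)
        zz(1) assms(4)]
    cross[OF zz(1) 2(6) assms(3)] cross[OF zz(1) 2(8) assms(3)] cross[OF zz(2) 1(6) assms(4)] cross[OF zz(2)
        1(8) assms(4)]
  show ?thesis unfolding isomorphic_over_def
    by (intro bexI[of _ "x + x'"] bexI[of _ "y + y'"] conjI) (simp_all add: distrib_left distrib_right 1 2 c add_in)
qed

theorem similar: "\<exists>x\<in>M. \<exists>y\<in>M. x * y = 1 \<and> y * x = 1 \<and> x * T1 = T2 * x"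
proof -
  have "isomorphic_over 1"
  proof (rule ccontr)
    assume "\<not> ?thesis"
    moreover have "isomorphic_over 0" unfolding isomorphic_over_def by (intro bexI[of _ 0]) auto
    ultimately obtain U where "ultrafilter U" "\<And>z. z \<in> U \<Longrightarrow> \<not> isomorphic_over z"
      using ultrafilter_exists[of isomorphic_over] isomorphic_cut isomorphic_add Z_comm B_Z B_M
      by (metis (no_types, lifting))
    then show False using isomorphic_near by blast
  qed
  then show ?thesis unfolding isomorphic_over_def by auto
qed

end

section \<open>Coordinates over the centre and the main theorem\<close>

text \<open>The preimages of the matrix units generate \<open>M\<close> over the preimages of the scalar matrices, which are
  central; coordinates and norm estimates then live in \<open>M\<close> itself.\<close>
lemma type_I_coordinates:
  fixes M :: "'h::complex_hilbert bop set"
  assumes "type_I_algebra TYPE('k::complex_hilbert) n M"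
  obtains b :: "nat \<times> nat \<Rightarrow> 'h bop" and cf
  where "\<And>i. i \<in> {..<n} \<times> {..<n} \<Longrightarrow> b i \<in> M"
    and "\<And>x i. x \<in> M \<Longrightarrow> i \<in> {..<n} \<times> {..<n} \<Longrightarrow> cf i x \<in> vn_algebra.Z M"
    and "\<And>x. x \<in> M \<Longrightarrow> x = (\<Sum>i\<in>{..<n} \<times> {..<n}. cf i x * b i)"
proof -
  obtain A :: "'k bop set" and \<phi> where vM: "von_neumann_algebra M" and vA: "von_neumann_algebra A"
    and comm: "\<And>a b. a \<in> A \<Longrightarrow> b \<in> A \<Longrightarrow> a * b = b * a" and iso: "\<phi> \<in> ring_iso (op_ring M) (op_mat_ring n A)"
    using assms unfolding type_I_algebra_def star_iso_to_mat_def by blast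
  interpret M: vn_algebra M by unfold_locales (rule vM)
  interpret A: vn_algebra A by unfold_locales (rule vA)
  let ?R = "{X \<in> carrier_mat n n. elements_mat X \<subseteq> A}"
  have R_iff: "X \<in> ?R \<longleftrightarrow> X \<in> carrier_mat n n \<and> (\<forall>i<n. \<forall>j<n. X $$ (i,j) \<in> A)" for X
    using elements_mat_carrier[of X n n A] by blast
  have hom: "\<phi> \<in> Ring.ring_hom (op_ring M) (op_mat_ring n A)" and bij: "bij_betw \<phi> M ?R"
    using iso by (auto simp: ring_iso_def op_ring_def op_mat_ring_def)
  have \<phi>R: "\<phi> x \<in> ?R" if "x \<in> M" for x using bij that by (auto simp: bij_betw_def)
  have mult: "\<phi> (x * y) = \<phi> x * \<phi> y" if "x \<in> M" "y \<in> M" for x y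
    using Ring.ring_hom_mult[OF hom] that by (simp add: op_ring_def op_mat_ring_def)
  have add: "\<phi> (x + y) = \<phi> x + \<phi> y" if "x \<in> M" "y \<in> M" for x y
    using Ring.ring_hom_add[OF hom] that by (simp add: op_ring_def op_mat_ring_def)
  have inj: "x = y" if "x \<in> M" "y \<in> M" "\<phi> x = \<phi> y" for x y
    using bij that by (auto simp: bij_betw_def inj_on_def)
  define inv\<phi> where "inv\<phi> = inv_into M \<phi>"
  have inv: "inv\<phi> X \<in> M" "\<phi> (inv\<phi> X) = X" if "X \<in> ?R" for X
    using bij that unfolding inv\<phi>_def bij_betw_def by (metis inv_into_into, metis f_inv_into_f)
  have dim: "\<phi> x \<in> carrier_mat n n" "\<And>i j. i < n \<Longrightarrow> j < n \<Longrightarrow> \<phi> x $$ (i,j) \<in> A" if "x \<in> M" for x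
    using \<phi>R[OF that] R_iff by blast+
  define E where "E i = mat n n (\<lambda>p. if p = i then 1 else (0::'k bop))" for i
  define S where "S a = mat n n (\<lambda>(i,j). if i = j then a else (0::'k bop))" for a
  have ER: "E i \<in> ?R" for i unfolding R_iff by (auto simp: E_def)
  have SR: "S a \<in> ?R" if "a \<in> A" for a unfolding R_iff using that by (auto simp: S_def)
  have S_entry: "(S a * X) $$ (i,j) = a * X $$ (i,j)" "(X * S a) $$ (i,j) = X $$ (i,j) * a"
    if "X \<in> carrier_mat n n" "i < n" "j < n" for X a i j
  proof -
    have "(S a * X) $$ (i,j) = (\<Sum>k\<in>{0..<n}. (if i = k then a else 0) * X $$ (k,j))"
      using that by (simp add: S_def scalar_prod_def)
    also have "\<dots> = (\<Sum>k\<in>{0..<n}. if k = i then a * X $$ (i,j) else 0)" by (rule sum.cong) auto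
    finally show "(S a * X) $$ (i,j) = a * X $$ (i,j)" using that by simp
    have "(X * S a) $$ (i,j) = (\<Sum>k\<in>{0..<n}. X $$ (i,k) * (if k = j then a else 0))"
      using that by (simp add: S_def scalar_prod_def)
    also have "\<dots> = (\<Sum>k\<in>{0..<n}. if k = j then X $$ (i,j) * a else 0)" by (rule sum.cong) auto
    finally show "(X * S a) $$ (i,j) = X $$ (i,j) * a" using that by simp
  qed
  have S_dim: "S a \<in> carrier_mat n n" for a by (simp add: S_def)
  let ?I = "{..<n} \<times> {..<n}"
  define b where "b i = inv\<phi> (E i)" for i
  define cf where "cf i x = inv\<phi> (S (\<phi> x $$ i))" for i x
  have bM: "b i \<in> M" for i unfolding b_def by (rule inv(1)[OF ER])
  have cfM: "cf i x \<in> M" "\<phi> (cf i x) = S (\<phi> x $$ i)" if "x \<in> M" "i \<in> ?I" for x i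
    unfolding cf_def using inv SR dim(2)[OF that(1)] that(2) by auto
  have cfZ: "cf i x \<in> M.Z" if x: "x \<in> M" "i \<in> ?I" for x i
  proof (rule M.ZI[OF cfM(1)[OF x]])
    fix y assume y: "y \<in> M"
    have a: "\<phi> x $$ i \<in> A" using dim(2)[OF x(1)] x(2) by auto
    have "\<phi> y * S (\<phi> x $$ i) = S (\<phi> x $$ i) * \<phi> y"
    proof (rule eq_matI)
      fix k l assume "k < dim_row (S (\<phi> x $$ i) * \<phi> y)" "l < dim_col (S (\<phi> x $$ i) * \<phi> y)"
      then have "k < n" "l < n" using dim(1)[OF y] by (auto simp: S_def)
      then show "(\<phi> y * S (\<phi> x $$ i)) $$ (k, l) = (S (\<phi> x $$ i) * \<phi> y) $$ (k, l)"
        using S_entry[OF dim(1)[OF y]] comm[OF a dim(2)[OF y]] by simp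
    qed (use dim(1)[OF y] in \<open>auto simp: S_def\<close>)
    then have "\<phi> (y * cf i x) = \<phi> (cf i x * y)" using mult cfM x y by simp
    then show "y * cf i x = cf i x * y" using inj M.mult_in cfM(1)[OF x] y by blast
  qed
  have zero_entry: "\<phi> 0 $$ (k,l) = 0" if "k < n" "l < n" for k l
  proof -
    have "\<phi> 0 = \<phi> 0 + \<phi> 0" using add[of 0 0] by simp
    then have "\<phi> 0 $$ (k,l) = (\<phi> 0 + \<phi> 0) $$ (k,l)" by simp
    also have "\<dots> = \<phi> 0 $$ (k,l) + \<phi> 0 $$ (k,l)" using dim(1)[OF M.zero_in] that by simp
    finally show ?thesis by simp
  qed
  have sum_entry: "\<phi> (sum g I) $$ (k,l) = (\<Sum>i\<in>I. \<phi> (g i) $$ (k,l))"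
    if "finite I" "\<And>i. i \<in> I \<Longrightarrow> g i \<in> M" "k < n" "l < n" for g and I :: "(nat \<times> nat) set" and k l
    using that(1,2)
  proof (induction I rule: finite_induct)
    case empty then show ?case using zero_entry that by simp
  next
    case (insert i I)
    have "sum g I \<in> M" using insert by (intro M.sum_in) auto
    then have "\<phi> (g i + sum g I) $$ (k,l) = \<phi> (g i) $$ (k,l) + \<phi> (sum g I) $$ (k,l)"
      using insert that add[of "g i" "sum g I"] dim(1)[of "sum g I"] by simp
    then show ?case using insert by simp
  qed
  have decomp: "x = (\<Sum>i\<in>?I. cf i x * b i)" if x: "x \<in> M" for x
  proof (rule inj[OF x])
    have gM: "cf i x * b i \<in> M" if "i \<in> ?I" for i by (rule M.mult_in[OF cfM(1)[OF x that] bM])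
    then show sM: "(\<Sum>i\<in>?I. cf i x * b i) \<in> M" by (rule M.sum_in)
    show "\<phi> x = \<phi> (\<Sum>i\<in>?I. cf i x * b i)"
    proof (rule eq_matI)
      fix k l assume "k < dim_row (\<phi> (\<Sum>i\<in>?I. cf i x * b i))" "l < dim_col (\<phi> (\<Sum>i\<in>?I. cf i x * b i))"
      then have kl: "k < n" "l < n" using dim(1)[OF sM] by auto
      have "\<phi> (\<Sum>i\<in>?I. cf i x * b i) $$ (k,l) = (\<Sum>i\<in>?I. \<phi> (cf i x * b i) $$ (k,l))"
        using gM kl by (intro sum_entry) auto
      also have "\<dots> = (\<Sum>i\<in>?I. if i = (k,l) then \<phi> x $$ (k,l) else 0)"
      proof (rule sum.cong[OF refl])
        fix i assume i: "i \<in> ?I"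
        have "\<phi> (cf i x * b i) = S (\<phi> x $$ i) * E i"
          using mult[OF cfM(1)[OF x i] bM] cfM(2)[OF x i] inv(2)[OF ER] by (simp add: b_def)
        then have "\<phi> (cf i x * b i) $$ (k,l) = \<phi> x $$ i * E i $$ (k,l)" using S_entry(1)[of "E i" k l] kl ER by simp
        then show "\<phi> (cf i x * b i) $$ (k,l) = (if i = (k,l) then \<phi> x $$ (k,l) else 0)" using kl
            by (auto simp: E_def)
      qed
      also have "\<dots> = \<phi> x $$ (k,l)" using kl by (simp add: sum.delta)
      finally show "\<phi> x $$ (k,l) = \<phi> (\<Sum>i\<in>?I. cf i x * b i) $$ (k,l)" by simp
    qed (use dim(1)[OF x] dim(1)[OF sM] in auto)
  qed
  show thesis by (rule that[of b cf]) (use bM cfZ decomp in blast)+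
qed

lemma similar_inE:
  assumes sim: "similar_in (op_mat_ring 2 M) A D"
  obtains X Y where "X \<in> carrier_mat 2 2" "Y \<in> carrier_mat 2 2" "elements_mat X \<subseteq> M" "elements_mat Y \<subseteq> M"
    "X * Y = 1\<^sub>m 2" "Y * X = 1\<^sub>m 2" "X * A * Y = D"
proof -
  let ?R = "op_mat_ring 2 M"
  obtain X where X: "X \<in> Units ?R" "X * A * inv\<^bsub>?R\<^esub> X = D"
    using sim unfolding similar_in_def by (auto simp: op_mat_ring_def)
  obtain Y where Y: "X \<in> carrier ?R" "Y \<in> carrier ?R" "Y \<otimes>\<^bsub>?R\<^esub> X = \<one>\<^bsub>?R\<^esub>" "X \<otimes>\<^bsub>?R\<^esub> Y = \<one>\<^bsub>?R\<^esub>"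
    using X(1) by (auto simp: Units_def)
  have "inv\<^bsub>?R\<^esub> X = Y" unfolding m_inv_def
  proof (rule the_equality)
    show "Y \<in> carrier ?R \<and> X \<otimes>\<^bsub>?R\<^esub> Y = \<one>\<^bsub>?R\<^esub> \<and> Y \<otimes>\<^bsub>?R\<^esub> X = \<one>\<^bsub>?R\<^esub>" using Y by simp
    fix Y' assume Y': "Y' \<in> carrier ?R \<and> X \<otimes>\<^bsub>?R\<^esub> Y' = \<one>\<^bsub>?R\<^esub> \<and> Y' \<otimes>\<^bsub>?R\<^esub> X = \<one>\<^bsub>?R\<^esub>"
    have c: "X \<in> carrier_mat 2 2" "Y \<in> carrier_mat 2 2" "Y' \<in> carrier_mat 2 2"
      and e: "X * Y = 1\<^sub>m 2" "Y' * X = 1\<^sub>m 2" using Y Y' by (auto simp: op_mat_ring_def)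
    have one: "W * 1\<^sub>m 2 = W" "1\<^sub>m 2 * W = W" if "W \<in> carrier_mat 2 2" for W :: "'a bop mat"
      using that by (intro eq_matI; auto simp: scalar_prod_def numeral_2_eq_2 less_Suc_eq)+
    have "Y' = Y' * (X * Y)" using one(1)[OF c(3)] e by simp
    also have "\<dots> = (Y' * X) * Y" using assoc_mult_mat[OF c(3) c(1) c(2)] by simp
    finally show "Y' = Y" using e one(2)[OF c(2)] by simp
  qed
  then show thesis using that[of X Y] X(2) Y by (auto simp: op_mat_ring_def)
qed

lemma similar_in_op_ringI:
  assumes M: "x \<in> M" "y \<in> M" "x * y = 1" "y * x = 1" and xA: "x * A * y = D"
  shows "similar_in (op_ring M) A D"
proof -
  have "inv\<^bsub>op_ring M\<^esub> x = y" unfolding m_inv_def op_ring_def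
  proof (rule the_equality, simp_all add: M)
    fix y' assume "y' \<in> M \<and> x * y' = 1 \<and> y' * x = 1"
    then show "y' = y" using M by (metis mult.assoc mult.left_neutral mult.right_neutral)
  qed
  moreover have "x \<in> Units (op_ring M)" using M by (auto simp: Units_def op_ring_def)
  ultimately show ?thesis unfolding similar_in_def using xA by (intro bexI[of _ x]) (simp_all add: op_ring_def)
qed

theorem theorem3p27:
  fixes n :: nat
    and M :: "'h::complex_hilbert bop set"
    and T1 T2 :: "'h bop"
  assumes "n \<ge> 1"
    and "type_I_algebra TYPE('k::complex_hilbert) n M"
    and "T1 \<in> M" and "T2 \<in> M"
    and "similar_in (op_mat_ring 2 M) (diag2 T1 T1) (diag2 T2 T2)"
    and "property_J M T1"
  shows "similar_in (op_ring M) T1 T2"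
proof -
  have vM: "von_neumann_algebra M" using assms(2) by (simp add: type_I_algebra_def)
  obtain b :: "nat \<times> nat \<Rightarrow> 'h bop" and cf
    where coords: "\<And>i. i \<in> {..<n} \<times> {..<n} \<Longrightarrow> b i \<in> M"
      "\<And>x i. x \<in> M \<Longrightarrow> i \<in> {..<n} \<times> {..<n} \<Longrightarrow> cf i x \<in> vn_algebra.Z M"
      "\<And>x. x \<in> M \<Longrightarrow> x = (\<Sum>i\<in>{..<n} \<times> {..<n}. cf i x * b i)"
    using type_I_coordinates[OF assms(2)] by blast
  obtain F where F: "bounded F" "abelian_idempotent_family (commutant {T1} \<inter> M) F"
    "\<And>G. abelian_idempotent_family (commutant {T1} \<inter> M) G \<Longrightarrow> F \<subseteq> G \<Longrightarrow> G = F"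
    using assms(6) unfolding property_J_def by blast
  obtain K where K: "\<And>q. q \<in> F \<Longrightarrow> norm q \<le> K" using F(1) by (auto simp: bounded_iff)
  obtain X Y where XY: "X \<in> carrier_mat 2 2" "Y \<in> carrier_mat 2 2" "elements_mat X \<subseteq> M" "elements_mat Y \<subseteq> M"
    "X * Y = 1\<^sub>m 2" "Y * X = 1\<^sub>m 2" "X * diag2 T1 T1 * Y = diag2 T2 T2"
    using assms(5) by (rule similar_inE)
  have inv: "m2_of X * m2_of Y = M2 1 0 0 1" "m2_of Y * m2_of X = M2 1 0 0 1"
    using m2_of_mult[OF XY(1,2)] m2_of_mult[OF XY(2,1)] XY(5,6) by (simp_all add: m2_of_one)
  have "m2_of X * M2 T1 0 0 T1 * m2_of Y = M2 T2 0 0 T2"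
    using arg_cong[OF XY(7), of m2_of] XY(1,2) diag2_carrier[of T1 T1]
    by (simp add: m2_of_mult m2_of_diag2 mult_carrier_mat[of X 2 2] mult.assoc)
  then have "m2_of X * M2 T1 0 0 T1 * (m2_of Y * m2_of X) = M2 T2 0 0 T2 * m2_of X"
    by (simp only: mult.assoc[symmetric])
  moreover have "A * M2 1 0 0 1 = A" for A :: "'h bop m2" by (cases A) simp
  ultimately have tw: "m2_of X * M2 T1 0 0 T1 = M2 T2 0 0 T2 * m2_of X" by (simp add: inv)
  interpret doubled_similarity M T1 F K "{..<n} \<times> {..<n}" b cf T2 "m2_of X" "m2_of Y"
  proof (unfold_locales)
    show "m00 (m2_of X) \<in> M" "m01 (m2_of X) \<in> M" "m10 (m2_of X) \<in> M" "m11 (m2_of X) \<in> M"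
      "m00 (m2_of Y) \<in> M" "m01 (m2_of Y) \<in> M" "m10 (m2_of Y) \<in> M" "m11 (m2_of Y) \<in> M"
      using XY(1-4) elements_mat_carrier by (simp_all add: m2_of_def elements_mat_carrier)
    show "finite ({..<n} \<times> {..<n})" by simp
  qed (fact vM assms(3,4) F(2) inv tw | erule K | erule (1) F(3) | erule coords(1) | erule (1) coords(2) |
      erule coords(3))+
  obtain x y where xy: "x \<in> M" "y \<in> M" "x * y = 1" "y * x = 1" "x * T1 = T2 * x" using similar by blast
  have "x * T1 * y = T2" using xy by (simp add: mult.assoc)
  then show ?thesis using similar_in_op_ringI xy by blast
qed

end
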